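(* Let $1\le p<\infty$, let $w$ be a $p$-admissible weight on $\mathbf{R}^n$ and $d\mu=w\,dx$. Let $\Omega=\mathbf{R}^n\setminus E$, where $\mu(E)=0$. Assume that $\Omega$ is $p$-path almost open in $\mathbf{R}^n$ (which in particular holds if $\Omega$ is open). Then the following statements are equivalent: (a) $E$ is removable for the Sobolev space $H^{1,p}(\Omega,\mu)$; (b) $E$ is removable for the Dirichlet space $L^{1,p}(\Omega,\mu)$; (c) $(\Omega,\mu)$ supports a global $p$-Poincaré inequality.
   Context: A weight $w$ on $\mathbf{R}^n$ is $p$-admissible if $d\mu=w\,dx$ is a globally doubling measure supporting a global $p$-Poincaré inequality on $\mathbf{R}^n$. Below, $Z$ denotes either $\mathbf{R}^n$ or $\Omega$, regarded as a metric space with the Euclidean distance and (the restriction of) $\mu$. Balls in $Z$ are open balls $B(x,r)=\{y\in Z:|x-y|<r\}$ with predetermined centre and radius, and $\lambda B=B(x,\lambda r)$. Curves are nonconstant, compact (i.e. defined on compact intervals) and rectifiable, and are parameterized by arc length, $\gamma:[0,l_\gamma]\to Z$. The $p$-modulus of a family $\Gamma$ of curves is $\inf_\rho\int_Z\rho^p\,d\mu$ over all Borel $\rho\ge 0$ with $\int_\gamma\rho\,ds\ge1$ for all $\gamma\in\Gamma$; a property holds for $p$-almost every curve if it fails only for a family of zero $p$-modulus. A Borel function $g:Z\to[0,\infty]$ is an upper gradient of $u:Z\to[-\infty,\infty]$ if $|u(\gamma(0))-u(\gamma(l_\gamma))|\le\int_\gamma g\,ds$ for all curves $\gamma$ in $Z$,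 where the left-hand side is considered to be $\infty$ if at least one of its terms is infinite. $N^{1,p}(Z)$ is the set of measurable $u:Z\to[-\infty,\infty]$ with $\int_Z|u|^p\,d\mu+\inf_g\int_Z g^p\,d\mu<\infty$, the infimum being over all upper gradients $g$ of $u$. $D^p(Z)$ is the set of measurable $u$ which are finite a.e. and have an upper gradient in $L^p(Z)$. Let $\widehat N^{1,p}(Z)=\{u:u=v \text{ a.e. for some } v\in N^{1,p}(Z)\}$ and $\widehat D^p(Z)=\{u:u=v\text{ a.e. for some }v\in D^p(Z)\}$. The weighted Sobolev space $H^{1,p}(Z,\mu)$ and Dirichlet space $L^{1,p}(Z,\mu)$ are interpreted as $\widehat N^{1,p}(Z)$ and $\widehat D^p(Z)$, respectively. $E$ is removable for $H^{1,p}(\Omega,\mu)$ if $\widehat N^{1,p}(\Omega)=\{u|_\Omega:u\in\widehat N^{1,p}(\mathbf{R}^n)\}$, and removable for $L^{1,p}(\Omega,\mu)$ if $\widehat D^p(\Omega)=\{u|_\Omega:u\in\widehat D^p(\mathbf{R}^n)\}$. The set $\Omega$ is $p$-path almost open in $\mathbf{R}^n$ if for $p$-almost every curve $\gamma:[0,l_\gamma]\to\mathbf{R}^n$ (modulus with respect to $\mu$), the set $\gamma^{-1}(\Omega)$ is the union of a (relatively) open subset of $[0,l_\gamma]$ and a set of zero 1-dimensional Lebesgue measure. $\mu$ is globally doubling if there is $C>0$ with $\mu(2B)\le C\mu(B)$ for all balls $B$. $(Z,\mu)$ supports a global $p$-Poincaré inequality if there are $C>0$ and $\lambda\ge1$ such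 that for all balls $B$ in $Z$ with radius $r_B$, all integrable functions $u$ on $\lambda B$ and all upper gradients $g$ of $u$ in $\lambda B$, $$\frac1{\mu(B)}\int_B|u-u_B|\,d\mu\le C r_B\biggl(\frac1{\mu(\lambda B)}\int_{\lambda B}g^p\,d\mu\biggr)^{1/p},\qquad u_B=\frac1{\mu(B)}\int_Bu\,d\mu .$$ *)

theory Defs
  imports "HOL-Analysis.Analysis"
begin

subsection \<open>Powers in the extended nonnegative reals\<close>

definition epowr :: "ennreal \<Rightarrow> real \<Rightarrow> ennreal" where
  "epowr a q = (if a = top then top else ennreal (enn2real a powr q))"
  \<comment> \<open>Used only for exponents \<open>q > 0\<close>.\<close>


subsection \<open>Weighted measures\<close>

definition weight :: "('a::euclidean_space \<Rightarrow> real) \<Rightarrow> bool" where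
  "weight w \<longleftrightarrow> w \<in> borel_measurable lebesgue \<and> (\<forall>x. 0 \<le> w x)"

text \<open>The completion matters only where \<open>w\<close> vanishes: every set of outer measure
  zero with respect to \<open>w dx\<close> is to be measurable.\<close>

definition weighted_measure :: "('a::euclidean_space \<Rightarrow> real) \<Rightarrow> 'a measure" where
  "weighted_measure w = completion (density lebesgue (\<lambda>x. ennreal (w x)))"

text \<open>Balls are required to have positive and finite measure, as usual for doubling
  measures; this is what makes the averages over balls below meaningful. For a
  weight, the upper bound says that \<open>w\<close> is locally integrable.\<close>

definition globally_doubling :: "'a::euclidean_space measure \<Rightarrow> bool" where
  "globally_doubling \<mu> \<longleftrightarrow>
     (\<forall>x r. 0 < r \<longrightarrow> 0 < emeasure \<mu> (ball x r) \<and> emeasure \<mu> (ball x r) < \<infinity>) \<and>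
     (\<exists>C>0. \<forall>x r. 0 < r \<longrightarrow>
        emeasure \<mu> (ball x (2 * r)) \<le> ennreal C * emeasure \<mu> (ball x r))"


subsection \<open>Curves and modulus\<close>

text \<open>A space \<open>Z\<close> is given as a subset of the ambient Euclidean space, with the
  restricted distance and measure.\<close>

definition curve_length :: "(real \<Rightarrow> 'a::metric_space) \<Rightarrow> real \<Rightarrow> real \<Rightarrow> ennreal" where
  "curve_length \<gamma> a b =
     (SUP (k, t) \<in> {(k::nat, t::nat \<Rightarrow> real). t 0 = a \<and> t k = b \<and> (\<forall>i<k. t i \<le> t (Suc i))}.
        \<Sum>i<k. ennreal (dist (\<gamma> (t i)) (\<gamma> (t (Suc i)))))"

text \<open>A curve is a pair of a map and the right end point \<open>l\<close> of its parameter
  interval \<open>{0..l}\<close>; the values of the map outside \<open>{0..l}\<close> are irrelevant. The last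
  condition is parameterization by arc length; it entails rectifiability, and
  with \<open>l > 0\<close> also that the curve is nonconstant.\<close>

definition curves :: "'a::metric_space set \<Rightarrow> ((real \<Rightarrow> 'a) \<times> real) set" where
  "curves Z = {(\<gamma>, l). 0 < l \<and> continuous_on {0..l} \<gamma> \<and> \<gamma> ` {0..l} \<subseteq> Z \<and>
     (\<forall>t\<in>{0..l}. curve_length \<gamma> 0 t = ennreal t)}"

definition line_integral :: "('a \<Rightarrow> ennreal) \<Rightarrow> (real \<Rightarrow> 'a) \<Rightarrow> real \<Rightarrow> ennreal" where
  "line_integral \<rho> \<gamma> l = (\<integral>\<^sup>+t\<in>{0..l}. \<rho> (\<gamma> t) \<partial>lborel)"

definition modulus ::
  "real \<Rightarrow> 'a::euclidean_space measure \<Rightarrow> 'a set \<Rightarrow> ((real \<Rightarrow> 'a) \<times> real) set \<Rightarrow> ennreal" where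
  "modulus p \<mu> Z \<Gamma> =
     (INF \<rho> \<in> {\<rho> \<in> borel_measurable (restrict_space borel Z).
                 \<forall>(\<gamma>, l)\<in>\<Gamma>. 1 \<le> line_integral \<rho> \<gamma> l}.
        \<integral>\<^sup>+x\<in>Z. epowr (\<rho> x) p \<partial>\<mu>)"

definition path_almost_open :: "real \<Rightarrow> 'a::euclidean_space measure \<Rightarrow> 'a set \<Rightarrow> bool" where
  "path_almost_open p \<mu> \<Omega> \<longleftrightarrow>
     modulus p \<mu> UNIV {(\<gamma>, l) \<in> curves UNIV.
        \<not> (\<exists>U N. openin (top_of_set {0..l}) U \<and> N \<in> null_sets lebesgue \<and>
               {t\<in>{0..l}. \<gamma> t \<in> \<Omega>} = U \<union> N)} = 0"


subsection \<open>Upper gradients and the Poincare inequality\<close>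

definition upper_gradient ::
  "'a::euclidean_space set \<Rightarrow> ('a \<Rightarrow> ereal) \<Rightarrow> ('a \<Rightarrow> ennreal) \<Rightarrow> bool" where
  "upper_gradient Z u g \<longleftrightarrow> g \<in> borel_measurable (restrict_space borel Z) \<and>
     (\<forall>(\<gamma>, l)\<in>curves Z.
        (if \<bar>u (\<gamma> 0)\<bar> = \<infinity> \<or> \<bar>u (\<gamma> l)\<bar> = \<infinity> then top else e2ennreal \<bar>u (\<gamma> 0) - u (\<gamma> l)\<bar>)
          \<le> line_integral g \<gamma> l)"

definition integrable_ereal_on :: "'a measure \<Rightarrow> 'a set \<Rightarrow> ('a \<Rightarrow> ereal) \<Rightarrow> bool" where
  "integrable_ereal_on \<mu> A u \<longleftrightarrow>
     u \<in> borel_measurable (restrict_space \<mu> A) \<and> (\<integral>\<^sup>+x\<in>A. e2ennreal \<bar>u x\<bar> \<partial>\<mu>) < \<infinity>"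

text \<open>The mean value of an integrable extended real-valued function. Such a function is
  finite a.e., so sending the values \<open>\<plusminus>\<infinity>\<close> to \<open>0\<close> does not change its integral.\<close>

definition average :: "'a measure \<Rightarrow> 'a set \<Rightarrow> ('a \<Rightarrow> ereal) \<Rightarrow> real" where
  "average \<mu> B u = (\<integral>x\<in>B. real_of_ereal (u x) \<partial>\<mu>) / measure \<mu> B"

definition supports_poincare :: "real \<Rightarrow> 'a::euclidean_space measure \<Rightarrow> 'a set \<Rightarrow> bool" where
  "supports_poincare p \<mu> Z \<longleftrightarrow>
     (\<exists>C>0. \<exists>L\<ge>1. \<forall>x\<in>Z. \<forall>r>0. \<forall>u g.
        let B = Z \<inter> ball x r; B' = Z \<inter> ball x (L * r)
        in integrable_ereal_on \<mu> B' u \<longrightarrow> upper_gradient B' u g \<longrightarrow>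
             (\<integral>\<^sup>+y\<in>B. e2ennreal \<bar>u y - ereal (average \<mu> B u)\<bar> \<partial>\<mu>) / emeasure \<mu> B
               \<le> ennreal (C * r)
                  * epowr ((\<integral>\<^sup>+y\<in>B'. epowr (g y) p \<partial>\<mu>) / emeasure \<mu> B') (1 / p))"

definition p_admissible :: "real \<Rightarrow> ('a::euclidean_space \<Rightarrow> real) \<Rightarrow> bool" where
  "p_admissible p w \<longleftrightarrow> weight w \<and> globally_doubling (weighted_measure w) \<and>
     supports_poincare p (weighted_measure w) UNIV"


subsection \<open>Sobolev and Dirichlet spaces\<close>

text \<open>Functions \<open>Z \<rightarrow> [-\<infinity>, \<infinity>]\<close> are represented by elements of \<^term>\<open>extensional Z\<close>, so that
  restriction to \<open>\<Omega>\<close> is \<^const>\<open>restrict\<close> and equality of function spaces on \<open>Z\<close> is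
  equality of sets.\<close>

definition newtonian ::
  "real \<Rightarrow> 'a::euclidean_space measure \<Rightarrow> 'a set \<Rightarrow> ('a \<Rightarrow> ereal) set" where
  "newtonian p \<mu> Z = {u \<in> extensional Z. u \<in> borel_measurable (restrict_space \<mu> Z) \<and>
     (\<integral>\<^sup>+x\<in>Z. epowr (e2ennreal \<bar>u x\<bar>) p \<partial>\<mu>)
       + (INF g \<in> {g. upper_gradient Z u g}. \<integral>\<^sup>+x\<in>Z. epowr (g x) p \<partial>\<mu>) < \<infinity>}"

definition dirichlet ::
  "real \<Rightarrow> 'a::euclidean_space measure \<Rightarrow> 'a set \<Rightarrow> ('a \<Rightarrow> ereal) set" where
  "dirichlet p \<mu> Z = {u \<in> extensional Z. u \<in> borel_measurable (restrict_space \<mu> Z) \<and>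
     (AE x in \<mu>. x \<in> Z \<longrightarrow> \<bar>u x\<bar> \<noteq> \<infinity>) \<and>
     (\<exists>g. upper_gradient Z u g \<and> (\<integral>\<^sup>+x\<in>Z. epowr (g x) p \<partial>\<mu>) < \<infinity>)}"

definition ae_class ::
  "'a measure \<Rightarrow> 'a set \<Rightarrow> ('a \<Rightarrow> ereal) set \<Rightarrow> ('a \<Rightarrow> ereal) set" where
  "ae_class \<mu> Z F = {u \<in> extensional Z. \<exists>v\<in>F. AE x in \<mu>. x \<in> Z \<longrightarrow> u x = v x}"

definition sobolev_space ::
  "real \<Rightarrow> 'a::euclidean_space measure \<Rightarrow> 'a set \<Rightarrow> ('a \<Rightarrow> ereal) set" where
  "sobolev_space p \<mu> Z = ae_class \<mu> Z (newtonian p \<mu> Z)"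

definition dirichlet_space ::
  "real \<Rightarrow> 'a::euclidean_space measure \<Rightarrow> 'a set \<Rightarrow> ('a \<Rightarrow> ereal) set" where
  "dirichlet_space p \<mu> Z = ae_class \<mu> Z (dirichlet p \<mu> Z)"

definition removable_sobolev :: "real \<Rightarrow> 'a::euclidean_space measure \<Rightarrow> 'a set \<Rightarrow> bool" where
  "removable_sobolev p \<mu> E \<longleftrightarrow>
     sobolev_space p \<mu> (- E) = (\<lambda>u. restrict u (- E)) ` sobolev_space p \<mu> UNIV"

definition removable_dirichlet :: "real \<Rightarrow> 'a::euclidean_space measure \<Rightarrow> 'a set \<Rightarrow> bool" where
  "removable_dirichlet p \<mu> E \<longleftrightarrow>
     dirichlet_space p \<mu> (- E) = (\<lambda>u. restrict u (- E)) ` dirichlet_space p \<mu> UNIV"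

end

theory Submission
  imports Defs
begin

text \<open>
  Write \<open>\<Omega>\<close> for the complement of the null set \<open>E\<close>. Removability means that every function of the
  space on \<open>\<Omega>\<close> agrees almost everywhere with one of the space on \<open>\<real>\<^sup>n\<close>
  (\<open>ae_class_eq_restrictions_iff\<close>). The three statements are proved in a cycle: a Poincare
  inequality on \<open>\<Omega>\<close> makes \<open>E\<close> removable for the Dirichlet space, this makes it removable for the
  Sobolev space, and this implies the Poincare inequality. The middle step is immediate, since an
  extension across a null set has the same \<open>L\<^sup>p\<close> norm.

  For the first step (\<open>dirichlet_extension\<close>), let \<open>u\<close> be a Dirichlet function on \<open>\<Omega>\<close> with upper gradient
  \<open>g\<close>. As \<open>E\<close> is a null set, \<open>u\<close> and \<open>g\<close> satisfy a Poincare inequality on the balls of \<open>\<real>\<^sup>n\<close>. It bounds the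
  difference of the means of \<open>u\<close> over balls of radius \<open>r\<close> around two points at distance less than
  \<open>r\<close> by \<open>r\<close> times the \<open>1 / p\<close>-th power of an average of \<open>g\<^sup>p\<close> around any point nearby. Cutting
  a curve into pieces of length about \<open>r\<close>, one finds that the means vary along the curve by at most a
  constant times the line integral of these powers. As \<open>r\<close> tends to zero along a suitable sequence,
  the means tend to \<open>u\<close> almost everywhere, and the averages tend to \<open>g\<^sup>p\<close> in \<open>L\<^sup>1\<close> so fast that the line
  integrals converge on almost every curve. So the upper limit of the means is an extension of \<open>u\<close>,
  up to a null set, that has a multiple of \<open>g\<close> as upper gradient after a negligible enlargement
  of \<open>g\<close> (\<open>upper_gradient_of_poincare_pair\<close>).

  For the last step (\<open>poincare_if_newtonian_extension\<close>), let \<open>u\<close> be a bounded function on the part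
  of a ball in \<open>\<Omega>\<close>, with upper gradient \<open>g\<close>. After multiplication by a cutoff function it
  extends to a Sobolev function \<open>v\<close> on \<open>\<real>\<^sup>n\<close>, about whose upper gradient \<open>h\<close> nothing is known except
  that it lies in \<open>L\<^sup>p\<close>. But \<open>h\<close> makes \<open>v\<close> absolutely continuous along almost every curve, and by path
  almost openness almost every curve is in \<open>\<Omega>\<close> on an open set of parameters of full measure, where
  \<open>g\<close> controls the variation of \<open>v\<close>. Therefore \<open>g\<close> controls it on the whole curve
  (\<open>osc_le_integral_if_le_on_open\<close>, \<open>restriction_gradient_is_weak_gradient\<close>), and the Poincare
  inequality of \<open>\<real>\<^sup>n\<close> for \<open>v\<close> becomes one for \<open>u\<close> with the same \<open>g\<close>.

  Exceptional families of curves are represented throughout by one Borel function with finite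
  energy whose line integrals over them are infinite; the maximum of a function and a small
  multiple of it turns an estimate on almost every curve into an upper gradient.
\<close>

section \<open>Powers of extended nonnegative reals\<close>

lemma epowr_ennreal: "0 \<le> x \<Longrightarrow> epowr (ennreal x) q = ennreal (x powr q)"
  by (simp add: epowr_def)

lemma epowr_top [simp]: "epowr top q = top"
  by (simp add: epowr_def)

lemma epowr_0 [simp]: "epowr 0 q = 0"
  by (simp add: epowr_def)

lemma epowr_mono: "0 < q \<Longrightarrow> a \<le> b \<Longrightarrow> epowr a q \<le> epowr b q"
  by (cases a; cases b) (auto simp: epowr_ennreal powr_mono2 top_unique)

lemma epowr_epowr: "0 < q \<Longrightarrow> 0 < r \<Longrightarrow> epowr (epowr a q) r = epowr a (q * r)"
  by (cases a) (auto simp: epowr_ennreal powr_powr)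

lemma epowr_1 [simp]: "epowr a 1 = a"
  by (cases a) (auto simp: epowr_ennreal)

lemma epowr_inverse: "0 < q \<Longrightarrow> epowr (epowr a q) (1 / q) = a" "0 < q \<Longrightarrow> epowr (epowr a (1 / q)) q = a"
  by (simp_all add: epowr_epowr)

lemma epowr_le_iff: "0 < q \<Longrightarrow> epowr a q \<le> b \<longleftrightarrow> a \<le> epowr b (1 / q)"
  using epowr_mono[of q a "epowr b (1/q)"] epowr_mono[of "1/q" "epowr a q" b] epowr_inverse
  by auto

lemma epowr_mult: "0 < q \<Longrightarrow> epowr (a * b) q = epowr a q * epowr b q"
  by (cases a; cases b)
    (auto simp: epowr_ennreal powr_mult ennreal_mult_top ennreal_top_mult simp flip: ennreal_mult
      split: if_splits)

lemma epowr_lt_top: "a < top \<Longrightarrow> epowr a q < top"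
  by (cases a) (auto simp: epowr_ennreal)

lemma epowr_eq_0_iff [simp]: "epowr a q = 0 \<longleftrightarrow> a = 0"
  by (cases a) (auto simp: epowr_ennreal)

lemma measurable_epowr [measurable]: "(\<lambda>a. epowr a q) \<in> borel_measurable borel"
  unfolding epowr_def by measurable

text \<open>When countably many \<open>L\<^sup>p\<close> functions have to be dominated by a single one, their supremum is
  the convenient choice: its \<open>p\<close>-th power is at most the sum of the \<open>p\<close>-th powers, so the energies
  simply add up.\<close>

lemma nn_integral_epowr_SUP_le:
  assumes [measurable]: "\<And>i. f i \<in> borel_measurable M" and q: "0 < q"
  shows "(\<integral>\<^sup>+x. epowr (SUP i::nat. f i x) q \<partial>M) \<le> (\<Sum>i. \<integral>\<^sup>+x. epowr (f i x) q \<partial>M)"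
proof -
  have "epowr (SUP i. f i x) q \<le> (\<Sum>i. epowr (f i x) q)" for x
  proof (subst epowr_le_iff[OF q], rule SUP_least)
    fix i
    have "epowr (f i x) q \<le> (\<Sum>i. epowr (f i x) q)"
      using sum_le_suminf[of "\<lambda>i. epowr (f i x) q" "{i}"] by simp
    then show "f i x \<le> epowr (\<Sum>i. epowr (f i x) q) (1 / q)"
      by (subst epowr_le_iff[OF q, symmetric])
  qed
  then have "(\<integral>\<^sup>+x. epowr (SUP i. f i x) q \<partial>M) \<le> (\<integral>\<^sup>+x. (\<Sum>i. epowr (f i x) q) \<partial>M)"
    by (intro nn_integral_mono) auto
  also have "\<dots> = (\<Sum>i. \<integral>\<^sup>+x. epowr (f i x) q \<partial>M)"
    by (intro nn_integral_suminf) auto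
  finally show ?thesis .
qed

text \<open>This is the form in which fast convergence in \<open>L\<^sup>p\<close> is used for curves: if \<open>S\<close> is the supremum
  below, then along every curve on which \<open>S\<close> is integrable the line integral of \<open>f j\<close> is at most
  \<open>1 / (j + 1)\<close> times that of \<open>S\<close>, and the remaining curves are negligible because \<open>S\<close> lies
  in \<open>L\<^sup>p\<close>.\<close>

lemma nn_integral_epowr_weighted_SUP_finite:
  assumes [measurable]: "\<And>j. f j \<in> borel_measurable M" and q: "0 < q"
    and small: "\<And>j. (\<integral>\<^sup>+x. epowr (f j x) q \<partial>M) \<le> ennreal ((1/2)^j / real (Suc j) powr q)"
  shows "(\<integral>\<^sup>+x. epowr (SUP j. of_nat (Suc j) * f j x) q \<partial>M) < \<infinity>"
proof -
  have "(\<integral>\<^sup>+x. epowr (SUP j. of_nat (Suc j) * f j x) q \<partial>M)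
      \<le> (\<Sum>j. \<integral>\<^sup>+x. epowr (of_nat (Suc j) * f j x) q \<partial>M)"
    by (rule nn_integral_epowr_SUP_le) (use q in measurable)
  also have "\<dots> \<le> (\<Sum>j. ennreal ((1/2)^j))"
  proof (intro suminf_le)
    fix j
    have "(\<integral>\<^sup>+x. epowr (of_nat (Suc j) * f j x) q \<partial>M) = (\<integral>\<^sup>+x. ennreal (real (Suc j) powr q) * epowr (f j x) q \<partial>M)"
      using q by (simp add: epowr_mult ennreal_of_nat_eq_real_of_nat epowr_ennreal del: of_nat_Suc)
    also have "\<dots> = ennreal (real (Suc j) powr q) * (\<integral>\<^sup>+x. epowr (f j x) q \<partial>M)" by (rule nn_integral_cmult) simp
    also have "\<dots> \<le> ennreal (real (Suc j) powr q) * ennreal ((1/2)^j / real (Suc j) powr q)"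
      by (rule mult_left_mono[OF small]) simp
    also have "\<dots> = ennreal ((1/2)^j)" by (subst ennreal_mult[symmetric]) auto
    finally show "(\<integral>\<^sup>+x. epowr (of_nat (Suc j) * f j x) q \<partial>M) \<le> ennreal ((1/2)^j)" .
  qed auto
  also have "\<dots> < \<infinity>" using summable_geometric[of "1/2::real"] by (subst suminf_ennreal2) auto
  finally show ?thesis .
qed

lemma epowr_max_le:
  assumes "0 < q" shows "epowr (max a b) q \<le> epowr a q + epowr b q"
  by (auto simp: max_def add_increasing add_increasing2)

lemma nn_integral_epowr_max_le:
  assumes [measurable]: "f \<in> borel_measurable M" "g \<in> borel_measurable M" and q: "0 < q"
  shows "(\<integral>\<^sup>+x. epowr (max (f x) (g x)) q \<partial>M) \<le> (\<integral>\<^sup>+x. epowr (f x) q \<partial>M) + (\<integral>\<^sup>+x. epowr (g x) q \<partial>M)"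
proof -
  have "(\<integral>\<^sup>+x. epowr (max (f x) (g x)) q \<partial>M) \<le> (\<integral>\<^sup>+x. epowr (f x) q + epowr (g x) q \<partial>M)"
    by (intro nn_integral_mono epowr_max_le q)
  then show ?thesis by (simp add: nn_integral_add)
qed

lemma nn_integral_epowr_max_finite:
  assumes "f \<in> borel_measurable M" "g \<in> borel_measurable M" "0 < q"
    and "(\<integral>\<^sup>+x. epowr (f x) q \<partial>M) < \<infinity>" "(\<integral>\<^sup>+x. epowr (g x) q \<partial>M) < \<infinity>"
  shows "(\<integral>\<^sup>+x. epowr (max (f x) (g x)) q \<partial>M) < \<infinity>"
  using assms(4,5) by (intro le_less_trans[OF nn_integral_epowr_max_le[OF assms(1-3)]]) simp

lemma nn_integral_epowr_infinity_null_set: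
  assumes "F \<in> null_sets M"
  shows "(\<integral>\<^sup>+x. epowr (\<infinity> * indicator F x) q \<partial>M) = 0"
proof -
  have "(\<integral>\<^sup>+x. epowr (\<infinity> * indicator F x) q \<partial>M) = (\<integral>\<^sup>+x. 0 \<partial>M)"
    using AE_not_in[OF assms] by (intro nn_integral_cong_AE) auto
  then show ?thesis by simp
qed


section \<open>Upper gradients along subcurves\<close>

text \<open>The left-hand side of the upper gradient inequality. It is infinite as soon as one value is, even
  for equal infinite values, but the triangle inequality survives; this is all that is needed to
  add up estimates over the pieces of a curve.\<close>

definition osc :: "ereal \<Rightarrow> ereal \<Rightarrow> ennreal" where
  "osc s t = (if \<bar>s\<bar> = \<infinity> \<or> \<bar>t\<bar> = \<infinity> then top else e2ennreal \<bar>s - t\<bar>)"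

lemma osc_ereal [simp]: "osc (ereal a) (ereal b) = ennreal \<bar>a - b\<bar>"
  by (simp add: osc_def e2ennreal_ereal)

lemma osc_infinite [simp]: "osc \<infinity> t = top" "osc (-\<infinity>) t = top" "osc t \<infinity> = top" "osc t (-\<infinity>) = top"
  by (simp_all add: osc_def)

lemma osc_triangle: "osc a c \<le> osc a b + osc b c"
  by (cases a; cases b; cases c) (auto simp: ennreal_plus[symmetric] simp del: ennreal_plus)

lemma osc_commute: "osc a b = osc b a"
  by (cases a; cases b) (auto simp: abs_minus_commute)

lemma upper_gradient_osc:
  "upper_gradient Z u g \<longleftrightarrow> g \<in> borel_measurable (restrict_space borel Z) \<and>
     (\<forall>(\<gamma>, l)\<in>curves Z. osc (u (\<gamma> 0)) (u (\<gamma> l)) \<le> line_integral g \<gamma> l)"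
  unfolding upper_gradient_def osc_def ..

lemma osc_chain_le_sum:
  assumes "0 < n"
  shows "osc (f (0::nat)) (f n) \<le> (\<Sum>i<n. osc (f i) (f (Suc i)))"
  using assms
proof (induction n rule: nat_induct_non_zero)
  case (Suc n)
  have "osc (f 0) (f (Suc n)) \<le> osc (f 0) (f n) + osc (f n) (f (Suc n))" by (rule osc_triangle)
  also have "\<dots> \<le> (\<Sum>i<n. osc (f i) (f (Suc i))) + osc (f n) (f (Suc n))"
    by (rule add_right_mono[OF Suc.IH])
  finally show ?case by simp
qed simp


lemma interval_nn_integral_add:
  fixes F :: "real \<Rightarrow> ennreal"
  assumes [measurable]: "F \<in> borel_measurable borel" and "a \<le> b" "b \<le> c"
  shows "(\<integral>\<^sup>+t\<in>{a..c}. F t \<partial>lborel) = (\<integral>\<^sup>+t\<in>{a..b}. F t \<partial>lborel) + (\<integral>\<^sup>+t\<in>{b..c}. F t \<partial>lborel)"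
proof -
  have "(\<integral>\<^sup>+t\<in>{a..c}. F t \<partial>lborel) = (\<integral>\<^sup>+t. F t * indicator {a..b} t + F t * indicator {b..c} t \<partial>lborel)"
    using AE_lborel_singleton[of b] assms
    by (intro nn_integral_cong_AE) (auto elim!: eventually_mono simp: indicator_def)
  also have "\<dots> = (\<integral>\<^sup>+t\<in>{a..b}. F t \<partial>lborel) + (\<integral>\<^sup>+t\<in>{b..c}. F t \<partial>lborel)"
    by (rule nn_integral_add) auto
  finally show ?thesis .
qed

lemma interval_nn_integral_chain:
  fixes F :: "real \<Rightarrow> ennreal"
  assumes [measurable]: "F \<in> borel_measurable borel" and mono: "\<And>i. i < n \<Longrightarrow> t i \<le> t (Suc i)"
  shows "(\<Sum>i<n. \<integral>\<^sup>+s\<in>{t i..t (Suc i)}. F s \<partial>lborel) = (\<integral>\<^sup>+s\<in>{t 0..t n}. F s \<partial>lborel)"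
  using mono
proof (induction n)
  case 0
  have "{t 0} \<in> null_sets lborel" by (simp add: null_sets_def)
  then show ?case by (simp add: nn_integral_null_set)
next
  case (Suc n)
  have "t 0 \<le> t i" if "i \<le> n" for i
    using that
  proof (induction i)
    case (Suc i)
    then show ?case using Suc.prems(1) \<open>\<And>i. i < Suc n \<Longrightarrow> t i \<le> t (Suc i)\<close>[of i] by auto
  qed simp
  then have "t 0 \<le> t n" by auto
  then show ?case using Suc by (simp add: interval_nn_integral_add[of F "t 0" "t n" "t (Suc n)"])
qed


lemma partition_bounds:
  assumes "t 0 = a" "t k = b" "\<forall>i<k. t i \<le> t (Suc i)" "i \<le> (k::nat)"
  shows "a \<le> t i \<and> t i \<le> (b::real)"
proof -
  have "t i \<le> t j" if "i \<le> j" "j \<le> k" for i j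
    using that
  proof (induction j)
    case (Suc j)
    then show ?case using assms(3) by (cases "i = Suc j") (auto intro: order_trans)
  qed simp
  from this[of 0 i] this[of i k] assms show ?thesis by auto
qed

text \<open>A partition of \<open>[0, s]\<close> extended by the point \<open>t\<close> is a partition of \<open>[0, t]\<close>, so the length of the
  curve grows by at least the chord.\<close>

lemma curve_dist_le:
  assumes c: "(\<gamma>, l) \<in> curves Z" and st: "0 \<le> s" "s \<le> t" "t \<le> l"
  shows "dist (\<gamma> s) (\<gamma> t) \<le> t - s"
proof -
  let ?P = "\<lambda>a b. {(k::nat, t::nat \<Rightarrow> real). t 0 = a \<and> t k = b \<and> (\<forall>i<k. t i \<le> t (Suc i))}"
  let ?S = "\<lambda>(k::nat, t::nat \<Rightarrow> real). \<Sum>i<k. ennreal (dist (\<gamma> (t i)) (\<gamma> (t (Suc i))))"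
  have len: "curve_length \<gamma> 0 s = ennreal s" "curve_length \<gamma> 0 t = ennreal t"
    using c st by (auto simp: curves_def)
  have ne: "?P 0 s \<noteq> {}"
    using st by (intro ex_in_conv[THEN iffD1] exI[of _ "(1, \<lambda>i. if i = 0 then 0 else s)"]) auto
  have "ennreal (dist (\<gamma> s) (\<gamma> t)) + ennreal s = (SUP q\<in>?P 0 s. ennreal (dist (\<gamma> s) (\<gamma> t)) + ?S q)"
    unfolding len(1)[symmetric] curve_length_def by (rule ennreal_SUP_add_right[OF ne])
  also have "\<dots> \<le> ennreal t"
  proof (intro SUP_least)
    fix q assume "q \<in> ?P 0 s"
    then obtain k \<tau> where q: "q = (k, \<tau>)" "\<tau> 0 = 0" "\<tau> k = s" "\<forall>i<k. \<tau> i \<le> \<tau> (Suc i)" by auto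
    have "?S (Suc k, \<tau>(Suc k := t)) \<le> curve_length \<gamma> 0 t"
      unfolding curve_length_def using q st
      by (intro SUP_upper) (auto simp: less_Suc_eq)
    moreover have "?S (Suc k, \<tau>(Suc k := t)) = ennreal (dist (\<gamma> s) (\<gamma> t)) + ?S q"
    proof -

      have "(\<Sum>i<k. ennreal (dist (\<gamma> ((\<tau>(Suc k := t)) i)) (\<gamma> ((\<tau>(Suc k := t)) (Suc i)))))
          = (\<Sum>i<k. ennreal (dist (\<gamma> (\<tau> i)) (\<gamma> (\<tau> (Suc i)))))"
        by (rule sum.cong) auto
      then show ?thesis
        unfolding q(1) prod.case sum.lessThan_Suc using q(3) by (simp del: sum_ennreal add: add.commute)
    qed
    ultimately show "ennreal (dist (\<gamma> s) (\<gamma> t)) + ?S q \<le> ennreal t" using len by simp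
  qed
  finally have "ennreal (dist (\<gamma> s) (\<gamma> t) + s) \<le> ennreal t" using st by (subst ennreal_plus) auto
  then show ?thesis using st by (subst (asm) ennreal_le_iff) auto
qed

lemma telescope_ennreal:
  assumes "\<And>i. i < k \<Longrightarrow> t i \<le> t (Suc i)"
  shows "(\<Sum>i<k. ennreal (t (Suc i) - t i)) = ennreal (t k - t (0::nat))"
  by (subst sum_ennreal) (auto simp: assms sum_lessThan_telescope)

text \<open>The length of a piece is at most its parameter length because the curve is 1-Lipschitz. It is at
  least that, since every partition of \<open>[0, a + t]\<close> may be split at \<open>a\<close>: the part before \<open>a\<close>
  contributes at most \<open>a\<close>, so the part after \<open>a\<close> has to contribute the rest.\<close>

lemma subcurve:
  assumes c: "(\<gamma>, l) \<in> curves Z" and ab: "0 \<le> a" "a < b" "b \<le> l" and im: "\<gamma> ` {a..b} \<subseteq> Z'"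
  shows "((\<lambda>t. \<gamma> (a + t)), b - a) \<in> curves Z'"
proof -
  let ?\<gamma> = "\<lambda>t. \<gamma> (a + t)"
  have cont: "continuous_on {0..l} \<gamma>" using c by (simp add: curves_def)
  have "continuous_on {0..b - a} ?\<gamma>"
    by (rule continuous_on_compose2[OF cont]) (use ab in \<open>auto intro!: continuous_intros\<close>)
  moreover have "curve_length ?\<gamma> 0 t = ennreal t" if t: "t \<in> {0..b - a}" for t
  proof (rule antisym)
    show "curve_length ?\<gamma> 0 t \<le> ennreal t"
      unfolding curve_length_def
    proof (intro SUP_least)
      fix q :: "nat \<times> (nat \<Rightarrow> real)"
      assume "q \<in> {(k, t'). t' 0 = 0 \<and> t' k = t \<and> (\<forall>i<k. t' i \<le> t' (Suc i))}"
      then obtain k \<tau> where q: "q = (k, \<tau>)" and tau: "t = \<tau> k" "\<forall>i<k. \<tau> i \<le> \<tau> (Suc i)" "\<tau> 0 = 0"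
        by auto
      have bd: "0 \<le> \<tau> i \<and> \<tau> i \<le> t" if "i \<le> k" for i
        using partition_bounds[of \<tau> 0 k t i] tau that by auto
      have "(\<Sum>i<k. ennreal (dist (\<gamma> (a + \<tau> i)) (\<gamma> (a + \<tau> (Suc i))))) \<le> (\<Sum>i<k. ennreal (\<tau> (Suc i) - \<tau> i))"
      proof (intro sum_mono ennreal_leI)
        fix i assume "i \<in> {..<k}"
        then show "dist (\<gamma> (a + \<tau> i)) (\<gamma> (a + \<tau> (Suc i))) \<le> \<tau> (Suc i) - \<tau> i"
          using curve_dist_le[OF c, of "a + \<tau> i" "a + \<tau> (Suc i)"] bd[of i] bd[of "Suc i"] tau ab t by auto
      qed
      then show "(case q of (k, \<tau>) \<Rightarrow> \<Sum>i<k. ennreal (dist (\<gamma> (a + \<tau> i)) (\<gamma> (a + \<tau> (Suc i))))) \<le> ennreal t"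
        using telescope_ennreal[of k \<tau>] tau(2) unfolding q prod.case tau(1) tau(3)
        by (simp only: diff_zero)
    qed
    have "ennreal (a + t) = curve_length \<gamma> 0 (a + t)" using c t ab by (auto simp: curves_def)
    also have "\<dots> \<le> ennreal a + curve_length ?\<gamma> 0 t"
      unfolding curve_length_def[of \<gamma>]
    proof (intro SUP_least)
      fix q :: "nat \<times> (nat \<Rightarrow> real)"
      assume "q \<in> {(k, t'). t' 0 = 0 \<and> t' k = a + t \<and> (\<forall>i<k. t' i \<le> t' (Suc i))}"
      then obtain k \<tau> where q: "q = (k, \<tau>)" and tau: "\<tau> k = a + t" "\<forall>i<k. \<tau> i \<le> \<tau> (Suc i)" "\<tau> 0 = 0"
        by auto
      have bd: "0 \<le> \<tau> i \<and> \<tau> i \<le> a + t" if "i \<le> k" for i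
        using partition_bounds[of \<tau> 0 k "a + t" i] tau that by auto
      (* the partition points up to a and those from a on; each sequence is stationary at a on the other side *)
      let ?m = "\<lambda>i. min (\<tau> i) a" and ?M = "\<lambda>i. max (\<tau> i) a"
      have "(\<Sum>i<k. ennreal (dist (\<gamma> (\<tau> i)) (\<gamma> (\<tau> (Suc i)))))
          \<le> (\<Sum>i<k. ennreal (?m (Suc i) - ?m i) + ennreal (dist (\<gamma> (?M i)) (\<gamma> (?M (Suc i)))))"
      proof (intro sum_mono)
        fix i assume i: "i \<in> {..<k}"
        have "dist (\<gamma> (?m i)) (\<gamma> (?m (Suc i))) \<le> ?m (Suc i) - ?m i"
          using i bd[of i] bd[of "Suc i"] tau t ab by (intro curve_dist_le[OF c]) auto
        moreover have "dist (\<gamma> (\<tau> i)) (\<gamma> (\<tau> (Suc i)))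
            \<le> dist (\<gamma> (?m i)) (\<gamma> (?m (Suc i))) + dist (\<gamma> (?M i)) (\<gamma> (?M (Suc i)))"
          using i tau dist_triangle[of "\<gamma> (\<tau> i)" "\<gamma> (\<tau> (Suc i))" "\<gamma> a"] by (auto simp: min_def max_def)
        ultimately have "dist (\<gamma> (\<tau> i)) (\<gamma> (\<tau> (Suc i))) \<le> (?m (Suc i) - ?m i) + dist (\<gamma> (?M i)) (\<gamma> (?M (Suc i)))"
          by linarith
        moreover have "0 \<le> ?m (Suc i) - ?m i" using i tau by auto
        ultimately show "ennreal (dist (\<gamma> (\<tau> i)) (\<gamma> (\<tau> (Suc i))))
            \<le> ennreal (?m (Suc i) - ?m i) + ennreal (dist (\<gamma> (?M i)) (\<gamma> (?M (Suc i))))"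
          by (simp only: ennreal_plus[symmetric] zero_le_dist ennreal_leI)
      qed
      also have "\<dots> = ennreal a + (\<Sum>i<k. ennreal (dist (?\<gamma> (?M i - a)) (?\<gamma> (?M (Suc i) - a))))"
        using telescope_ennreal[of k ?m] tau ab t by (simp add: sum.distrib min.coboundedI1)
      also have "\<dots> \<le> ennreal a + curve_length ?\<gamma> 0 t"
        unfolding curve_length_def
        by (intro add_left_mono SUP_upper2[where i = "(k, \<lambda>i. ?M i - a)"]) (use tau t ab in auto)
      finally show "(case q of (k, \<tau>) \<Rightarrow> \<Sum>i<k. ennreal (dist (\<gamma> (\<tau> i)) (\<gamma> (\<tau> (Suc i))))) \<le> ennreal a + curve_length ?\<gamma> 0 t"
        unfolding q prod.case .
    qed
    finally have le: "ennreal a + ennreal t \<le> ennreal a + curve_length ?\<gamma> 0 t"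
      using ab t by (simp add: ennreal_plus)
    then show "ennreal t \<le> curve_length ?\<gamma> 0 t"
      by simp
  qed
  moreover have "?\<gamma> ` {0..b - a} \<subseteq> Z'" using im ab by auto
  ultimately show ?thesis using ab by (auto simp: curves_def)
qed

lemma curves_mono: "Z \<subseteq> Z' \<Longrightarrow> curves Z \<subseteq> curves Z'"
  by (auto simp: curves_def)

lemma measurable_along_curve:
  fixes G :: "'a::topological_space \<Rightarrow> ennreal"
  assumes G: "G \<in> borel_measurable (restrict_space borel Z)"
    and cont: "continuous_on {a..b::real} \<gamma>" and im: "\<gamma> ` {a..b} \<subseteq> Z"
  shows "(\<lambda>t. G (\<gamma> t) * indicator {a..b} t) \<in> borel_measurable borel"
proof -
  have "\<gamma> \<in> measurable (restrict_space borel {a..b}) (restrict_space borel Z)"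
    using borel_measurable_continuous_on_restrict[OF cont] im
    by (auto intro!: measurable_restrict_space2 simp: space_restrict_space)
  then have "(\<lambda>t. G (\<gamma> t)) \<in> borel_measurable (restrict_space borel {a..b})"
    using G by (rule measurable_compose)
  then show ?thesis
    by (subst (asm) borel_measurable_restrict_space_iff_ennreal) auto
qed

lemma borel_measurable_restrict_UNIV [simp]:
  "borel_measurable (restrict_space M UNIV) = borel_measurable M"
  by (rule measurable_cong_sets) simp_all

lemma measurable_borel_along_curve:
  fixes G :: "'a::metric_space \<Rightarrow> ennreal"
  assumes "(\<gamma>, l) \<in> curves Z" "G \<in> borel_measurable borel"
  shows "(\<lambda>t. G (\<gamma> t) * indicator {0..l} t) \<in> borel_measurable borel"
  by (rule measurable_along_curve[where Z = UNIV and G = G and \<gamma> = \<gamma>])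
    (use assms in \<open>auto simp: curves_def\<close>)

lemma line_integral_mono: "(\<And>x. G x \<le> H x) \<Longrightarrow> line_integral G \<gamma> l \<le> line_integral H \<gamma> l"
  unfolding line_integral_def by (intro nn_integral_mono mult_right_mono) auto

lemma line_integral_indicator:
  "line_integral G \<gamma> l = (\<integral>\<^sup>+t\<in>{0..l}. (G (\<gamma> t) * indicator {0..l} t) \<partial>lborel)"
  unfolding line_integral_def by (intro nn_integral_cong) (auto simp: indicator_def)

lemma line_integral_cmult:
  fixes G :: "'a::metric_space \<Rightarrow> ennreal"
  assumes "(\<gamma>, l) \<in> curves Z" "G \<in> borel_measurable borel"
  shows "line_integral (\<lambda>x. c * G x) \<gamma> l = c * line_integral G \<gamma> l"
  using nn_integral_cmult[of "\<lambda>t. G (\<gamma> t) * indicator {0..l} t" lborel c] measurable_borel_along_curve[OF assms]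
  unfolding line_integral_def by (simp add: mult.assoc)

lemma line_integral_subcurve:
  fixes G :: "'a::topological_space \<Rightarrow> ennreal"
  assumes G: "G \<in> borel_measurable (restrict_space borel Z)"
    and cont: "continuous_on {a..b::real} \<gamma>" and im: "\<gamma> ` {a..b} \<subseteq> Z"
  shows "line_integral G (\<lambda>t. \<gamma> (a + t)) (b - a) = (\<integral>\<^sup>+t\<in>{a..b}. G (\<gamma> t) \<partial>lborel)"
proof -
  have "(\<integral>\<^sup>+t\<in>{a..b}. G (\<gamma> t) \<partial>lborel) = ennreal \<bar>1\<bar> * (\<integral>\<^sup>+t. G (\<gamma> (a + 1 * t)) * indicator {a..b} (a + 1 * t) \<partial>lborel)"
    by (intro nn_integral_real_affine measurable_along_curve[OF assms]) simp
  also have "\<dots> = line_integral G (\<lambda>t. \<gamma> (a + t)) (b - a)"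
    unfolding line_integral_def by (auto intro!: nn_integral_cong simp: indicator_def)
  finally show ?thesis ..
qed

lemma upper_gradient_segment:
  assumes ug: "upper_gradient Z u g" and c: "(\<gamma>, l) \<in> curves Z0" 
    and ab: "0 \<le> a" "a < b" "b \<le> l" and im: "\<gamma> ` {a..b} \<subseteq> Z"
  shows "osc (u (\<gamma> a)) (u (\<gamma> b)) \<le> (\<integral>\<^sup>+t\<in>{a..b}. g (\<gamma> t) \<partial>lborel)"
proof -
  have "continuous_on {0..l} \<gamma>" using c by (simp add: curves_def)
  then have cont: "continuous_on {a..b} \<gamma>" by (rule continuous_on_subset) (use ab in auto)
  have "osc (u (\<gamma> a)) (u (\<gamma> b)) \<le> line_integral g (\<lambda>t. \<gamma> (a + t)) (b - a)"
    using ug[unfolded upper_gradient_osc, THEN conjunct2, THEN bspec, OF subcurve[OF c ab im]] by simp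
  also have "\<dots> = (\<integral>\<^sup>+t\<in>{a..b}. g (\<gamma> t) \<partial>lborel)"
    using ug cont im by (intro line_integral_subcurve[of _ Z]) (auto simp: upper_gradient_def)
  finally show ?thesis .
qed

lemma upper_gradient_subset:
  assumes "upper_gradient Z u g" "Z' \<subseteq> Z" 
  shows "upper_gradient Z' u g"
proof -
  have "g \<in> borel_measurable (restrict_space borel Z')"
    using assms by (auto simp: upper_gradient_def intro: measurable_restrict_mono)
  then show ?thesis using assms(1) curves_mono[OF assms(2)] unfolding upper_gradient_osc by blast
qed

section \<open>Estimates along curves from local and almost everywhere estimates\<close>

lemma osc_le_sum_uniform_partition:
  fixes \<phi> :: "real \<Rightarrow> ereal"
  assumes "0 < n"
  shows "osc (\<phi> 0) (\<phi> l) \<le> (\<Sum>i<n. osc (\<phi> (real i * (l / real n))) (\<phi> (real (Suc i) * (l / real n))))"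
  using osc_chain_le_sum[OF assms, of "\<lambda>i. \<phi> (real i * (l / real n))"] assms by simp

lemma uniform_partition_sum:
  fixes F :: "real \<Rightarrow> ennreal"
  assumes "F \<in> borel_measurable borel" "0 < n" "0 \<le> l"
  shows "(\<Sum>i<n. \<integral>\<^sup>+t\<in>{real i * (l / real n)..real (Suc i) * (l / real n)}. F t \<partial>lborel) = (\<integral>\<^sup>+t\<in>{0..l}. F t \<partial>lborel)"
proof -
  have "real i * (l / real n) \<le> real (Suc i) * (l / real n)" for i
    using assms(3) by (intro mult_right_mono) auto
  then show ?thesis
    using interval_nn_integral_chain[OF assms(1), of n "\<lambda>i. real i * (l / real n)"] assms(2,3) by simp
qed

lemma uniform_partition_piece:
  assumes "i < n" "0 < l"
  shows "0 \<le> real i * (l / real n)" "real i * (l / real n) < real (Suc i) * (l / real n)"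
    "real (Suc i) * (l / real n) \<le> l" "real (Suc i) * (l / real n) - real i * (l / real n) = l / real n"
proof -
  have "real (Suc i) * (l / real n) \<le> real n * (l / real n)"
    using assms by (intro mult_right_mono) auto
  then show "real (Suc i) * (l / real n) \<le> l" using assms by simp
  have "0 < l / real n" using assms by auto
  then show "0 \<le> real i * (l / real n)" "real i * (l / real n) < real (Suc i) * (l / real n)"
    "real (Suc i) * (l / real n) - real i * (l / real n) = l / real n"
    by (simp_all only: of_nat_Suc distrib_right) (simp_all del: times_divide_eq_right)
qed

text \<open>Being an upper gradient is a local property: by compactness every curve splits into finitely many
  pieces of equal length, each of which stays in one of the two open sets.\<close>

lemma upper_gradient_Un_open:
  fixes Z :: "'a::euclidean_space set"
  assumes G: "G \<in> borel_measurable (restrict_space borel Z)"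
    and U: "open U1" "open U2" "Z \<subseteq> U1 \<union> U2"
    and ug: "upper_gradient (Z \<inter> U1) u G" "upper_gradient (Z \<inter> U2) u G"
  shows "upper_gradient Z u G"
  unfolding upper_gradient_osc
proof (intro conjI G ballI, clarify)
  fix \<gamma> l assume c: "(\<gamma>, l) \<in> curves Z"
  then have l: "0 < l" and cont: "continuous_on {0..l} \<gamma>" and im: "\<gamma> ` {0..l} \<subseteq> Z"
    by (auto simp: curves_def)
  obtain V1 where V1: "open V1" "V1 \<inter> {0..l} = \<gamma> -` U1 \<inter> {0..l}"
    using cont U(1) unfolding continuous_on_open_invariant by blast
  obtain V2 where V2: "open V2" "V2 \<inter> {0..l} = \<gamma> -` U2 \<inter> {0..l}"
    using cont U(2) unfolding continuous_on_open_invariant by blast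
  have iff: "t \<in> V1 \<longleftrightarrow> \<gamma> t \<in> U1" "t \<in> V2 \<longleftrightarrow> \<gamma> t \<in> U2" if "t \<in> {0..l}" for t
    using that V1(2) V2(2) by (metis Int_iff vimage_eq)+
  have cov: "{0..l} \<subseteq> \<Union>{V1, V2}"
  proof
    fix t assume t: "t \<in> {0..l}"
    then have "\<gamma> t \<in> U1 \<or> \<gamma> t \<in> U2" using im U(3) by fast
    then show "t \<in> \<Union>{V1, V2}" using iff[OF t] by simp
  qed
  obtain \<delta> where \<delta>: "0 < \<delta>" "\<And>T. \<lbrakk>T \<subseteq> {0..l}; diameter T < \<delta>\<rbrakk> \<Longrightarrow> \<exists>B\<in>{V1, V2}. T \<subseteq> B"
  proof (rule Lebesgue_number_lemma[OF compact_Icc _ cov])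
    show "open B" if "B \<in> {V1, V2}" for B using that V1(1) V2(1) by auto
  qed auto
  obtain n0 where "l / \<delta> < real n0" using reals_Archimedean2 by blast
  then have "l < real n0 * \<delta>" using \<delta>(1) by (simp add: pos_divide_less_eq)
  also have "\<dots> \<le> real (Suc n0) * \<delta>" using \<delta>(1) by (intro mult_right_mono) auto
  finally have n: "l / real (Suc n0) < \<delta>" by (simp add: pos_divide_less_eq mult.commute del: of_nat_Suc)
  define n where "n = Suc n0"
  have n0: "0 < n" by (simp add: n_def)
  let ?F = "\<lambda>t. G (\<gamma> t) * indicator {0..l} t"
  have F: "?F \<in> borel_measurable borel" by (rule measurable_along_curve[OF G cont im])
  have "osc (\<phi> (real i * (l / real n))) (\<phi> (real (Suc i) * (l / real n)))
      \<le> (\<integral>\<^sup>+t\<in>{real i * (l / real n)..real (Suc i) * (l / real n)}. ?F t \<partial>lborel)"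
    if i: "i < n" and phi: "\<phi> = (\<lambda>t. u (\<gamma> t))" for i \<phi>
  proof -
    let ?a = "real i * (l / real n)" and ?b = "real (Suc i) * (l / real n)"
    note pc = uniform_partition_piece[OF i l]
    have "diameter {?a..?b} < \<delta>" using pc n by (simp add: n_def)
    moreover have sub: "{?a..?b} \<subseteq> {0..l}" unfolding atLeastatMost_subset_iff using pc by blast
    ultimately have "{?a..?b} \<subseteq> V1 \<or> {?a..?b} \<subseteq> V2" using \<delta>(2)[of "{?a..?b}"] by simp
    then have "\<gamma> ` {?a..?b} \<subseteq> Z \<inter> U1 \<or> \<gamma> ` {?a..?b} \<subseteq> Z \<inter> U2"
    proof (elim disj_forward)

      have imZ: "\<gamma> t \<in> Z" if "t \<in> {?a..?b}" for t
        using subsetD[OF im imageI[OF subsetD[OF sub that]]] .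
      show "\<gamma> ` {?a..?b} \<subseteq> Z \<inter> U1" if "{?a..?b} \<subseteq> V1"
        by (intro image_subsetI IntI iff(1)[THEN iffD1] subsetD[OF that] subsetD[OF sub] imZ)
      show "\<gamma> ` {?a..?b} \<subseteq> Z \<inter> U2" if "{?a..?b} \<subseteq> V2"
        by (intro image_subsetI IntI iff(2)[THEN iffD1] subsetD[OF that] subsetD[OF sub] imZ)
    qed
    then have "osc (u (\<gamma> ?a)) (u (\<gamma> ?b)) \<le> (\<integral>\<^sup>+t\<in>{?a..?b}. G (\<gamma> t) \<partial>lborel)"
      using upper_gradient_segment[OF ug(1) c pc(1-3)] upper_gradient_segment[OF ug(2) c pc(1-3)] by (elim disjE)
    also have "\<dots> = (\<integral>\<^sup>+t\<in>{?a..?b}. ?F t \<partial>lborel)"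
      using pc by (intro nn_integral_cong) (auto simp: indicator_def)
    finally show ?thesis by (simp add: phi)
  qed
  then have "(\<Sum>i<n. osc (u (\<gamma> (real i * (l / real n)))) (u (\<gamma> (real (Suc i) * (l / real n)))))
      \<le> (\<Sum>i<n. \<integral>\<^sup>+t\<in>{real i * (l / real n)..real (Suc i) * (l / real n)}. ?F t \<partial>lborel)"
    by (intro sum_mono) simp
  also have "\<dots> = (\<integral>\<^sup>+t\<in>{0..l}. ?F t \<partial>lborel)"
    using l by (intro uniform_partition_sum[OF F n0]) simp
  finally have "osc (u (\<gamma> 0)) (u (\<gamma> l)) \<le> (\<integral>\<^sup>+t\<in>{0..l}. ?F t \<partial>lborel)"
    using osc_le_sum_uniform_partition[OF n0, of "\<lambda>t. u (\<gamma> t)" l] by (rule order_trans[rotated])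
  also have "\<dots> = line_integral G \<gamma> l" by (rule line_integral_indicator[symmetric])
  finally show "osc (u (\<gamma> 0)) (u (\<gamma> l)) \<le> line_integral G \<gamma> l" .
qed

lemma nn_integral_shrinking_tendsto_0:
  fixes h :: "'a \<Rightarrow> ennreal"
  assumes [measurable]: "h \<in> borel_measurable M" "\<And>n. V n \<in> sets M"
    and fin: "(\<integral>\<^sup>+t. h t \<partial>M) < \<infinity>" and ev: "AE t in M. eventually (\<lambda>n. t \<notin> V n) sequentially"
  shows "(\<lambda>n. \<integral>\<^sup>+t\<in>V n. h t \<partial>M) \<longlonglongrightarrow> 0"
proof -
  have "(\<lambda>n. \<integral>\<^sup>+t\<in>V n. h t \<partial>M) \<longlonglongrightarrow> (\<integral>\<^sup>+t. 0 \<partial>M)"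
  proof (rule nn_integral_dominated_convergence[where w = h])
    show "AE t in M. (\<lambda>n. h t * indicator (V n) t) \<longlonglongrightarrow> 0"
      using ev
    proof eventually_elim
      case (elim t)
      then have "eventually (\<lambda>n. h t * indicator (V n) t = 0) sequentially"
        by eventually_elim simp
      then show ?case by (rule tendsto_eventually)
    qed
  qed (use fin in \<open>auto simp: indicator_def\<close>)
  then show ?thesis by simp
qed

text \<open>An absolutely continuous \<open>\<phi>\<close> inherits an estimate that holds for a function \<open>\<psi>\<close> with the same
  values almost everywhere: the end points are moved inwards to points where \<open>\<phi>\<close> and \<open>\<psi>\<close> agree, at
  the price of the integral of \<open>h\<close> over two short intervals.\<close>

lemma osc_le_integral_if_AE_eq:
  fixes g h :: "real \<Rightarrow> ennreal" and \<phi> \<psi> :: "real \<Rightarrow> ereal"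
  assumes [measurable]: "g \<in> borel_measurable borel" "h \<in> borel_measurable borel"
    and fin: "(\<integral>\<^sup>+t\<in>{a..b}. h t \<partial>lborel) < \<infinity>" and ab: "a < b"
    and h: "\<And>s t. a \<le> s \<Longrightarrow> s < t \<Longrightarrow> t \<le> b \<Longrightarrow> osc (\<phi> s) (\<phi> t) \<le> (\<integral>\<^sup>+r\<in>{s..t}. h r \<partial>lborel)"
    and g: "\<And>s t. a \<le> s \<Longrightarrow> s < t \<Longrightarrow> t \<le> b \<Longrightarrow> osc (\<psi> s) (\<psi> t) \<le> (\<integral>\<^sup>+r\<in>{s..t}. g r \<partial>lborel)"
    and eq: "AE t in lborel. t \<in> {a..b} \<longrightarrow> \<phi> t = \<psi> t"
  shows "osc (\<phi> a) (\<phi> b) \<le> (\<integral>\<^sup>+t\<in>{a..b}. g t \<partial>lborel)"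
proof -
  define d where "d n = (b - a) / real (Suc (Suc n))" for n :: nat
  have d0: "0 < d n" for n using ab by (auto simp: d_def)
  have d2: "2 * d n \<le> b - a" for n
  proof -
    have "(b - a) * 2 \<le> (b - a) * real (Suc (Suc n))" using ab by (intro mult_left_mono) auto
    then show ?thesis using ab by (simp add: d_def pos_divide_le_eq mult.commute del: of_nat_Suc)
  qed
  have d: "0 < d n" "a + d n \<le> b - d n" "a + d n \<le> b" "a \<le> b - d n" for n
    using d0[of n] d2[of n] by linarith+
  let ?V = "\<lambda>n. {a..a + d n} \<union> {b - d n..b}"
  let ?h = "\<lambda>t. h t * indicator {a..b} t"
  have ex: "\<exists>s. x < s \<and> s < y \<and> \<phi> s = \<psi> s" if xy: "a \<le> x" "x < y" "y \<le> b" for x y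
  proof (rule ccontr)
    assume no: "\<not> ?thesis"
    from eq have "AE t in lborel. t \<notin> {x<..<y}"
      by eventually_elim (use no xy in auto)
    then have "emeasure lborel {x<..<y} = 0"
      by (subst (asm) AE_iff_measurable[of "{x<..<y}"]) auto
    then show False using xy by simp
  qed
  have bound: "osc (\<phi> a) (\<phi> b) \<le> (\<integral>\<^sup>+t\<in>{a..b}. g t \<partial>lborel) + (\<integral>\<^sup>+t\<in>?V n. ?h t \<partial>lborel)" for n
  proof -
    obtain s where s: "a < s" "s < a + d n" "\<phi> s = \<psi> s" using ex[of a "a + d n"] d[of n] by auto
    obtain t where t: "b - d n < t" "t < b" "\<phi> t = \<psi> t" using ex[of "b - d n" b] d[of n] by auto
    have "osc (\<phi> a) (\<phi> b) \<le> osc (\<phi> a) (\<phi> s) + (osc (\<phi> s) (\<phi> t) + osc (\<phi> t) (\<phi> b))"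
      using osc_triangle[of "\<phi> a" "\<phi> b" "\<phi> s"] osc_triangle[of "\<phi> s" "\<phi> b" "\<phi> t"]
      by (meson add_left_mono order_trans)
    also have "\<dots> \<le> (\<integral>\<^sup>+r\<in>{a..s}. h r \<partial>lborel) + ((\<integral>\<^sup>+r\<in>{s..t}. g r \<partial>lborel) + (\<integral>\<^sup>+r\<in>{t..b}. h r \<partial>lborel))"
      using h[of a s] h[of t b] g[of s t] s t d[of n] by (intro add_mono) auto
    also have "\<dots> = (\<integral>\<^sup>+r. g r * indicator {s..t} r + (h r * indicator {a..s} r + h r * indicator {t..b} r) \<partial>lborel)"
      by (simp add: nn_integral_add ac_simps)
    also have "\<dots> \<le> (\<integral>\<^sup>+r. g r * indicator {a..b} r + ?h r * indicator (?V n) r \<partial>lborel)"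
      using s t d[of n] by (intro nn_integral_mono add_mono) (auto simp: indicator_def)
    also have "\<dots> = (\<integral>\<^sup>+t\<in>{a..b}. g t \<partial>lborel) + (\<integral>\<^sup>+t\<in>?V n. ?h t \<partial>lborel)"
      by (rule nn_integral_add) auto
    finally show ?thesis .
  qed
  have dlim: "d \<longlonglongrightarrow> 0"
    unfolding d_def by (rule LIMSEQ_Suc[OF LIMSEQ_Suc[OF lim_const_over_n]])
  have "(\<lambda>n. \<integral>\<^sup>+t\<in>?V n. ?h t \<partial>lborel) \<longlonglongrightarrow> 0"
  proof (rule nn_integral_shrinking_tendsto_0)
    have *: "t \<noteq> a \<Longrightarrow> t \<noteq> b \<Longrightarrow> eventually (\<lambda>n. t \<notin> ?V n) sequentially" for t
    proof (cases "t \<in> {a..b}")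
      assume that: "t \<noteq> a" "t \<noteq> b"
      case True
      with that have "0 < min (t - a) (b - t)" by auto
      from order_tendstoD(2)[OF dlim this] show ?thesis by eventually_elim auto
    next
      case False
      then have "t \<notin> ?V n" for n using d(3,4)[of n] by auto
      then show ?thesis by simp
    qed
    show "AE t in lborel. eventually (\<lambda>n. t \<notin> ?V n) sequentially"
      using AE_lborel_singleton[of a] AE_lborel_singleton[of b] by eventually_elim (rule *)
  qed (use fin in auto)
  then have "(\<lambda>n. (\<integral>\<^sup>+t\<in>{a..b}. g t \<partial>lborel) + (\<integral>\<^sup>+t\<in>?V n. ?h t \<partial>lborel)) \<longlonglongrightarrow> (\<integral>\<^sup>+t\<in>{a..b}. g t \<partial>lborel) + 0"
    by (intro tendsto_add tendsto_const)
  then show ?thesis using bound by (intro LIMSEQ_le_const[where a = "osc (\<phi> a) (\<phi> b)"]) auto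
qed

text \<open>The heart of the passage from \<open>\<Omega>\<close> to the whole space: an absolutely continuous function whose
  variation is controlled by \<open>g\<close> inside an open set of full measure is controlled by \<open>g\<close>
  everywhere. In a partition into equal pieces, a piece inside \<open>U\<close> is estimated by \<open>g\<close> and any
  other piece by \<open>h\<close>. The latter pieces lie in a neighbourhood of the closed null set
  \<open>[0, l] - U\<close> that shrinks to it, so that their contribution tends to zero.\<close>

lemma osc_le_integral_if_le_on_open:
  fixes g h :: "real \<Rightarrow> ennreal" and \<phi> :: "real \<Rightarrow> ereal"
  assumes [measurable]: "g \<in> borel_measurable borel" "h \<in> borel_measurable borel"
    and fin: "(\<integral>\<^sup>+t\<in>{0..l}. h t \<partial>lborel) < \<infinity>" and l: "0 < l"
    and h: "\<And>a b. 0 \<le> a \<Longrightarrow> a < b \<Longrightarrow> b \<le> l \<Longrightarrow> osc (\<phi> a) (\<phi> b) \<le> (\<integral>\<^sup>+r\<in>{a..b}. h r \<partial>lborel)"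
    and U: "openin (top_of_set {0..l}) U" and null: "emeasure lborel ({0..l} - U) = 0"
    and g: "\<And>a b. a < b \<Longrightarrow> {a..b} \<subseteq> U \<Longrightarrow> osc (\<phi> a) (\<phi> b) \<le> (\<integral>\<^sup>+r\<in>{a..b}. g r \<partial>lborel)"
  shows "osc (\<phi> 0) (\<phi> l) \<le> (\<integral>\<^sup>+t\<in>{0..l}. g t \<partial>lborel)"
proof (cases "{0..l} - U = {}")
  case True
  then show ?thesis using g[of 0 l] l by auto
next
  case False
  define K where "K = {0..l} - U"
  have "closedin (top_of_set {0..l}) K" using U unfolding K_def by (simp add: openin_closedin_eq)
  then have K: "closed K" by (rule closedin_closed_trans) simp
  define V where "V n = {t\<in>{0..l}. infdist t K \<le> l / real (Suc n)}" for n
  have [measurable]: "V n \<in> sets borel" for n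
  proof -
    have "closed ({0..l} \<inter> (\<lambda>t. infdist t K) -` {..l / real (Suc n)})"
      by (intro continuous_closed_preimage) (auto intro!: continuous_intros)
    moreover have "V n = {0..l} \<inter> (\<lambda>t. infdist t K) -` {..l / real (Suc n)}" by (auto simp: V_def)
    ultimately show ?thesis by (simp add: borel_closed)
  qed
  let ?h = "\<lambda>t. h t * indicator {0..l} t"
  (* V m contains every piece of length l / (m + 1) that meets K *)
  have bound: "osc (\<phi> 0) (\<phi> l) \<le> (\<integral>\<^sup>+t\<in>{0..l}. g t \<partial>lborel) + (\<integral>\<^sup>+t\<in>V m. ?h t \<partial>lborel)" for m
  proof -
    define n where "n = Suc m"
    have n0: "0 < n" by (simp add: n_def)
    let ?a = "\<lambda>i. real i * (l / real n)" and ?b = "\<lambda>i. real (Suc i) * (l / real n)"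
    let ?G = "\<lambda>t. g t + ?h t * indicator (V m) t"
    have piece: "osc (\<phi> (?a i)) (\<phi> (?b i)) \<le> (\<integral>\<^sup>+t\<in>{?a i..?b i}. ?G t \<partial>lborel)" if i: "i < n" for i
    proof -
      note pc = uniform_partition_piece[OF i l]
      show ?thesis
      proof (cases "{?a i..?b i} \<subseteq> U")
        case True
        then have "osc (\<phi> (?a i)) (\<phi> (?b i)) \<le> (\<integral>\<^sup>+t\<in>{?a i..?b i}. g t \<partial>lborel)"
          using g pc by blast
        also have "\<dots> \<le> (\<integral>\<^sup>+t\<in>{?a i..?b i}. ?G t \<partial>lborel)"
          by (intro nn_integral_mono mult_right_mono) auto
        finally show ?thesis .
      next
        case False
        then obtain s where s: "s \<in> {?a i..?b i}" "s \<in> K" using pc by (fastforce simp: K_def)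
        have sub: "t \<in> V m" if t: "t \<in> {?a i..?b i}" for t
        proof -
          have "dist t s \<le> l / real n" using s t pc(4) by (auto simp: dist_real_def)
          then have "infdist t K \<le> l / real n" using infdist_le2[OF s(2)] by blast
          then show ?thesis using t pc by (auto simp: V_def n_def)
        qed
        have "osc (\<phi> (?a i)) (\<phi> (?b i)) \<le> (\<integral>\<^sup>+t\<in>{?a i..?b i}. h t \<partial>lborel)"
          using h pc by blast
        also have "\<dots> \<le> (\<integral>\<^sup>+t\<in>{?a i..?b i}. ?G t \<partial>lborel)"
          using sub pc by (intro nn_integral_mono) (auto simp: indicator_def)
        finally show ?thesis .
      qed
    qed
    have "osc (\<phi> 0) (\<phi> l) \<le> (\<Sum>i<n. osc (\<phi> (?a i)) (\<phi> (?b i)))"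
      by (rule osc_le_sum_uniform_partition[OF n0])
    also have "\<dots> \<le> (\<Sum>i<n. \<integral>\<^sup>+t\<in>{?a i..?b i}. ?G t \<partial>lborel)"
      by (intro sum_mono piece) auto
    also have "\<dots> = (\<integral>\<^sup>+t\<in>{0..l}. ?G t \<partial>lborel)"
      using l by (intro uniform_partition_sum n0) auto
    also have "\<dots> = (\<integral>\<^sup>+t. g t * indicator {0..l} t + ?h t * indicator (V m) t \<partial>lborel)"
      by (intro nn_integral_cong) (auto simp: indicator_def)
    also have "\<dots> = (\<integral>\<^sup>+t\<in>{0..l}. g t \<partial>lborel) + (\<integral>\<^sup>+t\<in>V m. ?h t \<partial>lborel)"
      by (rule nn_integral_add) auto
    finally show ?thesis .
  qed
  have "(\<lambda>n. \<integral>\<^sup>+t\<in>V n. ?h t \<partial>lborel) \<longlonglongrightarrow> 0"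
  proof (rule nn_integral_shrinking_tendsto_0)
    have ev: "t \<notin> K \<Longrightarrow> eventually (\<lambda>n. t \<notin> V n) sequentially" for t
    proof -
      assume that: "t \<notin> K"
      have "0 < infdist t K"
        using that K False infdist_pos_not_in_closed[of K t] by (auto simp: K_def)
      moreover have "(\<lambda>n. l / real (Suc n)) \<longlonglongrightarrow> 0" by (rule LIMSEQ_Suc[OF lim_const_over_n])
      ultimately have "eventually (\<lambda>n. l / real (Suc n) < infdist t K) sequentially"
        by (rule order_tendstoD(2)[rotated])
      then show ?thesis by eventually_elim (auto simp: V_def)
    qed
    moreover have "AE t in lborel. t \<notin> K"
      using null K by (intro AE_not_in null_setsI) (auto simp: K_def[symmetric])
    ultimately show "AE t in lborel. eventually (\<lambda>n. t \<notin> V n) sequentially"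
      by (auto elim: eventually_mono)
  qed (use fin in auto)
  then have "(\<lambda>n. (\<integral>\<^sup>+t\<in>{0..l}. g t \<partial>lborel) + (\<integral>\<^sup>+t\<in>V n. ?h t \<partial>lborel)) \<longlonglongrightarrow> (\<integral>\<^sup>+t\<in>{0..l}. g t \<partial>lborel) + 0"
    by (intro tendsto_add tendsto_const)
  then show ?thesis using bound by (intro LIMSEQ_le_const[where a = "osc (\<phi> 0) (\<phi> l)"]) auto
qed

text \<open>Admissible functions whose energies tend to zero fast are combined by a weighted supremum. In this
  form exceptional families are easy to unite: the functions \<open>\<rho>\<close> are replaced by their maximum.\<close>

lemma modulus_zero_majorant:
  fixes \<mu> :: "'a::euclidean_space measure"
  assumes mod0: "modulus p \<mu> UNIV \<Gamma> = 0" and p: "0 < p"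
    and borel: "\<And>f :: 'a \<Rightarrow> ennreal. f \<in> borel_measurable borel \<Longrightarrow> f \<in> borel_measurable \<mu>"
    and \<Gamma>: "\<Gamma> \<subseteq> curves UNIV"
  obtains \<rho> where "\<rho> \<in> borel_measurable borel" "(\<integral>\<^sup>+x. epowr (\<rho> x) p \<partial>\<mu>) < \<infinity>"
    "\<And>\<gamma> l. (\<gamma>, l) \<in> \<Gamma> \<Longrightarrow> line_integral \<rho> \<gamma> l = \<infinity>"
proof -
  have "\<exists>\<rho>. \<rho> \<in> borel_measurable borel \<and> (\<forall>(\<gamma>, l)\<in>\<Gamma>. 1 \<le> line_integral \<rho> \<gamma> l) \<and>
      (\<integral>\<^sup>+x. epowr (\<rho> x) p \<partial>\<mu>) < ennreal ((1/2)^j / real (Suc j) powr p)" for j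
  proof -
    have "modulus p \<mu> UNIV \<Gamma> < ennreal ((1/2)^j / real (Suc j) powr p)"
      using mod0 by simp
    then obtain \<rho> where "\<rho> \<in> borel_measurable (restrict_space borel (UNIV :: 'a set))"
        "\<forall>(\<gamma>, l)\<in>\<Gamma>. 1 \<le> line_integral \<rho> \<gamma> l"
        "(\<integral>\<^sup>+x\<in>UNIV. epowr (\<rho> x) p \<partial>\<mu>) < ennreal ((1/2)^j / real (Suc j) powr p)"
      unfolding modulus_def INF_less_iff by blast
    then show ?thesis by (intro exI[of _ \<rho>]) simp
  qed
  then obtain \<rho> where \<rho>: "\<And>j. \<rho> j \<in> borel_measurable borel"
      "\<And>j. \<forall>(\<gamma>, l)\<in>\<Gamma>. 1 \<le> line_integral (\<rho> j) \<gamma> l"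
      "\<And>j. (\<integral>\<^sup>+x. epowr (\<rho> j x) p \<partial>\<mu>) < ennreal ((1/2)^j / real (Suc j) powr p)"
    by metis
  have [measurable]: "\<rho> j \<in> borel_measurable \<mu>" for j using \<rho>(1) borel by blast
  define \<sigma> where "\<sigma> x = (SUP j. of_nat (Suc j) * \<rho> j x)" for x
  have fin: "(\<integral>\<^sup>+x. epowr (\<sigma> x) p \<partial>\<mu>) < \<infinity>"
    unfolding \<sigma>_def by (rule nn_integral_epowr_weighted_SUP_finite) (use p \<rho>(3) in \<open>auto intro: less_imp_le\<close>)
  have "line_integral \<sigma> \<gamma> l = \<infinity>" if \<gamma>: "(\<gamma>, l) \<in> \<Gamma>" for \<gamma> l
  proof -
    have "of_nat j \<le> line_integral \<sigma> \<gamma> l" for j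
    proof -
      have "of_nat j \<le> of_nat (Suc j) * (1::ennreal)" by simp
      also have "\<dots> \<le> of_nat (Suc j) * line_integral (\<rho> j) \<gamma> l"
        using \<rho>(2)[of j] \<gamma> by (intro mult_left_mono) auto
      also have "\<dots> = line_integral (\<lambda>x. of_nat (Suc j) * \<rho> j x) \<gamma> l"
        using \<gamma> \<Gamma> \<rho>(1) by (intro line_integral_cmult[symmetric, of _ _ UNIV]) auto
      also have "\<dots> \<le> line_integral \<sigma> \<gamma> l"
        unfolding \<sigma>_def by (intro line_integral_mono SUP_upper) simp
      finally show ?thesis .
    qed
    then have "(SUP j. of_nat j) \<le> line_integral \<sigma> \<gamma> l" by (intro SUP_least)
    then show ?thesis by (simp add: ennreal_SUP_of_nat_eq_top top_unique)
  qed
  moreover have "\<sigma> \<in> borel_measurable borel" unfolding \<sigma>_def using \<rho>(1) by measurable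
  ultimately show ?thesis using fin that by blast
qed

section \<open>Averages with respect to a doubling Borel measure\<close>

locale doubling_borel_measure =
  fixes \<nu> :: "'a::euclidean_space measure" and D :: real
  assumes sets_eq [measurable_cong, simp]: "sets \<nu> = sets borel"
    and ball_pos: "0 < r \<Longrightarrow> 0 < emeasure \<nu> (ball x r)"
    and ball_fin: "0 < r \<Longrightarrow> emeasure \<nu> (ball x r) < \<infinity>"
    and D_pos: "0 < D"
    and doubling: "0 < r \<Longrightarrow> emeasure \<nu> (ball x (2 * r)) \<le> ennreal D * emeasure \<nu> (ball x r)"
begin

lemma space_eq [simp]: "space \<nu> = UNIV"
  using sets_eq_imp_space_eq[OF sets_eq] by simp

lemma ball_measure_finite [simp]: "emeasure \<nu> (ball x r) \<noteq> top" "emeasure \<nu> (ball x r) < top"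
proof -
  have "emeasure \<nu> (ball x r) < \<infinity>"
  proof (cases "0 < r")
    case False
    then have "ball x r = {}" by (simp add: ball_eq_empty)
    then show ?thesis by (simp only: emeasure_empty) simp
  qed (rule ball_fin)
  then show "emeasure \<nu> (ball x r) \<noteq> top" "emeasure \<nu> (ball x r) < top" by auto
qed

lemma ball_measure_nonzero: "0 < r \<Longrightarrow> emeasure \<nu> (ball x r) \<noteq> 0"
  using ball_pos[of r x] by auto

lemma sigma_finite: "sigma_finite_measure \<nu>"
proof
  have "(\<Union>n. ball (0::'a) (real n)) = UNIV"
    by (auto simp: reals_Archimedean2)
  then show "\<exists>A. countable A \<and> A \<subseteq> sets \<nu> \<and> \<Union> A = space \<nu> \<and> (\<forall>a\<in>A. emeasure \<nu> a \<noteq> \<infinity>)"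
    by (intro exI[of _ "range (\<lambda>n. ball (0::'a) (real n))"]) auto
qed

sublocale sigma_finite_measure \<nu> by (rule sigma_finite)

sublocale pair: pair_sigma_finite \<nu> \<nu> ..

lemma ball_compare: "dist x y < r \<Longrightarrow> emeasure \<nu> (ball y r) \<le> ennreal D * emeasure \<nu> (ball x r)"
proof -
  assume xy: "dist x y < r"
  then have r: "0 < r" using zero_le_dist[of x y] by linarith
  have "ball y r \<subseteq> ball x (2 * r)"
  proof
    fix z assume "z \<in> ball y r" then show "z \<in> ball x (2 * r)"
      using xy dist_triangle[of x z y] by (simp add: dist_commute)
  qed
  then have "emeasure \<nu> (ball y r) \<le> emeasure \<nu> (ball x (2 * r))" by (intro emeasure_mono) auto
  also have "\<dots> \<le> ennreal D * emeasure \<nu> (ball x r)" by (rule doubling[OF r])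
  finally show ?thesis .
qed

definition avg :: "real \<Rightarrow> ('a \<Rightarrow> ennreal) \<Rightarrow> 'a \<Rightarrow> ennreal" where
  "avg r f x = (\<integral>\<^sup>+y\<in>ball x r. f y \<partial>\<nu>) / emeasure \<nu> (ball x r)"

lemma measurable_ball [measurable]: "Measurable.pred borel (\<lambda>y. y \<in> ball (x::'a) r)"
  by (simp add: pred_def)

lemma measurable_in_ball [measurable]: "Measurable.pred (\<nu> \<Otimes>\<^sub>M \<nu>) (\<lambda>q. snd q \<in> ball (fst q) r)"
proof -
  have "(\<lambda>q. dist (fst q) (snd q)) \<in> borel_measurable (\<nu> \<Otimes>\<^sub>M \<nu>)"
    by measurable
  then show ?thesis unfolding mem_ball by measurable
qed

lemma measurable_ball_measure [measurable]: "(\<lambda>x. emeasure \<nu> (ball x r)) \<in> borel_measurable \<nu>"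
proof -
  have "(\<lambda>x. \<integral>\<^sup>+y. indicator (ball x r) y \<partial>\<nu>) \<in> borel_measurable \<nu>"
    by measurable
  then show ?thesis by simp
qed

lemma measurable_avg [measurable]:
  assumes [measurable]: "f \<in> borel_measurable \<nu>"
  shows "avg r f \<in> borel_measurable \<nu>"
  unfolding avg_def by measurable

lemma ball_divide_times [simp]: "0 < r \<Longrightarrow> a / emeasure \<nu> (ball x r) * emeasure \<nu> (ball x r) = a"
  using ball_measure_nonzero[of r x] by (simp add: ennreal_divide_times)

lemma avg_lt_top:
  assumes f: "(\<integral>\<^sup>+x. f x \<partial>\<nu>) < \<infinity>" and r: "0 < r"
  shows "avg r f x < top"
proof -
  have "(\<integral>\<^sup>+y\<in>ball x r. f y \<partial>\<nu>) \<le> (\<integral>\<^sup>+x. f x \<partial>\<nu>)" by (intro nn_integral_mono) (auto simp: indicator_def)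
  then have "(\<integral>\<^sup>+y\<in>ball x r. f y \<partial>\<nu>) < top" using f by simp
  then show ?thesis unfolding avg_def using ball_measure_nonzero[OF r, of x]
    by (simp add: less_top[symmetric] ennreal_divide_eq_top_iff)
qed

lemma avg_const: "0 < r \<Longrightarrow> avg r (\<lambda>_. c) x = c"
  unfolding avg_def by (simp add: nn_integral_cmult_indicator ennreal_mult_divide_eq ball_measure_nonzero)

lemma avg_add:
  assumes [measurable]: "f \<in> borel_measurable \<nu>" "g \<in> borel_measurable \<nu>"
  shows "avg r (\<lambda>y. f y + g y) x = avg r f x + avg r g x"
proof -
  have "(\<integral>\<^sup>+y\<in>ball x r. f y + g y \<partial>\<nu>) = (\<integral>\<^sup>+y. f y * indicator (ball x r) y + g y * indicator (ball x r) y \<partial>\<nu>)"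
    by (simp add: distrib_right)
  also have "\<dots> = (\<integral>\<^sup>+y\<in>ball x r. f y \<partial>\<nu>) + (\<integral>\<^sup>+y\<in>ball x r. g y \<partial>\<nu>)"
    by (rule nn_integral_add) measurable
  finally show ?thesis unfolding avg_def by (simp add: divide_ennreal_def distrib_right)
qed

lemma avg_mono: "(\<And>y. y \<in> ball x r \<Longrightarrow> f y \<le> g y) \<Longrightarrow> avg r f x \<le> avg r g x"
  unfolding avg_def by (intro divide_right_mono_ennreal nn_integral_mono) (auto simp: indicator_def)

text \<open>By Fubini each value \<open>f y\<close> is counted with weight \<open>1 / \<nu> (ball x r)\<close> for all \<open>x\<close> in \<open>ball y r\<close>, and
  doubling makes this weight comparable to \<open>1 / \<nu> (ball y r)\<close>.\<close>

lemma nn_integral_avg_le: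
  assumes [measurable]: "f \<in> borel_measurable \<nu>" and r: "0 < r"
  shows "(\<integral>\<^sup>+x. avg r f x \<partial>\<nu>) \<le> ennreal D * (\<integral>\<^sup>+x. f x \<partial>\<nu>)"
proof -
  have "(\<integral>\<^sup>+x. avg r f x \<partial>\<nu>) = (\<integral>\<^sup>+x. \<integral>\<^sup>+y. f y * indicator (ball x r) y / emeasure \<nu> (ball x r) \<partial>\<nu> \<partial>\<nu>)"
    unfolding avg_def by (intro nn_integral_cong nn_integral_divide[symmetric]) measurable
  also have "\<dots> = (\<integral>\<^sup>+y. \<integral>\<^sup>+x. f y * indicator (ball x r) y / emeasure \<nu> (ball x r) \<partial>\<nu> \<partial>\<nu>)"
    by (rule pair.Fubini'[symmetric]) measurable
  also have "\<dots> \<le> (\<integral>\<^sup>+y. ennreal D * f y \<partial>\<nu>)"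
  proof (intro nn_integral_mono)
    fix y
    have "(\<integral>\<^sup>+x. f y * indicator (ball x r) y / emeasure \<nu> (ball x r) \<partial>\<nu>)
        \<le> (\<integral>\<^sup>+x. f y * (ennreal D / emeasure \<nu> (ball y r)) * indicator (ball y r) x \<partial>\<nu>)"
    proof (intro nn_integral_mono)
      fix x
      show "f y * indicator (ball x r) y / emeasure \<nu> (ball x r)
          \<le> f y * (ennreal D / emeasure \<nu> (ball y r)) * indicator (ball y r) x"
      proof (cases "dist x y < r")
        case True
        have "emeasure \<nu> (ball y r) \<le> ennreal D * emeasure \<nu> (ball x r)" using True by (rule ball_compare)
        then have "1 / emeasure \<nu> (ball x r) \<le> ennreal D / emeasure \<nu> (ball y r)"
          using ball_pos[OF r, of x] ball_pos[OF r, of y] ball_measure_finite[of x r] ball_measure_finite[of y r] D_pos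
          by (cases "emeasure \<nu> (ball x r)"; cases "emeasure \<nu> (ball y r)")
            (auto simp: divide_ennreal ennreal_mult[symmetric] ennreal_le_iff field_simps simp flip: ennreal_1)
        then have "f y * (1 / emeasure \<nu> (ball x r)) \<le> f y * (ennreal D / emeasure \<nu> (ball y r))"
          by (intro mult_left_mono) auto
        then show ?thesis using True by (simp add: dist_commute ennreal_times_divide)
      next
        case False
        then show ?thesis by (simp add: dist_commute)
      qed
    qed
    also have "\<dots> = f y * (ennreal D / emeasure \<nu> (ball y r)) * emeasure \<nu> (ball y r)"
      by (rule nn_integral_cmult_indicator) auto
    also have "\<dots> = ennreal D * f y"
      using ball_divide_times[OF r, of "ennreal D" y] by (metis mult.assoc mult.commute)
    finally show "(\<integral>\<^sup>+x. f y * indicator (ball x r) y / emeasure \<nu> (ball x r) \<partial>\<nu>) \<le> ennreal D * f y" .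
  qed
  also have "\<dots> = ennreal D * (\<integral>\<^sup>+x. f x \<partial>\<nu>)" by (rule nn_integral_cmult) simp
  finally show ?thesis .
qed

text \<open>The mean deviation of \<open>f\<close> from its value at \<open>x\<close>. Its integral over \<open>x\<close> is a modulus of continuity
  of \<open>f\<close> in \<open>L\<^sup>1\<close>.\<close>

definition osc_at :: "real \<Rightarrow> ('a \<Rightarrow> real) \<Rightarrow> 'a \<Rightarrow> ennreal" where
  "osc_at r f x = avg r (\<lambda>y. ennreal \<bar>f x - f y\<bar>) x"

lemma measurable_osc_at [measurable]:
  assumes [measurable]: "f \<in> borel_measurable \<nu>"
  shows "osc_at r f \<in> borel_measurable \<nu>"
  unfolding osc_at_def avg_def by measurable

text \<open>Used with \<open>h = \<bar>f\<bar>\<close> for perturbations that are small in \<open>L\<^sup>1\<close>, and with an indicator function for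
  functions that vary only near the boundary of a set.\<close>

lemma nn_integral_osc_at_le:
  assumes [measurable]: "f \<in> borel_measurable \<nu>" "h \<in> borel_measurable \<nu>" and r: "0 < r"
    and le: "\<And>x y. dist x y < r \<Longrightarrow> ennreal \<bar>f x - f y\<bar> \<le> h x + h y"
  shows "(\<integral>\<^sup>+x. osc_at r f x \<partial>\<nu>) \<le> ennreal (1 + D) * (\<integral>\<^sup>+x. h x \<partial>\<nu>)"
proof -
  have "osc_at r f x \<le> h x + avg r h x" for x
  proof -
    have "osc_at r f x \<le> avg r (\<lambda>y. h x + h y) x"
      unfolding osc_at_def using le by (intro avg_mono) auto
    then show ?thesis by (simp add: avg_add avg_const[OF r])
  qed
  then have "(\<integral>\<^sup>+x. osc_at r f x \<partial>\<nu>) \<le> (\<integral>\<^sup>+x. h x + avg r h x \<partial>\<nu>)" by (intro nn_integral_mono)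
  also have "\<dots> = (\<integral>\<^sup>+x. h x \<partial>\<nu>) + (\<integral>\<^sup>+x. avg r h x \<partial>\<nu>)" by (rule nn_integral_add) auto
  also have "\<dots> \<le> (\<integral>\<^sup>+x. h x \<partial>\<nu>) + ennreal D * (\<integral>\<^sup>+x. h x \<partial>\<nu>)"
    by (intro add_left_mono nn_integral_avg_le r) auto
  also have "\<dots> = ennreal (1 + D) * (\<integral>\<^sup>+x. h x \<partial>\<nu>)"
    using D_pos by (simp add: ennreal_plus distrib_right)
  finally show ?thesis .
qed

lemma nn_integral_osc_at_add:
  assumes [measurable]: "f \<in> borel_measurable \<nu>" "g \<in> borel_measurable \<nu>" and r: "0 < r"
  shows "(\<integral>\<^sup>+x. osc_at r (\<lambda>x. f x + g x) x \<partial>\<nu>) \<le> (\<integral>\<^sup>+x. osc_at r f x \<partial>\<nu>) + (\<integral>\<^sup>+x. osc_at r g x \<partial>\<nu>)"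
proof -
  have "osc_at r (\<lambda>x. f x + g x) x \<le> osc_at r f x + osc_at r g x" for x
  proof -
    have "osc_at r (\<lambda>x. f x + g x) x \<le> avg r (\<lambda>y. ennreal \<bar>f x - f y\<bar> + ennreal \<bar>g x - g y\<bar>) x"
      unfolding osc_at_def by (intro avg_mono) (auto simp flip: ennreal_plus intro!: ennreal_leI)
    then show ?thesis by (simp add: avg_add osc_at_def)
  qed
  then have "(\<integral>\<^sup>+x. osc_at r (\<lambda>x. f x + g x) x \<partial>\<nu>) \<le> (\<integral>\<^sup>+x. osc_at r f x + osc_at r g x \<partial>\<nu>)"
    by (intro nn_integral_mono)
  then show ?thesis by (simp add: nn_integral_add)
qed

lemma inner_regular_fin:
  assumes A: "A \<in> sets borel" and fin: "emeasure \<nu> A < \<infinity>" and e: "0 < (e::ennreal)"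
  obtains K where "compact K" "K \<subseteq> A" "emeasure \<nu> (A - K) \<le> e"
proof -
  define N where "N = density \<nu> (indicator A)"
  have NA: "emeasure N B = emeasure \<nu> (A \<inter> B)" if "B \<in> sets borel" for B
  proof -
    have "emeasure N B = (\<integral>\<^sup>+x. indicator A x * indicator B x \<partial>\<nu>)"
      unfolding N_def using that A by (intro emeasure_density) auto
    also have "\<dots> = (\<integral>\<^sup>+x. indicator (A \<inter> B) x \<partial>\<nu>)"
      by (simp add: indicator_inter_arith)
    also have "\<dots> = emeasure \<nu> (A \<inter> B)" using that A by (intro nn_integral_indicator) auto
    finally show ?thesis .
  qed
  have "emeasure N A = (SUP K \<in> {K. K \<subseteq> A \<and> compact K}. emeasure N K)"
  proof (rule inner_regular)
    show "sets N = sets borel" by (simp add: N_def)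
    show "emeasure N (space N) \<noteq> \<infinity>" using NA[of UNIV] fin by (simp add: N_def)
  qed (rule A)
  then have sup: "emeasure \<nu> A = (SUP K \<in> {K. K \<subseteq> A \<and> compact K}. emeasure N K)" using NA[OF A] by simp
  have "\<exists>K\<in>{K. K \<subseteq> A \<and> compact K}. emeasure \<nu> A \<le> emeasure N K + e"
  proof (rule ccontr)
    assume no: "\<not> ?thesis"
    have "e + (SUP K \<in> {K. K \<subseteq> A \<and> compact K}. emeasure N K)
        = (SUP K \<in> {K. K \<subseteq> A \<and> compact K}. e + emeasure N K)"
      by (rule ennreal_SUP_add_right) auto
    also have "\<dots> \<le> emeasure \<nu> A"
    proof (rule SUP_least)
      fix K assume "K \<in> {K. K \<subseteq> A \<and> compact K}"
      then have "\<not> emeasure \<nu> A \<le> emeasure N K + e" using no by blast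
      then show "e + emeasure N K \<le> emeasure \<nu> A" by (simp add: add.commute)
    qed
    finally have "e + emeasure \<nu> A \<le> emeasure \<nu> A" using sup by simp
    then show False using e fin
      by (cases e; cases "emeasure \<nu> A") (auto simp add: top_unique simp flip: ennreal_plus)
  qed
  then obtain K where K: "K \<subseteq> A" "compact K" "emeasure \<nu> A \<le> emeasure \<nu> K + e"
    using NA by (auto simp: Int_absorb1 compact_imp_closed borel_closed)
  have "emeasure \<nu> (A - K) \<le> e"
  proof -
    have Kb: "K \<in> sets borel" using K by (simp add: compact_imp_closed borel_closed)
    have Kf: "emeasure \<nu> K < \<infinity>" using emeasure_mono[OF K(1), of \<nu>] A fin by (auto simp: less_le_trans)
    have "emeasure \<nu> (A - K) = emeasure \<nu> A - emeasure \<nu> K"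
      using A Kb Kf K by (intro emeasure_Diff) auto
    then show ?thesis using K(3) Kf by (auto simp: ennreal_minus_le_iff add.commute)
  qed
  then show ?thesis using K that by blast
qed

lemma compact_neighbourhood_measure:
  assumes K: "compact K" and e: "0 < (e::ennreal)"
  obtains d where "0 < d" "emeasure \<nu> {x. x \<notin> K \<and> (\<exists>y\<in>K. dist x y < d)} \<le> e"
proof -
  define W where "W n = {x. x \<notin> K \<and> (\<exists>y\<in>K. dist x y < 1 / real (Suc n))}" for n
  have W: "W n \<in> sets borel" for n
  proof -
    have "W n = (\<Union>y\<in>K. ball y (1 / real (Suc n))) - K" by (auto simp: W_def dist_commute)
    moreover have "open ((\<Union>y\<in>K. ball y (1 / real (Suc n))) - K)"
      using K by (intro open_Diff open_UN) (auto simp: compact_imp_closed)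
    ultimately show ?thesis by simp
  qed
  obtain R where R: "0 < R" "K \<subseteq> ball 0 R"
    using K bounded_subset_ballD[OF compact_imp_bounded[OF K], of 0] by auto
  have "(\<lambda>n. emeasure \<nu> (W n)) \<longlonglongrightarrow> emeasure \<nu> (\<Inter>n. W n)"
  proof (rule Lim_emeasure_decseq)
    show "range W \<subseteq> sets \<nu>" using W by auto
    show "decseq W"
    proof (intro decseq_SucI subsetI)
      fix n x assume "x \<in> W (Suc n)"
      then obtain y where "x \<notin> K" "y \<in> K" "dist x y < 1 / real (Suc (Suc n))" by (auto simp: W_def)
      moreover have "1 / real (Suc (Suc n)) \<le> 1 / real (Suc n)" by (intro divide_left_mono) auto
      ultimately show "x \<in> W n" unfolding W_def by (auto intro!: bexI[of _ y] simp del: of_nat_Suc)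
    qed
    fix n
    have "W n \<subseteq> ball 0 (R + 1)"
    proof
      fix x assume "x \<in> W n"
      then obtain y where y: "y \<in> K" "dist x y < 1 / real (Suc n)" by (auto simp: W_def)
      have "1 / real (Suc n) \<le> 1" by simp
      then have "dist x y < 1" using y by linarith
      moreover have "dist 0 y < R" using y R by auto
      ultimately show "x \<in> ball 0 (R + 1)" using dist_triangle[of 0 x y] by (simp add: dist_commute)
    qed
    then have "emeasure \<nu> (W n) \<le> emeasure \<nu> (ball 0 (R + 1))" by (intro emeasure_mono) auto
    then show "emeasure \<nu> (W n) \<noteq> \<infinity>" using ball_measure_finite(2)[of 0 "R + 1"] by (auto simp: top_unique)
  qed
  moreover have "(\<Inter>n. W n) = {}"
  proof (rule ccontr)
    assume "(\<Inter>n. W n) \<noteq> {}"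
    then obtain x where x: "\<And>n. x \<in> W n" by auto
    then have "x \<notin> K" "K \<noteq> {}" by (auto simp: W_def)
    then have pos: "0 < infdist x K" using infdist_pos_not_in_closed[OF compact_imp_closed[OF K]] by auto
    then obtain n where n: "1 / real (Suc n) < infdist x K" using nat_approx_posE by blast
    obtain y where "y \<in> K" "dist x y < 1 / real (Suc n)" using x[of n] by (auto simp: W_def)
    then show False using infdist_le[of y K x] n by linarith
  qed
  ultimately have "(\<lambda>n. emeasure \<nu> (W n)) \<longlonglongrightarrow> 0" by simp
  then have "eventually (\<lambda>n. emeasure \<nu> (W n) < e) sequentially" using e by (rule order_tendstoD(2))
  then obtain n where "emeasure \<nu> (W n) < e" by (auto simp: eventually_sequentially)
  then show ?thesis using that[of "1 / real (Suc n)"] by (auto simp: W_def less_imp_le)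
qed

text \<open>A form of the Lebesgue differentiation theorem in \<open>L\<^sup>1\<close>. The functions with this property are
  closed under sums and limits in \<open>L\<^sup>1\<close>, so it suffices to consider the indicator of a set \<open>A\<close>. Up to a
  set of small measure \<open>A\<close> is a compact set \<open>K\<close>, and for points at distance less than \<open>r\<close> the
  indicator of \<open>K\<close> can differ only if one of them lies in a thin neighbourhood of \<open>K\<close>
  outside \<open>K\<close>, whose measure tends to zero with \<open>r\<close>.\<close>

lemma osc_at_tendsto_0:
  assumes f: "integrable \<nu> f"
  shows "\<forall>e::real>0. \<exists>d>0. \<forall>r. 0 < r \<longrightarrow> r < d \<longrightarrow> (\<integral>\<^sup>+x. osc_at r f x \<partial>\<nu>) \<le> ennreal e"
  using f
proof (induction rule: integrable_induct)
  case (base A c)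
  then have A [measurable]: "A \<in> sets borel" and fin: "emeasure \<nu> A < \<infinity>" by auto
  show ?case
  proof (intro allI impI)
    fix e :: real assume e: "0 < e"
    define e' where "e' = e / (2 * (1 + D) * (1 + \<bar>c\<bar>))"
    have e': "0 < e'" using e D_pos by (simp add: e'_def)
    obtain K where K: "compact K" "K \<subseteq> A" "emeasure \<nu> (A - K) \<le> ennreal e'"
      using inner_regular_fin[OF A fin, of "ennreal e'"] e' by auto
    obtain d where d: "0 < d" "emeasure \<nu> {x. x \<notin> K \<and> (\<exists>y\<in>K. dist x y < d)} \<le> ennreal e'"
      using compact_neighbourhood_measure[OF K(1), of "ennreal e'"] e' by auto
    define W where "W = {x. x \<notin> K \<and> (\<exists>y\<in>K. dist x y < d)}"
    have "W = (\<Union>y\<in>K. ball y d) - K" by (auto simp: W_def dist_commute)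
    moreover have "open ((\<Union>y\<in>K. ball y d) - K)"
      using K(1) by (intro open_Diff open_UN) (auto simp: compact_imp_closed)
    ultimately have [measurable]: "W \<in> sets borel" by simp
    have [measurable]: "K \<in> sets borel" using K by (simp add: compact_imp_closed borel_closed)
    have "(\<integral>\<^sup>+x. osc_at r (\<lambda>x. indicator A x *\<^sub>R c) x \<partial>\<nu>) \<le> ennreal e" if r: "0 < r" "r < d" for r
    proof -
      let ?h = "\<lambda>x. ennreal \<bar>c\<bar> * (indicator W x + indicator (A - K) x)"
      have "(\<integral>\<^sup>+x. osc_at r (\<lambda>x. indicator A x *\<^sub>R c) x \<partial>\<nu>) \<le> ennreal (1 + D) * (\<integral>\<^sup>+x. ?h x \<partial>\<nu>)"
      proof (rule nn_integral_osc_at_le)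
        fix x y :: 'a assume xy: "dist x y < r"
        have "y \<in> K \<Longrightarrow> x \<notin> K \<Longrightarrow> x \<in> W" "x \<in> K \<Longrightarrow> y \<notin> K \<Longrightarrow> y \<in> W"
          using xy r by (force simp: W_def dist_commute)+
        then have "(x \<in> A) \<noteq> (y \<in> A) \<Longrightarrow> x \<in> W \<union> (A - K) \<or> y \<in> W \<union> (A - K)" using K(2) by auto
        then have "(x \<in> A) \<noteq> (y \<in> A) \<Longrightarrow> ennreal \<bar>c\<bar> \<le> ?h x \<or> ennreal \<bar>c\<bar> \<le> ?h y"
          by (auto simp: indicator_def distrib_left)
        then show "ennreal \<bar>indicator A x *\<^sub>R c - indicator A y *\<^sub>R c\<bar> \<le> ?h x + ?h y"
          by (cases "x \<in> A"; cases "y \<in> A") (auto intro: add_increasing add_increasing2)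
      qed (use r in auto)
      also have "(\<integral>\<^sup>+x. ?h x \<partial>\<nu>) = ennreal \<bar>c\<bar> * (emeasure \<nu> W + emeasure \<nu> (A - K))"
        by (simp add: nn_integral_cmult nn_integral_add)
      also have "ennreal (1 + D) * \<dots> \<le> ennreal (1 + D) * (ennreal \<bar>c\<bar> * (ennreal e' + ennreal e'))"
        using K(3) d(2) by (intro mult_left_mono add_mono) (auto simp: W_def)
      also have "\<dots> = ennreal ((1 + D) * (\<bar>c\<bar> * (e' + e')))"
        using D_pos e' by (simp add: ennreal_mult flip: ennreal_plus)
      also have "\<dots> \<le> ennreal e"
      proof (rule ennreal_leI)
        have "(1 + D) * (\<bar>c\<bar> * (e' + e')) \<le> (1 + D) * ((1 + \<bar>c\<bar>) * (e' + e'))"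
          using D_pos e' by (intro mult_left_mono mult_right_mono) auto
        also have "\<dots> = e' * (2 * (1 + D) * (1 + \<bar>c\<bar>))" by (simp add: algebra_simps)
        also have "\<dots> = e" using D_pos by (simp add: e'_def)
        finally show "(1 + D) * (\<bar>c\<bar> * (e' + e')) \<le> e" .
      qed
      finally show ?thesis .
    qed
    then show "\<exists>d>0. \<forall>r. 0 < r \<longrightarrow> r < d \<longrightarrow> (\<integral>\<^sup>+x. osc_at r (\<lambda>x. indicator A x *\<^sub>R c) x \<partial>\<nu>) \<le> ennreal e"
      using d(1) by blast
  qed
next
  case (add f g)
  have [measurable]: "f \<in> borel_measurable \<nu>" "g \<in> borel_measurable \<nu>" using add by auto
  show ?case
  proof (intro allI impI)
    fix e :: real assume e: "0 < e"
    then have "0 < e / 2" by simp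
    then obtain d1 d2 where d: "0 < d1" "\<forall>r. 0 < r \<longrightarrow> r < d1 \<longrightarrow> (\<integral>\<^sup>+x. osc_at r f x \<partial>\<nu>) \<le> ennreal (e/2)"
      "0 < d2" "\<forall>r. 0 < r \<longrightarrow> r < d2 \<longrightarrow> (\<integral>\<^sup>+x. osc_at r g x \<partial>\<nu>) \<le> ennreal (e/2)"
      using add.IH by blast
    have "(\<integral>\<^sup>+x. osc_at r (\<lambda>x. f x + g x) x \<partial>\<nu>) \<le> ennreal e" if r: "0 < r" "r < min d1 d2" for r
    proof -
      have "(\<integral>\<^sup>+x. osc_at r (\<lambda>x. f x + g x) x \<partial>\<nu>) \<le> (\<integral>\<^sup>+x. osc_at r f x \<partial>\<nu>) + (\<integral>\<^sup>+x. osc_at r g x \<partial>\<nu>)"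
        using r by (intro nn_integral_osc_at_add) auto
      also have "\<dots> \<le> ennreal (e/2) + ennreal (e/2)" using d r by (intro add_mono) auto
      also have "\<dots> = ennreal e" using e by (simp flip: ennreal_plus)
      finally show ?thesis .
    qed
    then show "\<exists>d>0. \<forall>r. 0 < r \<longrightarrow> r < d \<longrightarrow> (\<integral>\<^sup>+x. osc_at r (\<lambda>x. f x + g x) x \<partial>\<nu>) \<le> ennreal e"
      using d by (intro exI[of _ "min d1 d2"]) auto
  qed
next
  case (lim f s)
  have [measurable]: "f \<in> borel_measurable \<nu>" "\<And>i. s i \<in> borel_measurable \<nu>" using lim by auto
  show ?case
  proof (intro allI impI)
    fix e :: real assume e: "0 < e"
    define e' where "e' = e / (2 * (1 + D))"
    have e': "0 < e'" using e D_pos by (simp add: e'_def)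
    have "(\<lambda>i. \<integral>\<^sup>+x. norm (f x - s i x) \<partial>\<nu>) \<longlonglongrightarrow> 0"
    proof (rule Bochner_Integration.nn_integral_dominated_convergence_norm[where w = "\<lambda>x. 2 * norm (f x)"])
      show "(\<integral>\<^sup>+x. ennreal (2 * norm (f x)) \<partial>\<nu>) < \<infinity>"
        using lim.hyps(4) by (simp add: integrable_iff_bounded ennreal_mult nn_integral_cmult ennreal_mult_less_top)
    qed (use lim.hyps in \<open>auto intro!: AE_I2\<close>)
    then have "eventually (\<lambda>i. (\<integral>\<^sup>+x. norm (f x - s i x) \<partial>\<nu>) < ennreal e') sequentially"
      using e' by (intro order_tendstoD(2)) auto
    then obtain i where i: "(\<integral>\<^sup>+x. norm (f x - s i x) \<partial>\<nu>) < ennreal e'" by (auto simp: eventually_sequentially)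
    obtain d where d: "0 < d" "\<forall>r. 0 < r \<longrightarrow> r < d \<longrightarrow> (\<integral>\<^sup>+x. osc_at r (s i) x \<partial>\<nu>) \<le> ennreal (e/2)"
      using lim.IH[of i] e by (meson half_gt_zero)
    have "(\<integral>\<^sup>+x. osc_at r f x \<partial>\<nu>) \<le> ennreal e" if r: "0 < r" "r < d" for r
    proof -
      have "(\<integral>\<^sup>+x. osc_at r f x \<partial>\<nu>) = (\<integral>\<^sup>+x. osc_at r (\<lambda>x. s i x + (f x - s i x)) x \<partial>\<nu>)" by simp
      also have "\<dots> \<le> (\<integral>\<^sup>+x. osc_at r (s i) x \<partial>\<nu>) + (\<integral>\<^sup>+x. osc_at r (\<lambda>x. f x - s i x) x \<partial>\<nu>)"
        using r by (intro nn_integral_osc_at_add) auto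
      also have "(\<integral>\<^sup>+x. osc_at r (\<lambda>x. f x - s i x) x \<partial>\<nu>) \<le> ennreal (1 + D) * (\<integral>\<^sup>+x. norm (f x - s i x) \<partial>\<nu>)"
        using r by (intro nn_integral_osc_at_le) (auto simp flip: ennreal_plus intro!: ennreal_leI)
      also have "(\<integral>\<^sup>+x. osc_at r (s i) x \<partial>\<nu>) + ennreal (1 + D) * (\<integral>\<^sup>+x. norm (f x - s i x) \<partial>\<nu>)
          \<le> ennreal (e/2) + ennreal (1 + D) * ennreal e'"
        using d r i by (intro add_mono mult_left_mono) auto
      also have "\<dots> = ennreal e"
      proof -
        have "e / 2 + (1 + D) * e' = e" using D_pos by (simp add: e'_def field_simps)
        then show ?thesis using D_pos e e' by (simp flip: ennreal_mult ennreal_plus)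
      qed
      finally show ?thesis by (simp add: add_left_mono)
    qed
    then show "\<exists>d>0. \<forall>r. 0 < r \<longrightarrow> r < d \<longrightarrow> (\<integral>\<^sup>+x. osc_at r f x \<partial>\<nu>) \<le> ennreal e"
      using d(1) by blast
  qed
qed

end

section \<open>Upper gradients from a Poincare inequality\<close>

lemma AE_tendsto_0_if_summable_integrals:
  fixes \<phi> :: "nat \<Rightarrow> 'a \<Rightarrow> ennreal"
  assumes [measurable]: "\<And>j. \<phi> j \<in> borel_measurable M" and fin: "(\<Sum>j. \<integral>\<^sup>+x. \<phi> j x \<partial>M) < \<infinity>"
  shows "AE x in M. (\<lambda>j. \<phi> j x) \<longlonglongrightarrow> 0"
proof -
  have "(\<integral>\<^sup>+x. (\<Sum>j. \<phi> j x) \<partial>M) < \<infinity>" using fin by (subst nn_integral_suminf) auto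
  then have "AE x in M. (\<Sum>j. \<phi> j x) \<noteq> \<infinity>" by (intro nn_integral_PInf_AE) auto
  then show ?thesis
  proof eventually_elim
    case (elim x)
    have lt: "\<phi> j x < top" for j
      using sum_le_suminf[of "\<lambda>j. \<phi> j x" "{j}"] elim by (auto simp: less_top[symmetric] top_unique)
    then have eq: "ennreal (enn2real (\<phi> j x)) = \<phi> j x" for j by simp
    have "summable (\<lambda>j. enn2real (\<phi> j x))"
      using elim by (intro summable_suminf_not_top) (auto simp: eq)
    then have "(\<lambda>j. ennreal (enn2real (\<phi> j x))) \<longlonglongrightarrow> ennreal 0"
      by (intro tendsto_ennrealI summable_LIMSEQ_zero)
    then show ?case by (simp add: eq)
  qed
qed

text \<open>The upper limits of two sequences that stay within asymptotic distance \<open>A\<close>. If one of the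
  sequences is bounded, so is the other, which rules out infinite upper limits.\<close>

lemma osc_limsup_le:
  assumes b: "Bseq b" and le: "eventually (\<lambda>j. \<bar>a j - b j\<bar> \<le> A + e j) sequentially" and e: "e \<longlonglongrightarrow> 0"
  shows "osc (limsup (\<lambda>j. ereal (a j))) (limsup (\<lambda>j. ereal (b j))) \<le> ennreal A"
    and "Bseq a"
proof -
  obtain B where B: "\<And>j. \<bar>b j\<bar> \<le> B" using b by (auto simp: Bseq_def)
  have ev1: "eventually (\<lambda>j. e j < 1) sequentially" using e by (rule order_tendstoD(2)) simp
  have "eventually (\<lambda>j. \<bar>a j\<bar> \<le> B + \<bar>A\<bar> + 1) sequentially"
    using le ev1 by eventually_elim (use B in \<open>smt (verit)\<close>)
  then show "Bseq a" unfolding Bfun_def by (auto intro!: exI[of _ "max 1 (B + \<bar>A\<bar> + 1)"] elim!: eventually_mono)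
  have lim: "(\<lambda>j. ereal (A + e j)) \<longlonglongrightarrow> ereal A"
    using tendsto_add[OF tendsto_const e, of A] by (auto intro: tendsto_ereal)
  have step: "limsup (\<lambda>j. ereal (c j)) \<le> ereal A + limsup (\<lambda>j. ereal (d j))"
    if "eventually (\<lambda>j. c j \<le> (A + e j) + d j) sequentially" for c d :: "nat \<Rightarrow> real"
  proof -
    have "limsup (\<lambda>j. ereal (c j)) \<le> limsup (\<lambda>j. ereal (A + e j) + ereal (d j))"
      using that by (intro Limsup_mono) (auto elim!: eventually_mono)
    also have "\<dots> = ereal A + limsup (\<lambda>j. ereal (d j))"
      by (rule ereal_limsup_lim_add[OF lim]) auto
    finally show ?thesis .
  qed
  have 1: "limsup (\<lambda>j. ereal (a j)) \<le> ereal A + limsup (\<lambda>j. ereal (b j))"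
    by (rule step) (use le in \<open>auto elim!: eventually_mono\<close>)
  have 2: "limsup (\<lambda>j. ereal (b j)) \<le> ereal A + limsup (\<lambda>j. ereal (a j))"
    by (rule step) (use le in \<open>auto elim!: eventually_mono\<close>)
  have "limsup (\<lambda>j. ereal (b j)) \<le> ereal B"
    using B by (intro Limsup_bounded always_eventually) (auto simp: abs_le_iff)
  moreover have "ereal (-B) \<le> liminf (\<lambda>j. ereal (b j))"
    using B by (intro Liminf_bounded always_eventually allI) (auto simp: abs_le_iff intro: minus_le_iff[THEN iffD1])
  then have "ereal (-B) \<le> limsup (\<lambda>j. ereal (b j))"
    using Liminf_le_Limsup[of sequentially "\<lambda>j. ereal (b j)"] by (auto intro: order_trans)
  ultimately obtain \<beta> where \<beta>: "limsup (\<lambda>j. ereal (b j)) = ereal \<beta>"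
    by (cases "limsup (\<lambda>j. ereal (b j))") auto
  then obtain \<alpha> where \<alpha>: "limsup (\<lambda>j. ereal (a j)) = ereal \<alpha>"
    using 1 2 by (cases "limsup (\<lambda>j. ereal (a j))") auto
  show "osc (limsup (\<lambda>j. ereal (a j))) (limsup (\<lambda>j. ereal (b j))) \<le> ennreal A"
    using 1 2 unfolding \<alpha> \<beta> by (auto intro!: ennreal_leI)
qed

lemma epowr_add_le:
  assumes p: "1 \<le> p"
  shows "epowr (a + b) (1 / p) \<le> 2 * (epowr a (1 / p) + epowr b (1 / p))"
proof -
  have "a + b \<le> 2 * max a b" by (simp add: mult_2 add_mono)
  then have "epowr (a + b) (1 / p) \<le> epowr (2 * max a b) (1 / p)" using p by (intro epowr_mono) auto
  also have "\<dots> = epowr 2 (1 / p) * epowr (max a b) (1 / p)" using p by (intro epowr_mult) auto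
  also have "\<dots> \<le> 2 * (epowr a (1 / p) + epowr b (1 / p))"
  proof (intro mult_mono)
    have "2 powr (1 / p) \<le> 2 powr (1::real)" using p by (intro powr_mono) auto
    then show "epowr 2 (1 / p) \<le> 2" using epowr_ennreal[of 2 "1/p"] ennreal_leI[of "2 powr (1/p)" 2] by simp
    show "epowr (max a b) (1 / p) \<le> epowr a (1 / p) + epowr b (1 / p)" using p by (intro epowr_max_le) auto
  qed auto
  finally show ?thesis .
qed

context doubling_borel_measure
begin

definition mean :: "real \<Rightarrow> ('a \<Rightarrow> real) \<Rightarrow> 'a \<Rightarrow> real" where
  "mean r u x = (\<integral>y\<in>ball x r. u y \<partial>\<nu>) / measure \<nu> (ball x r)"

lemma measurable_mean [measurable]:
  assumes [measurable]: "u \<in> borel_measurable \<nu>"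
  shows "mean r u \<in> borel_measurable \<nu>"
  unfolding mean_def set_lebesgue_integral_def measure_def by measurable

lemma mean_diff_le:
  assumes [measurable]: "u \<in> borel_measurable \<nu>" and int: "set_integrable \<nu> (ball x r) u" and r: "0 < r"
  shows "ennreal \<bar>mean r u x - c\<bar> \<le> avg r (\<lambda>y. ennreal \<bar>u y - c\<bar>) x"
proof -
  let ?B = "ball x r"
  have m: "0 < measure \<nu> ?B" "emeasure \<nu> ?B = ennreal (measure \<nu> ?B)"
    using ball_pos[OF r, of x] by (auto simp: emeasure_eq_ennreal_measure zero_less_measure_iff)
  have intc: "set_integrable \<nu> ?B (\<lambda>_. c)"
    unfolding set_integrable_def real_scaleR_def
    by (intro integrable_mult_left integrable_real_indicator) auto
  have "mean r u x - c = (\<integral>y\<in>?B. (u y - c) \<partial>\<nu>) / measure \<nu> ?B"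
    using m int intc by (simp add: mean_def set_integral_diff(2) set_integral_const field_simps)
  then have "ennreal \<bar>mean r u x - c\<bar> = ennreal \<bar>\<integral>y\<in>?B. (u y - c) \<partial>\<nu>\<bar> / emeasure \<nu> ?B"
    using m by (simp add: abs_divide divide_ennreal)
  also have "\<dots> \<le> avg r (\<lambda>y. ennreal \<bar>u y - c\<bar>) x"
  proof (unfold avg_def, rule divide_right_mono_ennreal)
    have "ennreal (norm (\<integral>y. indicator ?B y *\<^sub>R (u y - c) \<partial>\<nu>)) \<le> (\<integral>\<^sup>+y. norm (indicator ?B y *\<^sub>R (u y - c)) \<partial>\<nu>)"
      using set_integral_diff(1)[OF int intc] unfolding set_integrable_def
      by (rule integral_norm_bound_ennreal)
    also have "\<dots> = (\<integral>\<^sup>+y\<in>?B. ennreal \<bar>u y - c\<bar> \<partial>\<nu>)"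
      by (intro nn_integral_cong) (auto simp: indicator_def)
    finally show "ennreal \<bar>\<integral>y\<in>?B. (u y - c) \<partial>\<nu>\<bar> \<le> (\<integral>\<^sup>+y\<in>?B. ennreal \<bar>u y - c\<bar> \<partial>\<nu>)"
      by (simp add: set_lebesgue_integral_def)
  qed
  finally show ?thesis .
qed

lemma set_integrable_if_oscillation_finite:
  assumes [measurable]: "u \<in> borel_measurable \<nu>" and fin: "(\<integral>\<^sup>+y\<in>ball x r. ennreal \<bar>u y - c\<bar> \<partial>\<nu>) < \<infinity>"
  shows "set_integrable \<nu> (ball x r) u"
  unfolding set_integrable_def
proof (rule integrableI_bounded)
  have "(\<integral>\<^sup>+y. norm (indicator (ball x r) y *\<^sub>R u y) \<partial>\<nu>)
      \<le> (\<integral>\<^sup>+y. ennreal \<bar>u y - c\<bar> * indicator (ball x r) y + ennreal \<bar>c\<bar> * indicator (ball x r) y \<partial>\<nu>)"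
    by (intro nn_integral_mono) (auto simp: indicator_def simp flip: ennreal_plus intro!: ennreal_leI)
  also have "\<dots> = (\<integral>\<^sup>+y\<in>ball x r. ennreal \<bar>u y - c\<bar> \<partial>\<nu>) + ennreal \<bar>c\<bar> * emeasure \<nu> (ball x r)"
    by (subst nn_integral_add) (auto simp: nn_integral_cmult_indicator)
  also have "\<dots> < \<infinity>" using fin by (simp add: ennreal_mult_less_top)
  finally show "(\<integral>\<^sup>+y. norm (indicator (ball x r) y *\<^sub>R u y) \<partial>\<nu>) < \<infinity>" .
qed measurable

end

text \<open>Here \<open>\<phi>\<close> may be discontinuous and is only known to vary little at the fixed scale \<open>r\<close>. A partition
  of \<open>[0, l]\<close> into pieces of length between \<open>r / 2\<close> and \<open>r\<close> suffices: on each piece \<open>r * E s\<close> is at most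
  twice the length of the piece times \<open>E s\<close>, for every \<open>s\<close> in it, hence at most twice the
  integral of \<open>E\<close>.\<close>

lemma coarse_chain_le_integral:
  fixes \<phi> :: "real \<Rightarrow> real" and E :: "real \<Rightarrow> ennreal"
  assumes E [measurable]: "E \<in> borel_measurable borel" and K: "0 \<le> K" and r: "0 < r" "r \<le> l"
    and le: "\<And>a b s. 0 \<le> a \<Longrightarrow> a \<le> s \<Longrightarrow> s \<le> b \<Longrightarrow> b \<le> l \<Longrightarrow> b - a < r \<Longrightarrow> ennreal \<bar>\<phi> a - \<phi> b\<bar> \<le> ennreal (K * r) * E s"
  shows "ennreal \<bar>\<phi> 0 - \<phi> l\<bar> \<le> ennreal (2 * K) * (\<integral>\<^sup>+s\<in>{0..l}. E s \<partial>lborel)"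
proof -
  have l: "0 < l" using r by simp
  define n where "n = Suc (nat \<lfloor>l / r\<rfloor>)"
  have n0: "0 < n" by (simp add: n_def)
  have "1 \<le> l / r" using r by simp
  then have "l / r < real n" "real n \<le> 2 * (l / r)" unfolding n_def by linarith+
  define h where "h = l / real n"
  have h0: "0 < h" using l n0 by (simp add: h_def)
  have "h < r" using \<open>l / r < real n\<close> r n0 by (simp add: h_def field_simps)
  have "r \<le> 2 * h" using \<open>real n \<le> 2 * (l / r)\<close> r n0 by (simp add: h_def field_simps)
  have piece: "osc (ereal (\<phi> (real i * (l / real n)))) (ereal (\<phi> (real (Suc i) * (l / real n))))
      \<le> (\<integral>\<^sup>+s\<in>{real i * (l / real n)..real (Suc i) * (l / real n)}. ennreal (2 * K) * E s \<partial>lborel)"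
    if i: "i < n" for i
  proof -
    define a b where "a = real i * (l / real n)" and "b = real (Suc i) * (l / real n)"
    have ab: "0 \<le> a" "a < b" "b \<le> l" "b - a = h"
      using uniform_partition_piece[OF i l] by (simp_all only: a_def b_def h_def)
    have "ennreal h * ennreal \<bar>\<phi> a - \<phi> b\<bar> = (\<integral>\<^sup>+s\<in>{a..b}. ennreal \<bar>\<phi> a - \<phi> b\<bar> \<partial>lborel)"
      using ab by (subst nn_integral_cmult_indicator) (auto simp: mult.commute)
    also have "\<dots> \<le> (\<integral>\<^sup>+s\<in>{a..b}. ennreal (K * r) * E s \<partial>lborel)"
      using le ab \<open>h < r\<close> by (intro nn_integral_mono) (auto simp: indicator_def)
    also have "\<dots> = ennreal (K * r) * (\<integral>\<^sup>+s\<in>{a..b}. E s \<partial>lborel)"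
      by (simp add: nn_integral_cmult mult.assoc)
    also have "\<dots> \<le> ennreal (K * (2 * h)) * (\<integral>\<^sup>+s\<in>{a..b}. E s \<partial>lborel)"
      using \<open>r \<le> 2 * h\<close> K by (intro mult_right_mono ennreal_leI mult_left_mono) auto
    also have "\<dots> = ennreal h * (ennreal (2 * K) * (\<integral>\<^sup>+s\<in>{a..b}. E s \<partial>lborel))"
    proof -
      have "ennreal (K * (2 * h)) = ennreal h * ennreal (2 * K)"
        using K h0 by (subst ennreal_mult[symmetric]) (auto simp: mult_ac)
      then show ?thesis by (simp add: mult.assoc)
    qed
    finally have "ennreal \<bar>\<phi> a - \<phi> b\<bar> \<le> ennreal (2 * K) * (\<integral>\<^sup>+s\<in>{a..b}. E s \<partial>lborel)"
      using h0 by (subst (asm) ennreal_mult_le_mult_iff) auto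
    then show ?thesis unfolding a_def[symmetric] b_def[symmetric]
      by (simp add: nn_integral_cmult mult.assoc)
  qed
  have "osc (ereal (\<phi> 0)) (ereal (\<phi> l))
      \<le> (\<Sum>i<n. osc (ereal (\<phi> (real i * (l / real n)))) (ereal (\<phi> (real (Suc i) * (l / real n)))))"
    by (rule osc_le_sum_uniform_partition[OF n0, of "\<lambda>t. ereal (\<phi> t)"])
  also have "\<dots> \<le> (\<Sum>i<n. \<integral>\<^sup>+s\<in>{real i * (l / real n)..real (Suc i) * (l / real n)}. ennreal (2 * K) * E s \<partial>lborel)"
    by (intro sum_mono piece) auto
  also have "\<dots> = (\<integral>\<^sup>+s\<in>{0..l}. ennreal (2 * K) * E s \<partial>lborel)"
    using l by (intro uniform_partition_sum n0) auto
  also have "\<dots> = ennreal (2 * K) * (\<integral>\<^sup>+s\<in>{0..l}. E s \<partial>lborel)"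
    by (simp add: nn_integral_cmult mult.assoc)
  finally show ?thesis by simp
qed

context doubling_borel_measure
begin

text \<open>Both means differ little from the constant \<open>c\<close> that belongs to the larger ball around \<open>z\<close>. That
  \<open>z\<close> is arbitrary near \<open>x\<close> and \<open>x'\<close> is what allows integrating the estimate along a curve.\<close>

lemma mean_diff_le_poincare:
  assumes [measurable]: "u \<in> borel_measurable \<nu>" and int: "\<And>x r. set_integrable \<nu> (ball x r) u"
    and r: "0 < r" and C: "0 \<le> C"
    and pi: "(\<integral>\<^sup>+y\<in>ball z (2 * r). ennreal \<bar>u y - c\<bar> \<partial>\<nu>) \<le> ennreal (C * (2 * r)) * emeasure \<nu> (ball z (2 * r)) * e"
    and x: "dist x z < r" "dist x' z < r"
  shows "ennreal \<bar>mean r u x - mean r u x'\<bar> \<le> ennreal (4 * C * D^2 * r) * e"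
proof -
  have *: "ennreal \<bar>mean r u x - c\<bar> \<le> ennreal (C * (2 * r) * D^2) * e" if x: "dist x z < r" for x
  proof -
    let ?m = "emeasure \<nu> (ball x r)"
    have sub: "ball x r \<subseteq> ball z (2 * r)"
    proof
      fix y assume "y \<in> ball x r" then show "y \<in> ball z (2 * r)"
        using x dist_triangle[of z y x] by (simp add: dist_commute)
    qed
    have "emeasure \<nu> (ball z (2 * r)) \<le> ennreal D * emeasure \<nu> (ball z r)" by (rule doubling[OF r])
    also have "\<dots> \<le> ennreal D * (ennreal D * ?m)" by (intro mult_left_mono ball_compare x) auto
    finally have m: "emeasure \<nu> (ball z (2 * r)) \<le> ennreal (D^2) * ?m"
      using D_pos by (simp add: ennreal_mult power2_eq_square mult.assoc)
    have "ennreal \<bar>mean r u x - c\<bar> \<le> avg r (\<lambda>y. ennreal \<bar>u y - c\<bar>) x"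
      by (rule mean_diff_le[OF assms(1) int r])
    also have "\<dots> \<le> ennreal (C * (2 * r) * D^2) * e"
      unfolding avg_def
    proof (rule divide_le_posI_ennreal[OF ball_pos[OF r]])
      have "(\<integral>\<^sup>+y\<in>ball x r. ennreal \<bar>u y - c\<bar> \<partial>\<nu>) \<le> (\<integral>\<^sup>+y\<in>ball z (2 * r). ennreal \<bar>u y - c\<bar> \<partial>\<nu>)"
        using sub by (intro nn_integral_mono) (auto simp: indicator_def)
      also have "\<dots> \<le> ennreal (C * (2 * r)) * emeasure \<nu> (ball z (2 * r)) * e" by (rule pi)
      also have "\<dots> \<le> ennreal (C * (2 * r)) * (ennreal (D^2) * ?m) * e"
        by (intro mult_right_mono mult_left_mono m) auto
      also have "\<dots> = ?m * (ennreal (C * (2 * r) * D^2) * e)"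
        using C r by (simp add: ennreal_mult mult_ac)
      finally show "(\<integral>\<^sup>+y\<in>ball x r. ennreal \<bar>u y - c\<bar> \<partial>\<nu>) \<le> ?m * (ennreal (C * (2 * r) * D^2) * e)" .
    qed
    finally show ?thesis .
  qed
  have "ennreal \<bar>mean r u x - mean r u x'\<bar> \<le> ennreal \<bar>mean r u x - c\<bar> + ennreal \<bar>mean r u x' - c\<bar>"
    by (auto simp flip: ennreal_plus intro!: ennreal_leI)
  also have "\<dots> \<le> ennreal (C * (2 * r) * D^2) * e + ennreal (C * (2 * r) * D^2) * e"
    by (intro add_mono * x)
  also have "\<dots> = ennreal (4 * C * D^2 * r) * e"
  proof -
    have "ennreal (C * (2 * r) * D^2) + ennreal (C * (2 * r) * D^2) = ennreal (4 * C * D^2 * r)"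
      using C r by (subst ennreal_plus[symmetric]) (auto simp: algebra_simps)
    then show ?thesis by (simp flip: distrib_right)
  qed
  finally show ?thesis .
qed

text \<open>The cutoff by balls of increasing radius turns the locally integrable \<open>u\<close> into integrable functions
  that agree with \<open>u\<close> near any given point from some index on.\<close>

lemma AE_mean_tendsto:
  assumes [measurable]: "u \<in> borel_measurable \<nu>" and int: "\<And>x r. set_integrable \<nu> (ball x r) u"
    and r: "\<And>j. 0 < r j" "\<And>j. r j \<le> 1"
    and small: "\<And>j. (\<integral>\<^sup>+x. osc_at (r j) (\<lambda>y. indicator (ball 0 (real j + 2)) y * u y) x \<partial>\<nu>) \<le> ennreal ((1/2)^j)"
  shows "AE x in \<nu>. (\<lambda>j. mean (r j) u x) \<longlonglongrightarrow> u x"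
proof -
  let ?u = "\<lambda>j y. indicator (ball 0 (real j + 2)) y * u y"
  have "(\<Sum>j. \<integral>\<^sup>+x. osc_at (r j) (?u j) x \<partial>\<nu>) \<le> (\<Sum>j. ennreal ((1/2)^j))"
    by (intro suminf_le small) auto
  also have "\<dots> < \<infinity>"
    using summable_geometric[of "1/2::real"] by (subst suminf_ennreal2) auto
  finally have "AE x in \<nu>. (\<lambda>j. osc_at (r j) (?u j) x) \<longlonglongrightarrow> 0"
    by (intro AE_tendsto_0_if_summable_integrals) auto
  then show ?thesis
  proof eventually_elim
    case (elim x)
    obtain k where k: "norm x < real k" using reals_Archimedean2 by blast
    have "ennreal \<bar>mean (r j) u x - u x\<bar> \<le> osc_at (r j) (?u j) x" if j: "k \<le> j" for j
    proof -
      have "ennreal \<bar>mean (r j) u x - u x\<bar> \<le> avg (r j) (\<lambda>y. ennreal \<bar>u y - u x\<bar>) x"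
        by (rule mean_diff_le[OF assms(1) int r(1)])
      also have "\<dots> \<le> osc_at (r j) (?u j) x"
        unfolding osc_at_def
      proof (rule avg_mono)
        fix y assume "y \<in> ball x (r j)"
        then have "norm y < real j + 2" "norm x < real j + 2"
          using norm_triangle_sub[of y x] r(2)[of j] k j by (auto simp: dist_norm norm_minus_commute)
        then show "ennreal \<bar>u y - u x\<bar> \<le> ennreal \<bar>?u j x - ?u j y\<bar>" by (simp add: abs_minus_commute)
      qed
      finally show ?thesis .
    qed
    then have "eventually (\<lambda>j. ennreal \<bar>mean (r j) u x - u x\<bar> \<le> osc_at (r j) (?u j) x) sequentially"
      by (auto simp: eventually_sequentially)
    then have "(\<lambda>j. ennreal \<bar>mean (r j) u x - u x\<bar>) \<longlonglongrightarrow> 0"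
      by (intro tendsto_sandwich[OF _ _ tendsto_const elim]) auto
    then have "(\<lambda>j. \<bar>mean (r j) u x - u x\<bar>) \<longlonglongrightarrow> 0"
      by (subst (asm) tendsto_ennreal_iff[where x = 0, simplified]) auto
    then have "(\<lambda>j. mean (r j) u x - u x) \<longlonglongrightarrow> 0" by (rule tendsto_rabs_zero_cancel)
    then show ?case by (rule LIM_zero_cancel)
  qed
qed

text \<open>A pair that satisfies the Poincare inequality on all balls comes from a function with an upper
  gradient in \<open>L\<^sup>p\<close>, after a change on a null set. The means of \<open>u\<close> over balls of radius \<open>r j\<close> vary along
  a curve by at most a constant times the line integral of the \<open>1 / p\<close>-th power of averages
  of \<open>f\<close>. These averages exceed \<open>f\<close> by at most \<open>\<psi> j\<close>, and the radii are chosen such that the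
  \<open>\<psi> j\<close> tend to zero in \<open>L\<^sup>1\<close> so fast that a single \<open>S\<close> in \<open>L\<^sup>p\<close> takes care of all the errors.
  On curves where \<open>S\<close> is integrable the upper limit \<open>v\<close> of the means therefore varies by at most a
  constant times the line integral of \<open>f powr (1 / p)\<close>. It is finite at one point of the curve,
  and hence at all points, provided that the curve does not stay in the null set \<open>F\<close> where the
  means need not converge. All other curves are disposed of by the maximum of the gradient
  with \<open>S\<close> and with \<open>\<infinity>\<close> on \<open>F\<close>. The convergence of the averages is strong in \<open>L\<^sup>1\<close>, which covers
  \<open>p = 1\<close> as well.\<close>

theorem upper_gradient_of_poincare_pair:
  assumes [measurable]: "u \<in> borel_measurable \<nu>" and f: "integrable \<nu> f" "\<And>x. 0 \<le> f x"
    and p: "1 \<le> p" and C: "0 \<le> C" and L: "1 \<le> L"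
    and pi: "\<And>z r. 0 < r \<Longrightarrow> \<exists>c. (\<integral>\<^sup>+y\<in>ball z r. ennreal \<bar>u y - c\<bar> \<partial>\<nu>)
        \<le> ennreal (C * r) * emeasure \<nu> (ball z r) * epowr (avg (L * r) (\<lambda>y. ennreal (f y)) z) (1 / p)"
  obtains v G where "v \<in> borel_measurable \<nu>" "AE x in \<nu>. v x = ereal (u x)" "upper_gradient UNIV v G"
    "(\<integral>\<^sup>+x. epowr (G x) p \<partial>\<nu>) < \<infinity>"
proof -
  have p0: "0 < p" using p by simp
  let ?f = "\<lambda>y. ennreal (f y)"
  have [measurable]: "f \<in> borel_measurable \<nu>" using f by auto
  have f_fin: "(\<integral>\<^sup>+x. ?f x \<partial>\<nu>) < \<infinity>" using f by (auto simp: integrable_iff_bounded)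
  have int: "set_integrable \<nu> (ball x r) u" for x r
  proof (cases "0 < r")
    case True
    obtain c where "(\<integral>\<^sup>+y\<in>ball x r. ennreal \<bar>u y - c\<bar> \<partial>\<nu>)
        \<le> ennreal (C * r) * emeasure \<nu> (ball x r) * epowr (avg (L * r) ?f x) (1 / p)" using pi[OF True] by blast
    also have "\<dots> < \<infinity>"
      using avg_lt_top[OF f_fin, of "L * r" x] True L by (simp add: ennreal_mult_less_top epowr_lt_top)
    finally show ?thesis by (rule set_integrable_if_oscillation_finite[OF assms(1)])
  next
    case False
    then have "ball x r = {}" by (simp add: ball_eq_empty)
    then show ?thesis by (simp only: set_integrable_def) simp
  qed
  let ?u = "\<lambda>j y. indicator (ball 0 (real j + 2)) y * u y"
  let ?eps = "\<lambda>j. (1/2)^j / real (Suc j) powr p"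
  define P where "P j r \<longleftrightarrow> 0 < r \<and> r \<le> 1 / real (Suc j)
      \<and> (\<integral>\<^sup>+x. osc_at r (?u j) x \<partial>\<nu>) \<le> ennreal ((1/2)^j)
      \<and> (\<integral>\<^sup>+x. osc_at (L * (2 * r)) f x \<partial>\<nu>) \<le> ennreal (?eps j)" for j r
  have "\<exists>r. P j r" for j
  proof -
    have iu: "integrable \<nu> (?u j)" using int[of 0 "real j + 2"] by (simp add: set_integrable_def)
    have pos1: "0 < (1/2::real)^j" by simp
    from osc_at_tendsto_0[OF iu, rule_format, OF pos1]
    obtain d1 where d1: "0 < d1" "\<forall>r. 0 < r \<longrightarrow> r < d1 \<longrightarrow> (\<integral>\<^sup>+x. osc_at r (?u j) x \<partial>\<nu>) \<le> ennreal ((1/2)^j)"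
      by (elim exE conjE)
    have pos2: "0 < ?eps j" by simp
    from osc_at_tendsto_0[OF f(1), rule_format, OF pos2]
    obtain d2 where d2: "0 < d2" "\<forall>r. 0 < r \<longrightarrow> r < d2 \<longrightarrow> (\<integral>\<^sup>+x. osc_at r f x \<partial>\<nu>) \<le> ennreal (?eps j)"
      by (elim exE conjE)
    define r where "r = min (1 / real (Suc j)) (min (d1 / 2) (d2 / (4 * L)))"
    have "0 < d2 / (4 * L)" using d2(1) L by simp
    then have r: "0 < r" "r \<le> 1 / real (Suc j)" "r < d1" "r \<le> d2 / (4 * L)"
      using d1(1) by (auto simp: r_def min_def)
    have "r * (4 * L) \<le> d2" using L r(4) by (simp add: pos_le_divide_eq)
    moreover have "0 < r * L" using L r by simp
    moreover have "r * (4 * L) = 4 * (r * L)" "L * (2 * r) = 2 * (r * L)" by simp_all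
    ultimately have Lr: "L * (2 * r) < d2" "0 < L * (2 * r)" by linarith+
    have "P j r"
      unfolding P_def using r d1(2)[rule_format, OF r(1,3)] d2(2)[rule_format, OF Lr(2,1)] by (intro conjI)
    then show ?thesis by (rule exI)
  qed
  then obtain r where r0: "\<And>j. P j (r j)" by metis
  have r: "0 < r j" "r j \<le> 1 / real (Suc j)"
    "(\<integral>\<^sup>+x. osc_at (r j) (?u j) x \<partial>\<nu>) \<le> ennreal ((1/2)^j)"
    "(\<integral>\<^sup>+x. osc_at (L * (2 * r j)) f x \<partial>\<nu>) \<le> ennreal (?eps j)" for j
    using r0[of j] unfolding P_def by blast+
  have r1: "r j \<le> 1" for j
  proof -
    have "1 / real (Suc j) \<le> 1" by simp
    then show ?thesis using r(2)[of j] by linarith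
  qed
  define m where "m j = mean (r j) u" for j
  define \<psi> where "\<psi> j = osc_at (L * (2 * r j)) f" for j
  have [measurable]: "m j \<in> borel_measurable \<nu>" "\<psi> j \<in> borel_measurable \<nu>" for j
    by (simp_all add: m_def \<psi>_def)
  have "AE x in \<nu>. (\<lambda>j. m j x) \<longlonglongrightarrow> u x"
    unfolding m_def by (rule AE_mean_tendsto[OF assms(1) int r(1) r1 r(3)])
  then obtain F where F0: "{x \<in> space \<nu>. \<not> (\<lambda>j. m j x) \<longlonglongrightarrow> u x} \<subseteq> F" "emeasure \<nu> F = 0" "F \<in> sets \<nu>"
    by (rule AE_E)
  have F: "F \<in> null_sets \<nu>" "\<And>x. x \<notin> F \<Longrightarrow> (\<lambda>j. m j x) \<longlonglongrightarrow> u x"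
    using F0 by auto
  have [measurable]: "F \<in> sets borel" using F by auto
  define v where "v x = limsup (\<lambda>j. ereal (m j x))" for x
  define g where "g x = epowr (?f x) (1 / p)" for x
  define q where "q j x = epowr (\<psi> j x) (1 / p)" for j x
  define S where "S x = (SUP j. of_nat (Suc j) * q j x)" for x
  define K where "K = 4 * C * D^2"
  have K: "0 \<le> K" using C by (simp add: K_def)
  define G where "G x = max (ennreal (4 * K) * g x) (max (S x) (\<infinity> * indicator F x))" for x
  have borel_eq: "borel_measurable \<nu> = (borel_measurable borel :: ('a \<Rightarrow> ennreal) set)"
    by (rule measurable_cong_sets[OF sets_eq refl])
  have "g \<in> borel_measurable \<nu>" "q j \<in> borel_measurable \<nu>" for j
    unfolding g_def q_def by measurable
  then have [measurable]: "g \<in> borel_measurable borel" "q j \<in> borel_measurable borel" for j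
    unfolding borel_eq by auto
  have [measurable]: "S \<in> borel_measurable borel" unfolding S_def by measurable
  have [measurable]: "G \<in> borel_measurable borel" unfolding G_def by measurable

  have v_meas: "v \<in> borel_measurable \<nu>" unfolding v_def by measurable
  have v_eq: "AE x in \<nu>. v x = ereal (u x)"
    using AE_not_in[OF F(1)]
  proof eventually_elim
    case (elim x)
    then have "(\<lambda>j. ereal (m j x)) \<longlonglongrightarrow> ereal (u x)" using F(2) by (intro tendsto_ereal)
    then show ?case unfolding v_def by (intro lim_imp_Limsup) auto
  qed

  have G_fin: "(\<integral>\<^sup>+x. epowr (G x) p \<partial>\<nu>) < \<infinity>"
  proof -
    have S: "(\<integral>\<^sup>+x. epowr (S x) p \<partial>\<nu>) < \<infinity>"
      unfolding S_def
    proof (rule nn_integral_epowr_weighted_SUP_finite)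
      show "(\<integral>\<^sup>+x. epowr (q j x) p \<partial>\<nu>) \<le> ennreal (?eps j)" for j
        using r(4)[of j] p0 by (simp add: q_def epowr_inverse \<psi>_def)
    qed (use p0 in auto)
    have "(\<integral>\<^sup>+x. epowr (ennreal (4 * K) * g x) p \<partial>\<nu>) = ennreal ((4 * K) powr p) * (\<integral>\<^sup>+x. ?f x \<partial>\<nu>)"
      unfolding g_def using p0 K by (simp add: epowr_mult epowr_inverse epowr_ennreal nn_integral_cmult)
    then have g: "(\<integral>\<^sup>+x. epowr (ennreal (4 * K) * g x) p \<partial>\<nu>) < \<infinity>"
      using f_fin by (simp add: ennreal_mult_less_top)
    show ?thesis
      unfolding G_def using S g p0 nn_integral_epowr_infinity_null_set[OF F(1), of p]
      by (intro nn_integral_epowr_max_finite) auto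
  qed

  have segment: "ennreal \<bar>m j (\<gamma> 0) - m j (\<gamma> l)\<bar>
      \<le> ennreal (4 * K) * line_integral g \<gamma> l + ennreal (4 * K) * (line_integral S \<gamma> l / of_nat (Suc j))"
    if c: "(\<gamma>, l) \<in> curves UNIV" and j: "r j \<le> l" for \<gamma> l j
  proof -
    note meas = measurable_borel_along_curve[OF c]
    define A where "A z = epowr (avg (L * (2 * r j)) ?f z) (1 / p)" for z
    have "A \<in> borel_measurable \<nu>" unfolding A_def by measurable
    then have [measurable]: "A \<in> borel_measurable borel" unfolding borel_eq .
    have "ennreal \<bar>m j (\<gamma> 0) - m j (\<gamma> l)\<bar>
        \<le> ennreal (2 * K) * (\<integral>\<^sup>+s\<in>{0..l}. A (\<gamma> s) * indicator {0..l} s \<partial>lborel)"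
    proof (rule coarse_chain_le_integral[OF meas K r(1) j])
      fix a b s assume s: "0 \<le> a" "a \<le> s" "s \<le> b" "b \<le> l" "b - a < r j"
      have d: "dist (\<gamma> a) (\<gamma> s) < r j" "dist (\<gamma> b) (\<gamma> s) < r j"
        using curve_dist_le[OF c, of a s] curve_dist_le[OF c, of s b] s by (auto simp: dist_commute)
      have "0 < 2 * r j" using r(1)[of j] by simp
      then obtain c where "(\<integral>\<^sup>+y\<in>ball (\<gamma> s) (2 * r j). ennreal \<bar>u y - c\<bar> \<partial>\<nu>)
        \<le> ennreal (C * (2 * r j)) * emeasure \<nu> (ball (\<gamma> s) (2 * r j)) * A (\<gamma> s)"
        unfolding A_def using pi by blast
      from mean_diff_le_poincare[OF assms(1) int r(1) C this d]
      show "ennreal \<bar>m j (\<gamma> a) - m j (\<gamma> b)\<bar> \<le> ennreal (K * r j) * (A (\<gamma> s) * indicator {0..l} s)"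
        using s by (simp add: m_def K_def)
    qed simp
    also have "(\<integral>\<^sup>+s\<in>{0..l}. A (\<gamma> s) * indicator {0..l} s \<partial>lborel)
        \<le> (\<integral>\<^sup>+s. 2 * (g (\<gamma> s) * indicator {0..l} s) + 2 * ((S (\<gamma> s) * indicator {0..l} s) / of_nat (Suc j)) \<partial>lborel)"
    proof (rule nn_integral_mono)
      fix s
      let ?z = "\<gamma> s"
      have "avg (L * (2 * r j)) ?f ?z \<le> avg (L * (2 * r j)) (\<lambda>y. ?f ?z + ennreal \<bar>f ?z - f y\<bar>) ?z"
        using f(2) by (intro avg_mono) (auto simp flip: ennreal_plus intro!: ennreal_leI)
      also have "\<dots> = ?f ?z + \<psi> j ?z"
        using L r(1)[of j] by (simp add: avg_add avg_const \<psi>_def osc_at_def)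
      finally have "A ?z \<le> epowr (?f ?z + \<psi> j ?z) (1 / p)"
        unfolding A_def using p0 by (intro epowr_mono) auto
      also have "\<dots> \<le> 2 * (g ?z + q j ?z)" unfolding g_def q_def by (rule epowr_add_le[OF p])
      also have "q j ?z \<le> S ?z / of_nat (Suc j)"
      proof -
        have "of_nat (Suc j) * q j ?z \<le> S ?z" unfolding S_def by (rule SUP_upper) simp
        then have "(of_nat (Suc j) * q j ?z) / of_nat (Suc j) \<le> S ?z / of_nat (Suc j)"
          by (rule divide_right_mono_ennreal)
        moreover have "(of_nat (Suc j) * q j ?z) / of_nat (Suc j) = q j ?z"
          by (subst mult.commute, rule ennreal_mult_divide_eq) (auto simp del: of_nat_Suc)
        ultimately show ?thesis by simp
      qed
      finally have "A ?z \<le> 2 * g ?z + 2 * (S ?z / of_nat (Suc j))" by (simp add: distrib_left add_left_mono mult_left_mono)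
      then show "A ?z * indicator {0..l} s * indicator {0..l} s
          \<le> 2 * (g ?z * indicator {0..l} s) + 2 * ((S ?z * indicator {0..l} s) / of_nat (Suc j))"
        by (auto simp: indicator_def)
    qed
    also have "\<dots> = 2 * line_integral g \<gamma> l + 2 * (line_integral S \<gamma> l / of_nat (Suc j))"
      unfolding line_integral_def using meas[of g] meas[of S]
      by (subst nn_integral_add) (auto simp: nn_integral_cmult nn_integral_divide)
    finally have "ennreal \<bar>m j (\<gamma> 0) - m j (\<gamma> l)\<bar>
        \<le> ennreal (2 * K) * (2 * line_integral g \<gamma> l + 2 * (line_integral S \<gamma> l / of_nat (Suc j)))"
      by (simp add: mult_left_mono)
    also have "\<dots> = (ennreal (2 * K) * 2) * line_integral g \<gamma> l + (ennreal (2 * K) * 2) * (line_integral S \<gamma> l / of_nat (Suc j))"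
      by (simp only: distrib_left mult.assoc)
    also have "ennreal (2 * K) * 2 = ennreal (4 * K)"
      using K ennreal_mult[of "2 * K" 2] by simp
    finally show ?thesis .
  qed

  have g_le_G: "ennreal (4 * K) * line_integral g \<gamma> l \<le> line_integral G \<gamma> l" if "(\<gamma>, l) \<in> curves UNIV" for \<gamma> l
    by (subst line_integral_cmult[symmetric, OF that]) (auto simp: G_def intro: line_integral_mono)

  (* boundedness of the means spreads from one end point to the other *)
  have good: "osc (v (\<gamma> 0)) (v (\<gamma> l)) \<le> ennreal (4 * K) * line_integral g \<gamma> l
      \<and> (Bseq (\<lambda>j. m j (\<gamma> 0)) \<longleftrightarrow> Bseq (\<lambda>j. m j (\<gamma> l)))"
    if c: "(\<gamma>, l) \<in> curves UNIV" and fin: "line_integral G \<gamma> l < \<infinity>" and B: "Bseq (\<lambda>j. m j (\<gamma> 0)) \<or> Bseq (\<lambda>j. m j (\<gamma> l))" for \<gamma> l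
  proof -
    have l: "0 < l" using c by (simp add: curves_def)
    have "ennreal (4 * K) * line_integral g \<gamma> l < top"
      using g_le_G[OF c] fin by simp
    then obtain A where A: "ennreal (4 * K) * line_integral g \<gamma> l = ennreal A" "0 \<le> A"
      by (cases "ennreal (4 * K) * line_integral g \<gamma> l") auto
    have "line_integral S \<gamma> l \<le> line_integral G \<gamma> l"
      unfolding G_def by (intro line_integral_mono max.coboundedI2 max.cobounded1)
    then have "line_integral S \<gamma> l < top" using fin by simp
    then obtain s where s: "line_integral S \<gamma> l = ennreal s" "0 \<le> s"
      by (cases "line_integral S \<gamma> l") auto
    define e where "e j = 4 * K * (s / real (Suc j))" for j
    have "(\<lambda>j. 4 * K * (s / real (Suc j))) \<longlonglongrightarrow> 4 * K * 0"
      by (intro tendsto_mult tendsto_const LIMSEQ_Suc[OF lim_const_over_n])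
    then have e: "e \<longlonglongrightarrow> 0" unfolding e_def by simp
    have "eventually (\<lambda>j. 1 / real (Suc j) < l) sequentially"
      by (rule order_tendstoD(2)[OF LIMSEQ_Suc[OF lim_const_over_n] l])
    then have le: "eventually (\<lambda>j. \<bar>m j (\<gamma> 0) - m j (\<gamma> l)\<bar> \<le> A + e j) sequentially"
    proof eventually_elim
      case (elim j)
      then have "r j \<le> l" using r(2)[of j] by linarith
      from segment[OF c this]
      have "ennreal \<bar>m j (\<gamma> 0) - m j (\<gamma> l)\<bar> \<le> ennreal A + ennreal (4 * K) * (ennreal s / ennreal (real (Suc j)))"
        unfolding A(1) s(1) ennreal_of_nat_eq_real_of_nat .
      also have "ennreal s / ennreal (real (Suc j)) = ennreal (s / real (Suc j))"
        using s(2) by (intro divide_ennreal) auto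
      also have "ennreal A + ennreal (4 * K) * ennreal (s / real (Suc j)) = ennreal (A + e j)"
        unfolding e_def using K A(2) s(2) by (subst ennreal_plus, simp, simp, subst ennreal_mult) auto
      finally show ?case using A(2) K s(2) by (subst (asm) ennreal_le_iff) (auto simp: e_def)
    qed
    then have le': "eventually (\<lambda>j. \<bar>m j (\<gamma> l) - m j (\<gamma> 0)\<bar> \<le> A + e j) sequentially"
      by (simp add: abs_minus_commute)
    show ?thesis
      using B
    proof
      assume "Bseq (\<lambda>j. m j (\<gamma> 0))"
      from osc_limsup_le[OF this le' e] this show ?thesis
        unfolding A(1) v_def by (simp add: osc_commute)
    next
      assume "Bseq (\<lambda>j. m j (\<gamma> l))"
      from osc_limsup_le[OF this le e] this show ?thesis
        unfolding A(1) v_def by simp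
    qed
  qed

  have "upper_gradient UNIV v G"
    unfolding upper_gradient_osc
  proof (intro conjI ballI, simp, clarify)
    fix \<gamma> l assume c: "(\<gamma>, l) \<in> curves (UNIV :: 'a set)"
    show "osc (v (\<gamma> 0)) (v (\<gamma> l)) \<le> line_integral G \<gamma> l"
    proof (cases "line_integral G \<gamma> l = \<infinity>")
      case False
      then have fin: "line_integral G \<gamma> l < \<infinity>" by (simp add: less_top)
      have l: "0 < l" using c by (simp add: curves_def)
      have "AE t in lborel. G (\<gamma> t) * indicator {0..l} t \<noteq> \<infinity>"
        using fin measurable_borel_along_curve[OF c, of G] unfolding line_integral_def by (intro nn_integral_PInf_AE) auto
      moreover have "\<not> (AE t in lborel. t \<notin> {0<..<l})"
        using l by (subst AE_iff_measurable[of "{0<..<l}"]) auto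
      ultimately have "\<exists>t. t \<in> {0<..<l} \<and> G (\<gamma> t) * indicator {0..l} t \<noteq> \<infinity>"
        by (metis (mono_tags, lifting) eventually_mono)
      then obtain t where t: "0 < t" "t < l" "G (\<gamma> t) \<noteq> \<infinity>" by (auto simp: indicator_def split: if_splits)
      (* the curve has a point outside F, from which boundedness reaches its initial point *)
      have "\<gamma> t \<notin> F" using t(3) unfolding G_def by (auto simp: max_def indicator_def top_unique split: if_splits)
      then have "Bseq (\<lambda>j. m j (\<gamma> t))" using F(2) by (intro convergent_imp_Bseq convergentI)
      moreover
      have sub: "(\<gamma>, t) \<in> curves UNIV"
        using subcurve[OF c, of 0 t UNIV] t by simp
      have "line_integral G \<gamma> t \<le> line_integral G \<gamma> l"
        unfolding line_integral_def using t by (intro nn_integral_mono) (auto simp: indicator_def)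
      then have "line_integral G \<gamma> t < \<infinity>" using fin by simp
      ultimately have "Bseq (\<lambda>j. m j (\<gamma> 0))" using good[OF sub] by blast
      then have "osc (v (\<gamma> 0)) (v (\<gamma> l)) \<le> ennreal (4 * K) * line_integral g \<gamma> l"
        using good[OF c fin] by blast
      also have "\<dots> \<le> line_integral G \<gamma> l" by (rule g_le_G[OF c])
      finally show ?thesis .
    qed simp
  qed
  then show ?thesis using that v_meas v_eq G_fin by blast
qed

end

section \<open>Weighted measures as completions of Borel measures\<close>

text \<open>Upper gradients are Borel functions and Fubini is applied to Borel functions, while functions in the
  Sobolev spaces are only measurable for the completed measure. Both completions, of Lebesgue measure
  and of \<open>w dx\<close>, change Borel sets by subsets of Borel null sets only, so they amount to a
  single completion of a Borel measure.\<close>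

lemma weighted_measure_eq_completion:
  fixes w :: "'a::euclidean_space \<Rightarrow> real"
  assumes w: "weight w"
  obtains \<nu> :: "'a measure" where "sets \<nu> = sets borel" "weighted_measure w = completion \<nu>"
proof -
  have "w \<in> borel_measurable (completion lborel)" using w by (simp add: weight_def)
  then obtain w' where w' [measurable]: "w' \<in> borel_measurable lborel" and ae: "AE x in lborel. w x = w' x"
    using completion_ex_borel_measurable_real by blast
  define \<nu> where "\<nu> = density lborel (\<lambda>x. ennreal (w' x))"
  define M where "M = density lebesgue (\<lambda>x. ennreal (w x))"
  have w'l [measurable]: "w' \<in> borel_measurable lebesgue" by (rule measurable_completion) simp
  have wl [measurable]: "w \<in> borel_measurable lebesgue" using w by (simp add: weight_def)
  have M': "M = density lebesgue (\<lambda>x. ennreal (w' x))"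
    unfolding M_def using AE_completion[OF ae] by (intro density_cong) (auto elim!: eventually_mono)
  have sets: "sets \<nu> = sets borel" by (simp add: \<nu>_def)
  have sM: "sets M = sets lebesgue" by (simp add: M_def)
  have emM: "emeasure M A = emeasure \<nu> A" if A: "A \<in> sets borel" for A
  proof -
    have Al: "A \<in> sets lebesgue" using A by (simp add: sets_completionI_sets)
    have "emeasure M A = (\<integral>\<^sup>+x. ennreal (w' x) * indicator A x \<partial>lebesgue)"
      unfolding M' using Al by (intro emeasure_density) auto
    also have "\<dots> = (\<integral>\<^sup>+x. ennreal (w' x) * indicator A x \<partial>lborel)" by (rule nn_integral_completion)
    also have "\<dots> = emeasure \<nu> A"
      unfolding \<nu>_def using A by (intro emeasure_density[symmetric]) auto
    finally show ?thesis .
  qed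
  have nl: "N \<in> null_sets \<nu>" if N: "N \<in> null_sets lborel" for N
  proof -
    have "(\<integral>\<^sup>+x\<in>N. ennreal (w' x) \<partial>lborel) = 0" by (rule nn_integral_null_set[OF N])
    then show ?thesis using N unfolding \<nu>_def
      by (intro null_setsI) (auto simp: emeasure_density)
  qed
  have dec: "\<exists>S N. S \<in> sets borel \<and> N \<in> null_sets \<nu> \<and> S \<subseteq> A \<and> A \<subseteq> S \<union> N" if "A \<in> sets lebesgue" for A
  proof -
    from that obtain S N N' where "A = S \<union> N" "N \<subseteq> N'" "N' \<in> null_sets lborel" "S \<in> sets lborel"
      by (rule sets_completionE)
    then show ?thesis using nl[of N'] by (intro exI[of _ S] exI[of _ N']) auto
  qed
  have nM: "\<exists>N'. N' \<in> null_sets \<nu> \<and> N \<subseteq> N'" if N: "N \<in> null_sets M" for N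
  proof -
    have Nl: "N \<in> sets lebesgue" using N sM by auto
    obtain S N1 where S: "S \<in> sets borel" "N1 \<in> null_sets \<nu>" "S \<subseteq> N" "N \<subseteq> S \<union> N1"
      using dec[OF Nl] by blast
    have "emeasure M S \<le> emeasure M N" using S(3) N by (intro emeasure_mono) auto
    then have "S \<in> null_sets \<nu>" using N emM[OF S(1)] S(1) sets by (auto intro!: null_setsI)
    then show ?thesis using S by (intro exI[of _ "S \<union> N1"]) auto
  qed
  have "completion M = completion \<nu>"
  proof (rule measure_eqI)
    have *: "\<exists>S N. S \<in> sets borel \<and> N \<in> null_sets \<nu> \<and> S \<subseteq> A \<and> A \<subseteq> S \<union> N" if A: "A \<in> sets (completion M)" for A
    proof -
      from A obtain S N N' where A: "A = S \<union> N" "N \<subseteq> N'" "N' \<in> null_sets M" "S \<in> sets M"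
        by (rule sets_completionE)
      obtain S1 N1 where S1: "S1 \<in> sets borel" "N1 \<in> null_sets \<nu>" "S1 \<subseteq> S" "S \<subseteq> S1 \<union> N1"
        using dec[of S] A(4) sM by blast
      obtain N2 where N2: "N2 \<in> null_sets \<nu>" "N' \<subseteq> N2" using nM[OF A(3)] by blast
      show ?thesis
        using A S1 N2 by (intro exI[of _ S1] exI[of _ "N1 \<union> N2"] conjI) (auto intro: null_sets.Un)
    qed
    have sub: "A \<in> sets (completion \<nu>) \<and> (\<exists>S N. S \<in> sets borel \<and> N \<in> null_sets \<nu> \<and> A = S \<union> (A \<inter> N))"
      if A: "A \<in> sets (completion M)" for A
    proof -
      obtain S N where S: "S \<in> sets borel" "N \<in> null_sets \<nu>" "S \<subseteq> A" "A \<subseteq> S \<union> N" using *[OF A] by blast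
      then have eq: "A = S \<union> (A \<inter> N)" by blast
      have "A \<in> sets (completion \<nu>)"
        by (rule sets_completionI[OF eq _ S(2)]) (use S sets in auto)
      then show ?thesis using S eq by blast
    qed
    have bM: "A \<in> sets M" if "A \<in> sets borel" for A
      using that sM by (simp add: sets_completionI_sets)
    have nullM: "N \<in> null_sets M" if "N \<in> null_sets \<nu>" for N
      using that sets emM bM by (auto simp: null_sets_def)
    show "sets (completion M) = sets (completion \<nu>)"
    proof (intro antisym subsetI)
      fix A assume "A \<in> sets (completion \<nu>)"
      then obtain S N N' where "A = S \<union> N" "N \<subseteq> N'" "N' \<in> null_sets \<nu>" "S \<in> sets \<nu>"
        by (rule sets_completionE)
      then show "A \<in> sets (completion M)"
        using bM[of S] nullM[of N'] sets by (intro sets_completionI[of A S N N']) auto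
    qed (use sub in blast)
    fix A assume A: "A \<in> sets (completion M)"
    obtain S N where S: "S \<in> sets borel" "N \<in> null_sets \<nu>" "A = S \<union> (A \<inter> N)" using sub[OF A] by blast
    have 1: "A \<inter> N \<in> null_sets (completion M)"
      using nullM[OF S(2)] null_sets_completion_subset[of "A \<inter> N" N M] by (auto intro: null_sets_completionI)
    have 2: "A \<inter> N \<in> null_sets (completion \<nu>)"
      using S(2) null_sets_completion_subset[of "A \<inter> N" N \<nu>] by (auto intro: null_sets_completionI)
    have "emeasure (completion M) A = emeasure (completion M) (S \<union> (A \<inter> N))" using S(3) by simp
    also have "\<dots> = emeasure (completion M) S" using bM[OF S(1)] 1 by (intro emeasure_Un_null_set) auto
    also have "\<dots> = emeasure \<nu> S" using bM[OF S(1)] emM[OF S(1)] by simp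
    also have "\<dots> = emeasure (completion \<nu>) S" using S(1) sets by simp
    also have "\<dots> = emeasure (completion \<nu>) (S \<union> (A \<inter> N))"
      using S(1) sets 2 by (intro emeasure_Un_null_set[symmetric]) auto
    also have "\<dots> = emeasure (completion \<nu>) A" using S(3) by simp
    finally show "emeasure (completion M) A = emeasure (completion \<nu>) A" .
  qed
  then show ?thesis using that[OF sets] by (simp add: weighted_measure_def M_def)
qed

section \<open>Truncation\<close>

definition trunc :: "nat \<Rightarrow> ereal \<Rightarrow> ereal" where
  "trunc k s = max (ereal (- real k)) (min (ereal (real k)) s)"

lemma trunc_ereal: "trunc k (ereal a) = ereal (max (- real k) (min (real k) a))"
  by (simp add: trunc_def ereal_max ereal_min)

lemma abs_trunc_le: "\<bar>trunc k s\<bar> \<le> ereal (real k)"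
  by (cases s) (auto simp: trunc_def min_def max_def)

lemma osc_trunc_le: "osc (trunc k s) (trunc k t) \<le> osc s t"
proof (cases s; cases t)
  fix a b :: real assume "s = ereal a" "t = ereal b"
  moreover have "\<bar>max (- real k) (min (real k) a) - max (- real k) (min (real k) b)\<bar> \<le> \<bar>a - b\<bar>"
    by linarith
  ultimately show ?thesis by (simp only: trunc_ereal osc_ereal ennreal_leI)
qed simp_all

lemma measurable_trunc [measurable]: "trunc k \<in> borel_measurable borel"
  unfolding trunc_def by measurable

lemma upper_gradient_trunc: "upper_gradient Z u g \<Longrightarrow> upper_gradient Z (\<lambda>x. trunc k (u x)) g"
  unfolding upper_gradient_osc by (blast intro: order_trans[OF osc_trunc_le])

lemma abs_diff_osc: "e2ennreal \<bar>s - ereal c\<bar> = osc s (ereal c)"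
  by (cases s) (auto simp: osc_def)

text \<open>The set where \<open>\<bar>U\<bar> \<le> m\<close> has positive measure for some \<open>m\<close>, and there all later truncations coincide
  with \<open>U\<close>. Hence the constants \<open>c\<close> that belong to the truncations stay bounded.\<close>

lemma nn_integral_finite_if_truncations_oscillate_boundedly:
  fixes U :: "'a \<Rightarrow> real"
  assumes [measurable]: "U \<in> borel_measurable M" "B \<in> sets M"
    and B: "0 < emeasure M B" "emeasure M B < \<infinity>" and K: "K < \<infinity>"
    and osc: "\<And>k::nat. \<exists>c. (\<integral>\<^sup>+y\<in>B. ennreal \<bar>max (- real k) (min (real k) (U y)) - c\<bar> \<partial>M) \<le> K"
  shows "(\<integral>\<^sup>+y\<in>B. ennreal \<bar>U y\<bar> \<partial>M) < \<infinity>"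
proof -
  define A where "A m = {y\<in>space M. y \<in> B \<and> \<bar>U y\<bar> \<le> real m}" for m :: nat
  have [measurable]: "A m \<in> sets M" for m unfolding A_def by measurable
  have "(\<lambda>m. emeasure M (A m)) \<longlonglongrightarrow> emeasure M (\<Union>m. A m)"
  proof (rule Lim_emeasure_incseq)
    show "incseq A" by (auto simp: A_def incseq_def intro: order_trans)
  qed auto
  moreover have "(\<Union>m. A m) = B"
  proof -
    have "\<exists>m. \<bar>U y\<bar> \<le> real m" for y by (rule real_arch_simple)
    then show ?thesis using sets.sets_into_space[of B M] by (auto simp: A_def)
  qed
  ultimately have "eventually (\<lambda>m. 0 < emeasure M (A m)) sequentially"
    using B(1) by (intro order_tendstoD(1)) auto
  then obtain m where m: "0 < emeasure M (A m)" by (auto simp: eventually_sequentially)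
  have AB: "A m \<subseteq> B" by (auto simp: A_def)
  have Am_fin: "emeasure M (A m) < \<infinity>" using emeasure_mono[OF AB, of M] B(2) by (auto intro: le_less_trans)
  define T where "T k y = max (- real k) (min (real k) (U y))" for k y
  have [measurable]: "T k \<in> borel_measurable M" for k unfolding T_def by measurable
  define Q where "Q = (K + ennreal (real m) * emeasure M (A m)) / emeasure M (A m)"
  have Q: "Q < \<infinity>" using K Am_fin m
    unfolding Q_def by (auto simp: less_top[symmetric] ennreal_divide_eq_top_iff ennreal_mult_eq_top_iff)
  have bound: "(\<integral>\<^sup>+y\<in>B. ennreal \<bar>T k y\<bar> \<partial>M) \<le> K + Q * emeasure M B" if k: "m \<le> k" for k
  proof -
    obtain c where c: "(\<integral>\<^sup>+y\<in>B. ennreal \<bar>T k y - c\<bar> \<partial>M) \<le> K" using osc[of k] unfolding T_def by blast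
    have "ennreal \<bar>c\<bar> * emeasure M (A m) = (\<integral>\<^sup>+y. ennreal \<bar>c\<bar> * indicator (A m) y \<partial>M)"
      by (rule nn_integral_cmult_indicator[symmetric]) simp
    also have "\<dots> \<le> (\<integral>\<^sup>+y. ennreal \<bar>T k y - c\<bar> * indicator B y + ennreal (real m) * indicator (A m) y \<partial>M)"
    proof (intro nn_integral_mono)
      fix y
      show "ennreal \<bar>c\<bar> * indicator (A m) y
          \<le> ennreal \<bar>T k y - c\<bar> * indicator B y + ennreal (real m) * indicator (A m) y"
      proof (cases "y \<in> A m")
        case True
        then have "\<bar>U y\<bar> \<le> real m" "y \<in> B" by (auto simp: A_def)
        then have "T k y = U y" using k by (auto simp: T_def)
        then have "\<bar>c\<bar> \<le> \<bar>T k y - c\<bar> + real m" using \<open>\<bar>U y\<bar> \<le> real m\<close> by linarith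
        then show ?thesis using True \<open>y \<in> B\<close> by (simp add: ennreal_leI flip: ennreal_plus)
      qed simp
    qed
    also have "\<dots> = (\<integral>\<^sup>+y\<in>B. ennreal \<bar>T k y - c\<bar> \<partial>M) + ennreal (real m) * emeasure M (A m)"
      by (subst nn_integral_add) (auto simp: nn_integral_cmult_indicator)
    also have "\<dots> \<le> K + ennreal (real m) * emeasure M (A m)" by (rule add_right_mono[OF c])
    finally have "ennreal \<bar>c\<bar> * emeasure M (A m) / emeasure M (A m) \<le> Q"
      unfolding Q_def by (rule divide_right_mono_ennreal)
    then have cQ: "ennreal \<bar>c\<bar> \<le> Q" using m Am_fin by (simp add: ennreal_mult_divide_eq)
    have "(\<integral>\<^sup>+y\<in>B. ennreal \<bar>T k y\<bar> \<partial>M)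
        \<le> (\<integral>\<^sup>+y. ennreal \<bar>T k y - c\<bar> * indicator B y + ennreal \<bar>c\<bar> * indicator B y \<partial>M)"
      by (intro nn_integral_mono) (auto simp: indicator_def simp flip: ennreal_plus intro!: ennreal_leI)
    also have "\<dots> = (\<integral>\<^sup>+y\<in>B. ennreal \<bar>T k y - c\<bar> \<partial>M) + ennreal \<bar>c\<bar> * emeasure M B"
      by (subst nn_integral_add) (auto simp: nn_integral_cmult_indicator)
    also have "\<dots> \<le> K + Q * emeasure M B" by (intro add_mono c mult_right_mono cQ) simp
    finally show ?thesis .
  qed
  have "(\<integral>\<^sup>+y\<in>B. ennreal \<bar>U y\<bar> \<partial>M) = (\<integral>\<^sup>+y. liminf (\<lambda>k. ennreal \<bar>T k y\<bar> * indicator B y) \<partial>M)"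
  proof (intro nn_integral_cong)
    fix y
    obtain n :: nat where n: "\<bar>U y\<bar> \<le> real n" using real_arch_simple by blast
    have "eventually (\<lambda>k. ennreal \<bar>T k y\<bar> * indicator B y = ennreal \<bar>U y\<bar> * indicator B y) sequentially"
      unfolding eventually_sequentially using n by (intro exI[of _ n]) (auto simp: T_def)
    then have "(\<lambda>k. ennreal \<bar>T k y\<bar> * indicator B y) \<longlonglongrightarrow> ennreal \<bar>U y\<bar> * indicator B y"
      by (rule tendsto_eventually)
    then show "ennreal \<bar>U y\<bar> * indicator B y = liminf (\<lambda>k. ennreal \<bar>T k y\<bar> * indicator B y)"
      by (intro lim_imp_Liminf[symmetric]) auto
  qed
  also have "\<dots> \<le> liminf (\<lambda>k. \<integral>\<^sup>+y\<in>B. ennreal \<bar>T k y\<bar> \<partial>M)" by (intro nn_integral_liminf) measurable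
  also have "\<dots> \<le> K + Q * emeasure M B"
    using bound by (intro Liminf_le) (auto simp: eventually_sequentially)
  also have "\<dots> < \<infinity>" using K Q B(2) by (simp add: ennreal_mult_less_top)
  finally show ?thesis .
qed

section \<open>Extending Dirichlet functions across a null set\<close>

lemma supports_poincareD:
  assumes "supports_poincare p \<mu> Z"
  obtains C L where "0 < C" "1 \<le> L"
    "\<forall>x r u g. x \<in> Z \<longrightarrow> 0 < r \<longrightarrow> integrable_ereal_on \<mu> (Z \<inter> ball x (L * r)) u \<longrightarrow>
       upper_gradient (Z \<inter> ball x (L * r)) u g \<longrightarrow>
       (\<integral>\<^sup>+y\<in>Z \<inter> ball x r. osc (u y) (ereal (average \<mu> (Z \<inter> ball x r) u)) \<partial>\<mu>) / emeasure \<mu> (Z \<inter> ball x r)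
         \<le> ennreal (C * r) * epowr ((\<integral>\<^sup>+y\<in>Z \<inter> ball x (L * r). epowr (g y) p \<partial>\<mu>) / emeasure \<mu> (Z \<inter> ball x (L * r))) (1 / p)"
  using assms unfolding supports_poincare_def Let_def abs_diff_osc by blast

locale null_complement = doubling_borel_measure \<nu> D
  for \<nu> :: "'a::euclidean_space measure" and D :: real +
  fixes p :: real and E :: "'a set"
  assumes p: "1 \<le> p" and E_null: "E \<in> null_sets (completion \<nu>)"
begin

abbreviation \<mu> :: "'a measure" where "\<mu> \<equiv> completion \<nu>"

lemma p0: "0 < p" using p by simp

lemma complement_sets [simp]: "- E \<in> sets \<mu>"
  using sets.compl_sets[of E "\<mu>"] E_null by (auto simp: Compl_eq_Diff_UNIV)

lemma AE_complement: "AE x in \<nu>. x \<in> - E"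
  using AE_not_in[OF E_null] by (simp add: AE_completion_iff)

lemma complement_ball_sets [simp]: "- E \<inter> ball x r \<in> sets \<mu>"
  by (intro sets.Int) (auto simp: sets_completionI_sets)

lemma nn_integral_complement_Int:
  "(\<integral>\<^sup>+y\<in>- E \<inter> A. f y \<partial>\<mu>) = (\<integral>\<^sup>+y\<in>A. f y \<partial>\<nu>)"
proof -
  have "AE y in \<nu>. f y * indicator (- E \<inter> A) y = f y * indicator A y"
    using AE_complement by eventually_elim (simp add: indicator_def)
  then show ?thesis by (subst nn_integral_completion, intro nn_integral_cong_AE)
qed

lemma emeasure_complement_ball: "emeasure \<mu> (- E \<inter> ball x r) = emeasure \<nu> (ball x r)"
proof -
  have "emeasure \<mu> (- E \<inter> ball x r) = (\<integral>\<^sup>+y\<in>- E \<inter> ball x r. 1 \<partial>\<mu>)" by simp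
  also have "\<dots> = (\<integral>\<^sup>+y\<in>ball x r. 1 \<partial>\<nu>)" by (rule nn_integral_complement_Int)
  finally show ?thesis by simp
qed

lemma complement_dense: "0 < r \<Longrightarrow> \<exists>x\<in>- E. dist z x < r"
proof (rule ccontr)
  assume r: "0 < r" and no: "\<not> (\<exists>x\<in>- E. dist z x < r)"
  have "AE y in \<nu>. y \<notin> ball z r" using AE_complement by eventually_elim (use no in auto)
  then have "emeasure \<nu> (ball z r) = 0" by (subst (asm) AE_iff_measurable[of "ball z r"]) auto
  then show False using ball_pos[OF r, of z] by simp
qed

lemma measurable_restrict_completion:
  assumes "g \<in> measurable (restrict_space borel A) N"
  shows "g \<in> measurable (restrict_space \<mu> A) N"
proof -
  have "(\<lambda>x. x) \<in> measurable \<nu> borel" by (rule measurable_ident_sets) simp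
  then have "(\<lambda>x. x) \<in> measurable \<mu> borel" by (rule measurable_completion)
  then have "(\<lambda>x. x) \<in> measurable (restrict_space \<mu> A) (restrict_space borel A)"
    by (rule measurable_restrict_space3) simp
  from measurable_compose[OF this assms] show ?thesis .
qed

text \<open>The set \<open>- E\<close> need not be Borel, so a Borel function on it is replaced by a Borel function on the whole
  space that agrees with it almost everywhere.\<close>

lemma borel_version_ennreal:
  fixes g :: "'a \<Rightarrow> ennreal"
  assumes g: "g \<in> borel_measurable (restrict_space \<mu> A)" and A: "A \<in> sets \<mu>"
  obtains g' where "g' \<in> borel_measurable borel" "AE x in \<nu>. x \<in> A \<longrightarrow> g x = g' x"
proof -
  have "(\<lambda>x. g x * indicator A x) \<in> borel_measurable \<mu>"
    using g A by (subst (asm) borel_measurable_restrict_space_iff_ennreal) auto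
  from completion_ex_borel_measurable[OF this]
  obtain g' where g': "g' \<in> borel_measurable \<nu>" "AE x in \<nu>. g x * indicator A x = g' x" by blast
  have "borel_measurable \<nu> = (borel_measurable borel :: ('a \<Rightarrow> ennreal) set)"
    by (rule measurable_cong_sets[OF sets_eq refl])
  then have "g' \<in> borel_measurable borel" using g'(1) by simp
  moreover have "AE x in \<nu>. x \<in> A \<longrightarrow> g x = g' x" using g'(2) by eventually_elim auto
  ultimately show ?thesis by (rule that)
qed

lemma borel_version_real:
  assumes u: "u \<in> borel_measurable (restrict_space \<mu> A)" and A: "A \<in> sets \<mu>"
    and fin: "AE x in \<nu>. x \<in> A \<longrightarrow> \<bar>u x\<bar> \<noteq> (\<infinity>::ereal)"
  obtains U :: "'a \<Rightarrow> real" where "U \<in> borel_measurable \<nu>" "AE x in \<nu>. x \<in> A \<longrightarrow> u x = ereal (U x)"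
proof -
  have "(\<lambda>x. real_of_ereal (u x)) \<in> borel_measurable (restrict_space \<mu> A)"
    using u by measurable
  then have "(\<lambda>x. indicator A x *\<^sub>R real_of_ereal (u x)) \<in> borel_measurable \<mu>"
    using A by (subst (asm) borel_measurable_restrict_space_iff) auto
  from completion_ex_borel_measurable_real[OF this]
  obtain U where U: "U \<in> borel_measurable \<nu>" "AE x in \<nu>. indicator A x *\<^sub>R real_of_ereal (u x) = U x" by blast
  have "AE x in \<nu>. x \<in> A \<longrightarrow> u x = ereal (U x)"
    using U(2) fin by eventually_elim (auto simp: ereal_real)
  then show ?thesis using U(1) that by blast
qed

lemma avg_le_avg:
  assumes sub: "ball x s \<subseteq> ball z t" and s: "0 < s"
    and le: "emeasure \<nu> (ball z t) \<le> c * emeasure \<nu> (ball x s)"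
  shows "avg s f x \<le> c * avg t f z"
proof -
  have "x \<in> ball z t" using subsetD[OF sub, of x] s by simp
  then have t: "0 < t" using zero_le_dist[of z x] by (simp del: zero_le_dist)
  show ?thesis
    unfolding avg_def[of s]
  proof (rule divide_le_posI_ennreal[OF ball_pos[OF s]])
    have "(\<integral>\<^sup>+y\<in>ball x s. f y \<partial>\<nu>) \<le> (\<integral>\<^sup>+y\<in>ball z t. f y \<partial>\<nu>)"
      using sub by (intro nn_integral_mono) (auto simp: indicator_def)
    also have "\<dots> = avg t f z * emeasure \<nu> (ball z t)"
      unfolding avg_def using t by simp
    also have "\<dots> \<le> avg t f z * (c * emeasure \<nu> (ball x s))" by (intro mult_left_mono le) simp
    also have "\<dots> = emeasure \<nu> (ball x s) * (c * avg t f z)" by (simp add: mult_ac)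
    finally show "(\<integral>\<^sup>+y\<in>ball x s. f y \<partial>\<nu>) \<le> emeasure \<nu> (ball x s) * (c * avg t f z)" .
  qed
qed

lemma integrable_on_ball_if_bounded:
  fixes u :: "'a \<Rightarrow> ereal"
  assumes u: "u \<in> borel_measurable (restrict_space \<mu> (- E \<inter> ball x r))"
    and bd: "\<And>y. y \<in> - E \<inter> ball x r \<Longrightarrow> \<bar>u y\<bar> \<le> ereal k"
  shows "integrable_ereal_on \<mu> (- E \<inter> ball x r) u"
proof -
  have "(\<integral>\<^sup>+y\<in>- E \<inter> ball x r. e2ennreal \<bar>u y\<bar> \<partial>\<mu>) \<le> (\<integral>\<^sup>+y\<in>- E \<inter> ball x r. ennreal k \<partial>\<mu>)"
  proof (intro nn_integral_mono)
    fix y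
    show "e2ennreal \<bar>u y\<bar> * indicator (- E \<inter> ball x r) y \<le> ennreal k * indicator (- E \<inter> ball x r) y"
      using bd[of y] e2ennreal_mono[of "\<bar>u y\<bar>" "ereal k"] by (cases "y \<in> - E \<inter> ball x r") (auto simp: e2ennreal_ereal)
  qed
  also have "\<dots> = ennreal k * emeasure \<nu> (ball x r)"
    by (simp add: nn_integral_complement_Int nn_integral_cmult_indicator)
  also have "\<dots> < \<infinity>" by (simp add: ennreal_mult_less_top)
  finally show ?thesis using u by (simp add: integrable_ereal_on_def)
qed

text \<open>The Poincare inequality on the complement holds for functions integrable on the ball. Applied to
  truncations it gives integrability of \<open>u\<close> itself. As \<open>E\<close> is a null set, the balls of the
  complement have the same measure as those of the whole space, and its points are dense; so the
  inequality holds, with larger constants, on balls with arbitrary centres, where it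
  provides an extension with an upper gradient in \<open>L\<^sup>p\<close>.\<close>

theorem dirichlet_extension:
  assumes sp: "supports_poincare p \<mu> (- E)" and u: "u \<in> dirichlet p \<mu> (- E)"
  obtains v where "v \<in> dirichlet p \<mu> UNIV" "AE x in \<mu>. x \<in> - E \<longrightarrow> u x = v x"
proof -
  obtain C L where C: "0 < C" and L: "1 \<le> L" and PI0:
    "\<forall>x r u g. x \<in> - E \<longrightarrow> 0 < r \<longrightarrow> integrable_ereal_on \<mu> (- E \<inter> ball x (L * r)) u \<longrightarrow>
       upper_gradient (- E \<inter> ball x (L * r)) u g \<longrightarrow>
       (\<integral>\<^sup>+y\<in>- E \<inter> ball x r. osc (u y) (ereal (average \<mu> (- E \<inter> ball x r) u)) \<partial>\<mu>)
           / emeasure \<mu> (- E \<inter> ball x r)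
         \<le> ennreal (C * r) * epowr ((\<integral>\<^sup>+y\<in>- E \<inter> ball x (L * r). epowr (g y) p \<partial>\<mu>)
           / emeasure \<mu> (- E \<inter> ball x (L * r))) (1 / p)"
    by (rule supports_poincareD[OF sp]) (rule that)
  note PI = PI0[rule_format]
  have um: "u \<in> borel_measurable (restrict_space \<mu> (- E))"
    and ufin: "AE x in \<nu>. x \<in> - E \<longrightarrow> \<bar>u x\<bar> \<noteq> \<infinity>"
    using u by (auto simp: dirichlet_def AE_completion_iff)
  obtain g where ug: "upper_gradient (- E) u g" and gfin: "(\<integral>\<^sup>+x\<in>- E. epowr (g x) p \<partial>\<mu>) < \<infinity>"
    using u by (auto simp: dirichlet_def)
  have gm: "g \<in> borel_measurable (restrict_space \<mu> (- E))"
    using ug by (intro measurable_restrict_completion) (simp add: upper_gradient_def)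
  obtain U :: "'a \<Rightarrow> real" where U [measurable]: "U \<in> borel_measurable \<nu>" and uU: "AE x in \<nu>. x \<in> - E \<longrightarrow> u x = ereal (U x)"
    using borel_version_real[OF um complement_sets ufin] by blast
  obtain g' where g' [measurable]: "g' \<in> borel_measurable borel" and gg': "AE x in \<nu>. x \<in> - E \<longrightarrow> g x = g' x"
    using borel_version_ennreal[OF gm complement_sets] by blast
  have fin': "(\<integral>\<^sup>+x. epowr (g' x) p \<partial>\<nu>) < \<infinity>"
  proof -
    have "(\<integral>\<^sup>+x. epowr (g' x) p \<partial>\<nu>) = (\<integral>\<^sup>+x. epowr (g x) p * indicator (- E) x \<partial>\<nu>)"
      using gg' AE_complement by (intro nn_integral_cong_AE, eventually_elim) simp
    then show ?thesis using gfin by (simp add: nn_integral_completion)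
  qed
  define f where "f x = enn2real (epowr (g' x) p)" for x
  have [measurable]: "f \<in> borel_measurable \<nu>" unfolding f_def by measurable
  have "AE x in \<nu>. epowr (g' x) p \<noteq> \<infinity>" using fin' by (intro nn_integral_PInf_AE) auto
  then have fg': "AE x in \<nu>. ennreal (f x) = epowr (g' x) p"
    by eventually_elim (simp add: f_def less_top)
  have f_int: "integrable \<nu> f"
  proof (rule integrableI_bounded)
    have "(\<integral>\<^sup>+x. ennreal (norm (f x)) \<partial>\<nu>) = (\<integral>\<^sup>+x. epowr (g' x) p \<partial>\<nu>)"
      using fg' by (intro nn_integral_cong_AE, eventually_elim) (simp add: f_def)
    then show "(\<integral>\<^sup>+x. ennreal (norm (f x)) \<partial>\<nu>) < \<infinity>" using fin' by simp
  qed simp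
  have avg_f: "(\<integral>\<^sup>+y\<in>- E \<inter> ball x r. epowr (g y) p \<partial>\<mu>) / emeasure \<mu> (- E \<inter> ball x r)
      = avg r (\<lambda>y. ennreal (f y)) x" for x r
  proof -
    have "(\<integral>\<^sup>+y\<in>ball x r. epowr (g y) p \<partial>\<nu>) = (\<integral>\<^sup>+y\<in>ball x r. ennreal (f y) \<partial>\<nu>)"
      using gg' AE_complement fg' by (intro nn_integral_cong_AE, eventually_elim) simp
    then show ?thesis by (simp add: nn_integral_complement_Int emeasure_complement_ball avg_def)
  qed
  let ?f = "\<lambda>y. ennreal (f y)"
  have f_fin: "(\<integral>\<^sup>+x. ?f x \<partial>\<nu>) < \<infinity>" using f_int by (simp add: integrable_iff_bounded f_def)
  have ug_ball: "upper_gradient (- E \<inter> ball x r) u g" for x r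
    by (rule upper_gradient_subset[OF ug]) simp
  have um_ball: "u \<in> borel_measurable (restrict_space \<mu> (- E \<inter> ball x r))" for x r
    by (rule measurable_restrict_mono[OF um]) simp
  have PI': "\<exists>c. (\<integral>\<^sup>+y\<in>ball x r. osc (w y) (ereal c) \<partial>\<nu>) \<le> ennreal (C * r) * epowr (avg (L * r) ?f x) (1 / p) * emeasure \<nu> (ball x r)"
    if x: "x \<in> - E" and r: "0 < r" and w: "integrable_ereal_on \<mu> (- E \<inter> ball x (L * r)) w"
      "upper_gradient (- E \<inter> ball x (L * r)) w g" for x r w
  proof -
    let ?c = "average \<mu> (- E \<inter> ball x r) w"
    have "(\<integral>\<^sup>+y\<in>ball x r. osc (w y) (ereal ?c) \<partial>\<nu>) / emeasure \<nu> (ball x r) \<le> ennreal (C * r) * epowr (avg (L * r) ?f x) (1 / p)"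
      using PI[OF x r w] unfolding avg_f unfolding nn_integral_complement_Int emeasure_complement_ball .
    then have "(\<integral>\<^sup>+y\<in>ball x r. osc (w y) (ereal ?c) \<partial>\<nu>) / emeasure \<nu> (ball x r) * emeasure \<nu> (ball x r)
        \<le> ennreal (C * r) * epowr (avg (L * r) ?f x) (1 / p) * emeasure \<nu> (ball x r)"
      by (rule mult_right_mono) simp
    then show ?thesis using r by auto
  qed
  have int_u: "integrable_ereal_on \<mu> (- E \<inter> ball x r) u" if x: "x \<in> - E" and r: "0 < r" for x r
  proof -
    have "(\<integral>\<^sup>+y\<in>ball x r. ennreal \<bar>U y\<bar> \<partial>\<nu>) < \<infinity>"
    proof (rule nn_integral_finite_if_truncations_oscillate_boundedly)
      show "0 < emeasure \<nu> (ball x r)" "emeasure \<nu> (ball x r) < \<infinity>" using ball_pos[OF r] ball_fin[OF r] by auto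
      show "ennreal (C * r) * epowr (avg (L * r) ?f x) (1 / p) * emeasure \<nu> (ball x r) < \<infinity>"
        using avg_lt_top[OF f_fin, of "L * r" x] r L by (simp add: ennreal_mult_less_top epowr_lt_top)
      fix k :: nat
      have "integrable_ereal_on \<mu> (- E \<inter> ball x (L * r)) (\<lambda>y. trunc k (u y))"
        by (rule integrable_on_ball_if_bounded[OF measurable_compose[OF um_ball measurable_trunc] abs_trunc_le])
      from PI'[OF x r this upper_gradient_trunc[OF ug_ball]]
      obtain c where c: "(\<integral>\<^sup>+y\<in>ball x r. osc (trunc k (u y)) (ereal c) \<partial>\<nu>)
          \<le> ennreal (C * r) * epowr (avg (L * r) ?f x) (1 / p) * emeasure \<nu> (ball x r)" by blast
      have "(\<integral>\<^sup>+y\<in>ball x r. ennreal \<bar>max (- real k) (min (real k) (U y)) - c\<bar> \<partial>\<nu>)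
          = (\<integral>\<^sup>+y\<in>ball x r. osc (trunc k (u y)) (ereal c) \<partial>\<nu>)"
        using uU AE_complement
        by (intro nn_integral_cong_AE, eventually_elim) (simp only: trunc_ereal osc_ereal)
      then show "\<exists>c. (\<integral>\<^sup>+y\<in>ball x r. ennreal \<bar>max (- real k) (min (real k) (U y)) - c\<bar> \<partial>\<nu>)
          \<le> ennreal (C * r) * epowr (avg (L * r) ?f x) (1 / p) * emeasure \<nu> (ball x r)"
        using c by (intro exI[of _ c]) simp
    qed measurable
    moreover have "(\<integral>\<^sup>+y\<in>ball x r. e2ennreal \<bar>u y\<bar> \<partial>\<nu>) = (\<integral>\<^sup>+y\<in>ball x r. ennreal \<bar>U y\<bar> \<partial>\<nu>)"
      using uU AE_complement by (intro nn_integral_cong_AE, eventually_elim) (simp add: e2ennreal_ereal)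
    ultimately show ?thesis
      using um_ball by (simp add: integrable_ereal_on_def nn_integral_complement_Int)
  qed
  define C' where "C' = C * 2 * D^2 * (D^2) powr (1 / p)"
  have pair: "\<exists>c. (\<integral>\<^sup>+y\<in>ball z r. ennreal \<bar>U y - c\<bar> \<partial>\<nu>)
        \<le> ennreal (C' * r) * emeasure \<nu> (ball z r) * epowr (avg (4 * L * r) ?f z) (1 / p)" if r: "0 < r" for z r
  proof -
    (* ball z r lies in ball x (2 * r), and ball x (2 * L * r) in ball z (4 * L * r) *)
    obtain x where x: "x \<in> - E" "dist z x < r" using complement_dense[OF r] by blast
    have r2: "0 < 2 * r" using r by simp
    obtain c where c: "(\<integral>\<^sup>+y\<in>ball x (2 * r). osc (u y) (ereal c) \<partial>\<nu>)
        \<le> ennreal (C * (2 * r)) * epowr (avg (L * (2 * r)) ?f x) (1 / p) * emeasure \<nu> (ball x (2 * r))"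
      using PI'[OF x(1) r2 int_u[OF x(1)] ug_ball] r L by auto
    have "emeasure \<nu> (ball x (2 * r)) \<le> ennreal D * emeasure \<nu> (ball x r)" by (rule doubling[OF r])
    also have "\<dots> \<le> ennreal D * (ennreal D * emeasure \<nu> (ball z r))"
      by (intro mult_left_mono ball_compare x) auto
    finally have m: "emeasure \<nu> (ball x (2 * r)) \<le> ennreal (D^2) * emeasure \<nu> (ball z r)"
      using D_pos by (simp add: ennreal_mult power2_eq_square mult.assoc)
    have Lr: "r \<le> L * r" using L r by simp
    have "emeasure \<nu> (ball z (4 * L * r)) \<le> ennreal D * emeasure \<nu> (ball x (4 * L * r))"
    proof (rule ball_compare)
      have "dist x z < 4 * (L * r)" using x(2) Lr r dist_commute[of x z] by linarith
      then show "dist x z < 4 * L * r" by simp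
    qed
    also have "\<dots> \<le> ennreal D * (ennreal D * emeasure \<nu> (ball x (L * (2 * r))))"
      using doubling[of "L * (2 * r)" x] L r by (intro mult_left_mono) (auto simp: mult_ac)
    finally have m2: "emeasure \<nu> (ball z (4 * L * r)) \<le> ennreal (D^2) * emeasure \<nu> (ball x (L * (2 * r)))"
      using D_pos by (simp add: ennreal_mult power2_eq_square mult.assoc)
    have "avg (L * (2 * r)) ?f x \<le> ennreal (D^2) * avg (4 * L * r) ?f z"
    proof (rule avg_le_avg[OF _ _ m2])
      show "ball x (L * (2 * r)) \<subseteq> ball z (4 * L * r)"
      proof
        fix y assume "y \<in> ball x (L * (2 * r))"
        then have "dist z y < r + 2 * (L * r)"
          using dist_triangle[of z y x] x by simp
        then have "dist z y < 4 * (L * r)" using Lr r by linarith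
        then show "y \<in> ball z (4 * L * r)" by simp
      qed
    qed (use L r in simp)
    then have "epowr (avg (L * (2 * r)) ?f x) (1 / p) \<le> epowr (ennreal (D^2) * avg (4 * L * r) ?f z) (1 / p)"
      using p0 by (intro epowr_mono) auto
    also have "\<dots> = ennreal ((D^2) powr (1 / p)) * epowr (avg (4 * L * r) ?f z) (1 / p)"
      using p0 by (simp add: epowr_mult epowr_ennreal)
    finally have e: "epowr (avg (L * (2 * r)) ?f x) (1 / p) \<le> ennreal ((D^2) powr (1 / p)) * epowr (avg (4 * L * r) ?f z) (1 / p)" .
    have "(\<integral>\<^sup>+y\<in>ball z r. ennreal \<bar>U y - c\<bar> \<partial>\<nu>) \<le> (\<integral>\<^sup>+y\<in>ball x (2 * r). ennreal \<bar>U y - c\<bar> \<partial>\<nu>)"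
    proof (intro nn_integral_mono mult_left_mono)
      fix y
      have "y \<in> ball z r \<Longrightarrow> y \<in> ball x (2 * r)"
        using dist_triangle[of x y z] x by (simp add: dist_commute)
      then show "indicator (ball z r) y \<le> (indicator (ball x (2 * r)) y :: ennreal)"
        by (auto simp: indicator_def)
    qed simp
    also have "\<dots> = (\<integral>\<^sup>+y\<in>ball x (2 * r). osc (u y) (ereal c) \<partial>\<nu>)"
      using uU AE_complement by (intro nn_integral_cong_AE, eventually_elim) simp
    also note c
    also have "ennreal (C * (2 * r)) * epowr (avg (L * (2 * r)) ?f x) (1 / p) * emeasure \<nu> (ball x (2 * r))
        \<le> ennreal (C * (2 * r)) * (ennreal ((D^2) powr (1 / p)) * epowr (avg (4 * L * r) ?f z) (1 / p)) * (ennreal (D^2) * emeasure \<nu> (ball z r))"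
      by (intro mult_mono e m) auto
    also have "\<dots> = (ennreal (C * (2 * r)) * ennreal ((D^2) powr (1 / p)) * ennreal (D^2)) * emeasure \<nu> (ball z r) * epowr (avg (4 * L * r) ?f z) (1 / p)"
      by (simp only: mult_ac)
    also have "ennreal (C * (2 * r)) * ennreal ((D^2) powr (1 / p)) * ennreal (D^2) = ennreal (C' * r)"
      using C r by (simp add: C'_def ennreal_mult[symmetric] mult_ac)
    finally show ?thesis by blast
  qed
  have "0 \<le> C'" "1 \<le> 4 * L" "0 \<le> f x" for x using C L by (auto simp: C'_def f_def)
  then obtain v G where v: "v \<in> borel_measurable \<nu>" "AE x in \<nu>. v x = ereal (U x)" "upper_gradient UNIV v G"
      "(\<integral>\<^sup>+x. epowr (G x) p \<partial>\<nu>) < \<infinity>"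
    using upper_gradient_of_poincare_pair[OF U f_int _ p _ _ pair] by blast
  have "AE x in \<nu>. x \<in> - E \<longrightarrow> u x = v x" using uU v(2) by eventually_elim auto
  moreover have "AE x in \<nu>. \<bar>v x\<bar> \<noteq> \<infinity>" using v(2) by eventually_elim auto
  ultimately show ?thesis
    using v by (intro that[of v])
      (auto simp: dirichlet_def AE_completion_iff nn_integral_completion measurable_completion)
qed

end

section \<open>From extension to a Poincare inequality\<close>

lemma measurable_if_on_restriction:
  assumes h: "h \<in> measurable (restrict_space M (A \<inter> B)) N" and B: "B \<in> sets M" and c: "c \<in> space N"
  shows "(\<lambda>x. if x \<in> B then h x else c) \<in> measurable (restrict_space M A) N"
proof (rule measurable_If_restrict_space_iff[THEN iffD2], goal_cases)
  case 1
  have "A \<inter> B \<in> sets (restrict_space M A)" using B by (auto simp: sets_restrict_space)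
  moreover have "{x \<in> space (restrict_space M A). x \<in> B} = A \<inter> B"
    using sets.sets_into_space[OF B] by (auto simp: space_restrict_space)
  ultimately show ?case by simp
next
  case 2
  have "(\<lambda>x. x) \<in> measurable (restrict_space (restrict_space M A) {x. x \<in> B}) (restrict_space M (A \<inter> B))"
    by (intro measurable_restrict_space2 measurable_restrict_space1 measurable_ident)
      (auto simp: space_restrict_space)
  from measurable_compose[OF this h] c show ?case by simp
qed

context null_complement
begin

text \<open>The upper gradient \<open>h\<close> of the extension \<open>v\<close> may be much larger than the upper gradient \<open>g\<close> of the
  original function \<open>u\<close>, but it makes \<open>v\<close> absolutely continuous on all curves with finite line
  integral of \<open>h\<close>. By path almost openness, such a curve runs through the complement of \<open>E\<close> during a
  relatively open set of parameters of full measure, up to a negligible family of curves. On an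
  interval inside that set \<open>u\<close>, and hence \<open>v\<close>, is controlled by \<open>g\<close>. So \<open>g\<close> controls \<open>v\<close> on the whole
  curve. The function \<open>\<rho>\<close> singles out the exceptional curves.\<close>

lemma restriction_gradient_is_weak_gradient:
  fixes u v :: "'a \<Rightarrow> ereal"
  assumes pao: "path_almost_open p \<mu> (- E)"
    and h: "upper_gradient UNIV v h" "(\<integral>\<^sup>+x. epowr (h x) p \<partial>\<nu>) < \<infinity>"
    and g: "upper_gradient (- E \<inter> ball x0 R) u g"
    and eq: "AE x in \<nu>. x \<in> - E \<inter> ball x0 R \<longrightarrow> u x = v x"
  obtains g' \<rho> where "g' \<in> borel_measurable borel" "\<rho> \<in> borel_measurable borel"
    "AE x in \<nu>. x \<in> - E \<inter> ball x0 R \<longrightarrow> g x = g' x" "(\<integral>\<^sup>+x. epowr (\<rho> x) p \<partial>\<nu>) < \<infinity>"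
    "\<And>\<gamma> l. (\<gamma>, l) \<in> curves (ball x0 R) \<Longrightarrow> line_integral \<rho> \<gamma> l < \<infinity> \<Longrightarrow> osc (v (\<gamma> 0)) (v (\<gamma> l)) \<le> line_integral g' \<gamma> l"
proof -
  let ?A = "- E \<inter> ball x0 R"
  have gm: "g \<in> borel_measurable (restrict_space borel ?A)" using g by (simp add: upper_gradient_def)
  obtain g' where g' [measurable]: "g' \<in> borel_measurable borel" and gg': "AE x in \<nu>. x \<in> ?A \<longrightarrow> g x = g' x"
    using borel_version_ennreal[OF measurable_restrict_completion[OF gm] complement_ball_sets] by blast
  have hm [measurable]: "h \<in> borel_measurable borel" using h(1) by (simp add: upper_gradient_def)
  define \<Gamma> where "\<Gamma> = {(\<gamma>, l) \<in> curves UNIV. \<not> (\<exists>U N. openin (top_of_set {0..l}) U \<and> N \<in> null_sets lebesgue \<and>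
               {t\<in>{0..l}. \<gamma> t \<in> - E} = U \<union> N)}"
  have mod: "modulus p \<mu> UNIV \<Gamma> = 0" using pao unfolding path_almost_open_def \<Gamma>_def .
  have Gsub: "\<Gamma> \<subseteq> curves UNIV" unfolding \<Gamma>_def by auto
  have bm: "f \<in> borel_measurable \<mu>" if "f \<in> borel_measurable borel" for f :: "'a \<Rightarrow> ennreal"
    by (rule measurable_completion) (use that in simp)
  obtain \<rho>1 where r1 [measurable]: "\<rho>1 \<in> borel_measurable borel" and r1f: "(\<integral>\<^sup>+x. epowr (\<rho>1 x) p \<partial>\<mu>) < \<infinity>"
    and r1i: "\<And>\<gamma> l. (\<gamma>, l) \<in> \<Gamma> \<Longrightarrow> line_integral \<rho>1 \<gamma> l = \<infinity>"
    using modulus_zero_majorant[OF mod p0 bm Gsub] by blast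
  have "AE x in \<nu>. x \<in> - E \<and> (x \<in> ?A \<longrightarrow> u x = v x \<and> g x = g' x)"
    using AE_complement eq gg' by eventually_elim auto
  then obtain F where F0: "{x \<in> space \<nu>. \<not> (x \<in> - E \<and> (x \<in> ?A \<longrightarrow> u x = v x \<and> g x = g' x))} \<subseteq> F"
      "emeasure \<nu> F = 0" "F \<in> sets \<nu>"
    by (rule AE_E)
  have F: "x \<notin> F \<Longrightarrow> x \<in> - E \<and> (x \<in> ?A \<longrightarrow> u x = v x \<and> g x = g' x)" for x
    using F0(1) by auto
  have Fn: "F \<in> null_sets \<nu>" using F0 by auto
  have [measurable]: "F \<in> sets borel" using F0 by simp
  define \<rho> where "\<rho> x = max (h x) (max (\<rho>1 x) (\<infinity> * indicator F x))" for x
  have \<rho>m [measurable]: "\<rho> \<in> borel_measurable borel" unfolding \<rho>_def by measurable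
  have \<rho>fin: "(\<integral>\<^sup>+x. epowr (\<rho> x) p \<partial>\<nu>) < \<infinity>"
    unfolding \<rho>_def using h(2) r1f p0 nn_integral_epowr_infinity_null_set[OF Fn, of p]
    by (intro nn_integral_epowr_max_finite) (auto simp: nn_integral_completion)
  have "osc (v (\<gamma> 0)) (v (\<gamma> l)) \<le> line_integral g' \<gamma> l"
    if c: "(\<gamma>, l) \<in> curves (ball x0 R)" and fin: "line_integral \<rho> \<gamma> l < \<infinity>" for \<gamma> l
  proof -
    have cU: "(\<gamma>, l) \<in> curves UNIV" using c curves_mono[of "ball x0 R" UNIV] by auto
    have l: "0 < l" and cont: "continuous_on {0..l} \<gamma>" and im: "\<gamma> ` {0..l} \<subseteq> ball x0 R"
      using c by (auto simp: curves_def)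
    note meas = measurable_borel_along_curve[OF c]
    have le\<rho>: "line_integral k \<gamma> l < \<infinity>" if "\<And>x. k x \<le> \<rho> x" for k
      using line_integral_mono[of k \<rho>, OF that] fin by (rule le_less_trans)
    have hfin: "line_integral h \<gamma> l < \<infinity>" by (rule le\<rho>) (simp add: \<rho>_def)
    have "line_integral \<rho>1 \<gamma> l < \<infinity>" by (rule le\<rho>) (simp add: \<rho>_def le_max_iff_disj)
    then have "(\<gamma>, l) \<notin> \<Gamma>" using r1i by force
    then obtain U N where U: "openin (top_of_set {0..l}) U" and N: "N \<in> null_sets lebesgue"
      and UN: "{t\<in>{0..l}. \<gamma> t \<in> - E} = U \<union> N" using cU unfolding \<Gamma>_def by blast
    have "line_integral (\<lambda>x. \<infinity> * indicator F x) \<gamma> l < \<infinity>" by (rule le\<rho>) (simp add: \<rho>_def le_max_iff_disj)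
    then have "AE t in lborel. \<infinity> * indicator F (\<gamma> t) * indicator {0..l} t \<noteq> (\<infinity> :: ennreal)"
      using meas[of "\<lambda>x. \<infinity> * indicator F x"] unfolding line_integral_def
      by (intro nn_integral_PInf_AE) (auto simp: less_top[symmetric])
    then have aeF: "AE t in lborel. t \<in> {0..l} \<longrightarrow> \<gamma> t \<notin> F"
      by eventually_elim (auto simp: indicator_def)
    have aeN: "AE t in lborel. t \<notin> N" using AE_not_in[OF N] by (simp add: AE_completion_iff)
    have "AE t in lborel. t \<notin> {0..l} - U"
      using aeF aeN
    proof eventually_elim
      case (elim t)
      then show ?case using F[of "\<gamma> t"] UN by auto
    qed
    moreover have "{0..l} - U \<in> sets borel"
    proof -
      have "closedin (top_of_set {0..l}) ({0..l} - U)" using U by (simp add: openin_closedin_eq)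
      then have "closed ({0..l} - U)" by (rule closedin_closed_trans) simp
      then show ?thesis by (rule borel_closed)
    qed
    ultimately have null: "emeasure lborel ({0..l} - U) = 0"
      by (subst (asm) AE_iff_measurable[of "{0..l} - U"]) auto
    let ?h = "\<lambda>t. h (\<gamma> t) * indicator {0..l} t" and ?g = "\<lambda>t. g' (\<gamma> t) * indicator {0..l} t"
    have hb: "osc (v (\<gamma> a)) (v (\<gamma> b)) \<le> (\<integral>\<^sup>+r\<in>{a..b}. ?h r \<partial>lborel)" if "0 \<le> a" "a < b" "b \<le> l" for a b
    proof -
      have "osc (v (\<gamma> a)) (v (\<gamma> b)) \<le> (\<integral>\<^sup>+r\<in>{a..b}. h (\<gamma> r) \<partial>lborel)"
        using upper_gradient_segment[OF h(1) cU that] by simp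
      also have "\<dots> = (\<integral>\<^sup>+r\<in>{a..b}. ?h r \<partial>lborel)"
        using that by (intro nn_integral_cong) (auto simp: indicator_def)
      finally show ?thesis .
    qed
    have "osc (v (\<gamma> 0)) (v (\<gamma> l)) \<le> (\<integral>\<^sup>+t\<in>{0..l}. ?g t \<partial>lborel)"
    proof (rule osc_le_integral_if_le_on_open[OF meas meas _ l hb U null])
      show "(\<integral>\<^sup>+t\<in>{0..l}. ?h t \<partial>lborel) < \<infinity>"
        using hfin unfolding line_integral_indicator .
      fix a b assume ab: "a < b" "{a..b} \<subseteq> U"
      have "U \<subseteq> {0..l}" using U by (rule openin_imp_subset)
      then have sub: "{a..b} \<subseteq> {0..l}" using ab(2) by (rule order_trans[rotated])
      then have ab': "0 \<le> a" "b \<le> l" using ab(1) by auto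
      have imA: "\<gamma> t \<in> ?A" if t: "t \<in> {a..b}" for t
      proof -
        have "t \<in> {t\<in>{0..l}. \<gamma> t \<in> - E}" using UN ab(2) t by blast
        moreover have "\<gamma> t \<in> ball x0 R" using subsetD[OF im imageI[OF subsetD[OF sub t]]] .
        ultimately show ?thesis by simp
      qed
      show "osc (v (\<gamma> a)) (v (\<gamma> b)) \<le> (\<integral>\<^sup>+r\<in>{a..b}. ?g r \<partial>lborel)"
      proof (rule osc_le_integral_if_AE_eq[OF meas meas _ ab(1), where \<psi> = "\<lambda>t. u (\<gamma> t)"])
        have "(\<integral>\<^sup>+t\<in>{a..b}. ?h t \<partial>lborel) \<le> line_integral h \<gamma> l"
          unfolding line_integral_def by (intro nn_integral_mono) (auto simp: indicator_def)
        then show "(\<integral>\<^sup>+t\<in>{a..b}. ?h t \<partial>lborel) < \<infinity>" using hfin by simp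
        show "AE t in lborel. t \<in> {a..b} \<longrightarrow> v (\<gamma> t) = u (\<gamma> t)"
          using aeF
        proof eventually_elim
          case (elim t)
          show ?case
          proof
            assume t: "t \<in> {a..b}"
            then have "\<gamma> t \<notin> F" using elim subsetD[OF sub t] by simp
            then show "v (\<gamma> t) = u (\<gamma> t)" using F[of "\<gamma> t"] imA[OF t] by simp
          qed
        qed
      next
        fix s t assume st: "a \<le> s" "s < t" "t \<le> b"
        show "osc (v (\<gamma> s)) (v (\<gamma> t)) \<le> (\<integral>\<^sup>+r\<in>{s..t}. ?h r \<partial>lborel)"
          using st ab' by (intro hb) auto
        have "\<gamma> ` {s..t} \<subseteq> ?A" using imA st by (intro image_subsetI) auto
        then have "osc (u (\<gamma> s)) (u (\<gamma> t)) \<le> (\<integral>\<^sup>+r\<in>{s..t}. g (\<gamma> r) \<partial>lborel)"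
          using upper_gradient_segment[OF g cU, of s t] st ab' by simp
        also have "\<dots> = (\<integral>\<^sup>+r\<in>{s..t}. ?g r \<partial>lborel)"
        proof (rule nn_integral_cong_AE)
          show "AE r in lborel. g (\<gamma> r) * indicator {s..t} r = ?g r * indicator {s..t} r"
            using aeF
          proof eventually_elim
            case (elim r)
            show ?case
            proof (cases "r \<in> {s..t}")
              case True
              then have r: "r \<in> {a..b}" using st by auto
              then have "\<gamma> r \<notin> F" using elim subsetD[OF sub r] by simp
              then show ?thesis using F[of "\<gamma> r"] imA[OF r] subsetD[OF sub r] True by simp
            qed simp
          qed
        qed
        finally show "osc (u (\<gamma> s)) (u (\<gamma> t)) \<le> (\<integral>\<^sup>+r\<in>{s..t}. ?g r \<partial>lborel)" .
      qed (use g' hm in auto)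
    qed (use g' hm in auto)
    also have "\<dots> = line_integral g' \<gamma> l" by (rule line_integral_indicator[symmetric])
    finally show ?thesis .
  qed
  with g' \<rho>m gg' \<rho>fin show ?thesis by (rule that)
qed

text \<open>The cutoff \<open>\<eta>\<close> is 1 up to radius \<open>R\<close> and vanishes beyond \<open>3 / 2 * R\<close>. This leaves room to cover the
  space by the ball of radius \<open>2 * R\<close>, where the product rule applies, and the exterior of the closed
  ball of radius \<open>3 / 2 * R\<close>, where the product is zero; being an upper gradient is
  local.\<close>

lemma cutoff_newtonian:
  fixes u :: "'a \<Rightarrow> ereal" and R k :: real
  assumes R: "0 < R" and g: "upper_gradient (- E \<inter> ball x0 (2 * R)) u g"
    and gfin: "(\<integral>\<^sup>+y\<in>- E \<inter> ball x0 (2 * R). epowr (g y) p \<partial>\<mu>) < \<infinity>"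
    and um: "u \<in> borel_measurable (restrict_space \<mu> (- E \<inter> ball x0 (2 * R)))"
    and k: "0 \<le> k" "\<And>y. y \<in> - E \<inter> ball x0 (2 * R) \<Longrightarrow> \<bar>u y\<bar> \<le> ereal k"
  obtains u' where "u' \<in> newtonian p \<mu> (- E)" "\<And>y. y \<in> - E \<inter> ball x0 R \<Longrightarrow> u' y = u y"
proof -
  let ?B = "ball x0 (2 * R)"
  define \<eta> where "\<eta> y = min 1 (max 0 (3 - 2 * dist x0 y / R))" for y
  have \<eta>01: "0 \<le> \<eta> y" "\<eta> y \<le> 1" for y by (auto simp: \<eta>_def)
  have \<eta>lip: "\<bar>\<eta> y - \<eta> z\<bar> \<le> 2 / R * dist y z" for y z
  proof -
    have "\<bar>\<eta> y - \<eta> z\<bar> \<le> \<bar>2 * dist x0 y / R - 2 * dist x0 z / R\<bar>" unfolding \<eta>_def by linarith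
    also have "2 * dist x0 y / R - 2 * dist x0 z / R = 2 / R * (dist x0 y - dist x0 z)"
      by (simp add: diff_divide_distrib right_diff_distrib)
    also have "\<bar>2 / R * (dist x0 y - dist x0 z)\<bar> = 2 / R * \<bar>dist x0 y - dist x0 z\<bar>"
      using R by (simp only: abs_mult) simp
    also have "\<dots> \<le> 2 / R * dist y z"
      using R dist_triangle[of x0 y z] dist_triangle[of x0 z y]
      by (intro mult_left_mono) (auto simp: dist_commute abs_le_iff)
    finally show ?thesis .
  qed
  define Ur where "Ur y = real_of_ereal (u y)" for y
  have uU: "u y = ereal (Ur y)" "\<bar>Ur y\<bar> \<le> k" if "y \<in> - E \<inter> ?B" for y
    using k(2)[OF that] by (cases "u y"; simp add: Ur_def)+
  define w where "w y = (if y \<in> ?B then ereal (\<eta> y * Ur y) else 0)" for y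
  define u' where "u' = restrict w (- E)"
  have u'E: "y \<in> - E \<Longrightarrow> u' y = w y" for y by (simp add: u'_def)
  define G where "G y = (if y \<in> ?B then g y + ennreal (k * (2 / R)) else 0)" for y
  have gm: "g \<in> borel_measurable (restrict_space borel (- E \<inter> ?B))" using g by (simp add: upper_gradient_def)
  have Gm: "G \<in> borel_measurable (restrict_space borel (- E))"
    unfolding G_def by (rule measurable_if_on_restriction) (use gm in auto)
  have u'm: "u' \<in> borel_measurable (restrict_space \<mu> (- E))"
  proof -
    have "\<eta> \<in> borel_measurable borel" unfolding \<eta>_def by measurable
    then have "\<eta> \<in> borel_measurable \<nu>" by simp
    then have [measurable]: "\<eta> \<in> borel_measurable (restrict_space \<mu> (- E \<inter> ?B))"
      by (intro measurable_restrict_space1 measurable_completion)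
    have [measurable]: "Ur \<in> borel_measurable (restrict_space \<mu> (- E \<inter> ?B))"
      unfolding Ur_def using um by measurable
    have "w \<in> borel_measurable (restrict_space \<mu> (- E))"
      unfolding w_def by (rule measurable_if_on_restriction) (auto simp: sets_completionI_sets)
    moreover have "u' \<in> borel_measurable (restrict_space \<mu> (- E))
        \<longleftrightarrow> w \<in> borel_measurable (restrict_space \<mu> (- E))"
      by (rule measurable_cong) (auto simp: u'E space_restrict_space)
    ultimately show ?thesis by simp
  qed
  have ug: "upper_gradient (- E) u' G"
  proof (rule upper_gradient_Un_open[OF Gm, where ?U1.0 = ?B and ?U2.0 = "- cball x0 (3 / 2 * R)"])
    show "- E \<subseteq> ?B \<union> - cball x0 (3 / 2 * R)" using R by auto
    show "upper_gradient (- E \<inter> ?B) u' G"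
      unfolding upper_gradient_osc
    proof (intro conjI ballI, rule measurable_restrict_mono[OF Gm], simp, clarify)
      fix \<gamma> l assume c: "(\<gamma>, l) \<in> curves (- E \<inter> ?B)"
      have "\<gamma> ` {0..l} \<subseteq> - E \<inter> ?B" using c by (simp add: curves_def)
      then have im: "\<gamma> t \<in> - E \<inter> ?B" if "t \<in> {0..l}" for t using imageI[OF that] by (rule subsetD)
      have l: "0 < l" and cont: "continuous_on {0..l} \<gamma>" using c by (auto simp: curves_def)
      have e: "\<gamma> 0 \<in> - E \<inter> ?B" "\<gamma> l \<in> - E \<inter> ?B" using im l by auto
      let ?a = "\<gamma> 0" and ?b = "\<gamma> l"
      have u'v: "u' ?a = ereal (\<eta> ?a * Ur ?a)" "u' ?b = ereal (\<eta> ?b * Ur ?b)"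
        using e by (auto simp: u'E w_def)
      have "\<bar>\<eta> ?a * Ur ?a - \<eta> ?b * Ur ?b\<bar> \<le> \<bar>Ur ?a - Ur ?b\<bar> + k * (2 / R) * l"
      proof -
        have "\<eta> ?a * Ur ?a - \<eta> ?b * Ur ?b = \<eta> ?a * (Ur ?a - Ur ?b) + Ur ?b * (\<eta> ?a - \<eta> ?b)"
          by (simp add: algebra_simps)
        then have "\<bar>\<eta> ?a * Ur ?a - \<eta> ?b * Ur ?b\<bar> \<le> \<eta> ?a * \<bar>Ur ?a - Ur ?b\<bar> + \<bar>Ur ?b\<bar> * \<bar>\<eta> ?a - \<eta> ?b\<bar>"
          using abs_triangle_ineq[of "\<eta> ?a * (Ur ?a - Ur ?b)" "Ur ?b * (\<eta> ?a - \<eta> ?b)"] \<eta>01(1)[of ?a]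
          by (simp add: abs_mult)
        also have "\<dots> \<le> 1 * \<bar>Ur ?a - Ur ?b\<bar> + k * (2 / R * l)"
        proof (intro add_mono mult_mono)
          have "dist ?a ?b \<le> l" using curve_dist_le[OF c, of 0 l] l by simp
          then have "2 / R * dist ?a ?b \<le> 2 / R * l" using R by (intro mult_left_mono) auto
          then show "\<bar>\<eta> ?a - \<eta> ?b\<bar> \<le> 2 / R * l" using \<eta>lip[of ?a ?b] by linarith
        qed (use \<eta>01 uU(2)[OF e(2)] k in auto)
        finally show ?thesis by (simp add: mult.assoc)
      qed
      then have "osc (u' ?a) (u' ?b) \<le> ennreal (\<bar>Ur ?a - Ur ?b\<bar> + k * (2 / R) * l)"
        unfolding u'v osc_ereal by (rule ennreal_leI)
      also have "\<dots> = osc (u ?a) (u ?b) + ennreal (k * (2 / R)) * ennreal l"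
        unfolding uU(1)[OF e(1)] uU(1)[OF e(2)] osc_ereal using k R l by (simp add: ennreal_mult[symmetric] ennreal_plus)
      also have "\<dots> \<le> line_integral g \<gamma> l + ennreal (k * (2 / R)) * ennreal l"
        using g c unfolding upper_gradient_osc by (intro add_right_mono) blast
      also have "\<dots> = (\<integral>\<^sup>+t. g (\<gamma> t) * indicator {0..l} t + ennreal (k * (2 / R)) * indicator {0..l} t \<partial>lborel)"
      proof -
        have "(\<lambda>t. g (\<gamma> t) * indicator {0..l} t) \<in> borel_measurable borel"
          by (rule measurable_along_curve[where Z = "- E \<inter> ?B"]) (use g cont im in \<open>auto simp: upper_gradient_def\<close>)
        then show ?thesis
          using l by (subst nn_integral_add) (auto simp: line_integral_def nn_integral_cmult_indicator)
      qed
      also have "\<dots> = line_integral G \<gamma> l"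
        unfolding line_integral_def using im by (intro nn_integral_cong) (auto simp: G_def indicator_def)
      finally show "osc (u' ?a) (u' ?b) \<le> line_integral G \<gamma> l" .
    qed
    show "upper_gradient (- E \<inter> - cball x0 (3 / 2 * R)) u' G"
      unfolding upper_gradient_osc
    proof (intro conjI ballI, rule measurable_restrict_mono[OF Gm], simp, clarify)
      fix \<gamma> l assume c: "(\<gamma>, l) \<in> curves (- E \<inter> - cball x0 (3 / 2 * R))"
      have z: "u' y = ereal 0" if "y \<in> - E \<inter> - cball x0 (3 / 2 * R)" for y
      proof -
        have "3 \<le> 2 * dist x0 y / R" using that R by (auto simp: field_simps)
        then have "\<eta> y = 0" by (simp add: \<eta>_def)
        then show ?thesis using that by (simp add: u'E w_def)
      qed
      have "\<gamma> ` {0..l} \<subseteq> - E \<inter> - cball x0 (3 / 2 * R)" "0 < l" using c by (simp_all add: curves_def)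
      moreover have "0 \<in> {0..l}" "l \<in> {0..l}" using \<open>0 < l\<close> by auto
      ultimately have "\<gamma> 0 \<in> - E \<inter> - cball x0 (3 / 2 * R)" "\<gamma> l \<in> - E \<inter> - cball x0 (3 / 2 * R)"
        by (meson imageI subsetD)+
      then show "osc (u' (\<gamma> 0)) (u' (\<gamma> l)) \<le> line_integral G \<gamma> l"
        using z by (simp only: osc_ereal) simp
    qed
  qed (auto intro: open_Compl)
  have mB: "emeasure \<mu> (- E \<inter> ?B) < \<infinity>" by (simp add: emeasure_complement_ball)
  have Gfin: "(\<integral>\<^sup>+x\<in>- E. epowr (G x) p \<partial>\<mu>) < \<infinity>"
  proof -
    let ?g = "\<lambda>y. epowr (g y) p * indicator (- E \<inter> ?B) y"
    let ?c = "epowr (ennreal (k * (2 / R))) p"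
    have "(\<lambda>y. epowr (g y) p) \<in> borel_measurable (restrict_space \<mu> (- E \<inter> ?B))"
      using measurable_restrict_completion[OF gm] by (rule measurable_compose[OF _ measurable_epowr])
    then have [measurable]: "?g \<in> borel_measurable \<mu>"
      by (subst (asm) borel_measurable_restrict_space_iff_ennreal) auto
    have [measurable]: "- E \<inter> ?B \<in> sets \<mu>" by simp
    have "(\<integral>\<^sup>+x\<in>- E. epowr (G x) p \<partial>\<mu>)
        \<le> (\<integral>\<^sup>+x. epowr 2 p * (?g x + ?c * indicator (- E \<inter> ?B) x) \<partial>\<mu>)"
    proof (intro nn_integral_mono)
      fix x
      show "epowr (G x) p * indicator (- E) x \<le> epowr 2 p * (?g x + ?c * indicator (- E \<inter> ?B) x)"
      proof (cases "x \<in> - E \<inter> ?B")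
        case True
        have "g x + ennreal (k * (2 / R)) \<le> 2 * max (g x) (ennreal (k * (2 / R)))"
          by (simp add: mult_2 add_mono)
        then have "epowr (g x + ennreal (k * (2 / R))) p \<le> epowr (2 * max (g x) (ennreal (k * (2 / R)))) p"
          by (rule epowr_mono[OF p0])
        also have "\<dots> = epowr 2 p * epowr (max (g x) (ennreal (k * (2 / R)))) p" by (rule epowr_mult[OF p0])
        also have "\<dots> \<le> epowr 2 p * (epowr (g x) p + ?c)" by (intro mult_left_mono epowr_max_le p0) simp
        finally show ?thesis using True by (simp add: G_def)
      next
        case False
        then show ?thesis by (auto simp: G_def indicator_def)
      qed
    qed
    also have "\<dots> = epowr 2 p * ((\<integral>\<^sup>+x. ?g x \<partial>\<mu>) + ?c * emeasure \<mu> (- E \<inter> ?B))"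
      by (subst nn_integral_cmult, measurable, subst nn_integral_add) (auto simp: nn_integral_cmult_indicator)
    also have "\<dots> < \<infinity>" using gfin mB by (simp add: ennreal_mult_less_top epowr_lt_top)
    finally show ?thesis .
  qed
  have u'fin: "(\<integral>\<^sup>+x\<in>- E. epowr (e2ennreal \<bar>u' x\<bar>) p \<partial>\<mu>) < \<infinity>"
  proof -
    have "(\<integral>\<^sup>+x\<in>- E. epowr (e2ennreal \<bar>u' x\<bar>) p \<partial>\<mu>)
        \<le> (\<integral>\<^sup>+x. epowr (ennreal k) p * indicator (- E \<inter> ?B) x \<partial>\<mu>)"
    proof (intro nn_integral_mono)
      fix x
      show "epowr (e2ennreal \<bar>u' x\<bar>) p * indicator (- E) x \<le> epowr (ennreal k) p * indicator (- E \<inter> ?B) x"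
      proof (cases "x \<in> - E \<inter> ?B")
        case True
        have "\<bar>\<eta> x * Ur x\<bar> \<le> 1 * k"
          using \<eta>01[of x] uU(2)[OF True] unfolding abs_mult by (intro mult_mono) auto
        then have "e2ennreal \<bar>u' x\<bar> \<le> ennreal k"
          using True by (auto simp: u'E w_def e2ennreal_ereal intro!: ennreal_leI)
        then show ?thesis using True by (auto intro: epowr_mono p0)
      next
        case False
        then show ?thesis by (auto simp: u'E w_def indicator_def e2ennreal_ereal zero_ereal_def)
      qed
    qed
    also have "\<dots> = epowr (ennreal k) p * emeasure \<mu> (- E \<inter> ?B)"
      by (rule nn_integral_cmult_indicator) simp
    also have "\<dots> < \<infinity>" using mB by (simp add: ennreal_mult_less_top epowr_lt_top)
    finally show ?thesis .
  qed
  have "(INF g \<in> {g. upper_gradient (- E) u' g}. \<integral>\<^sup>+x\<in>- E. epowr (g x) p \<partial>\<mu>)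
      \<le> (\<integral>\<^sup>+x\<in>- E. epowr (G x) p \<partial>\<mu>)" using ug by (intro INF_lower) simp
  then have "(INF g \<in> {g. upper_gradient (- E) u' g}. \<integral>\<^sup>+x\<in>- E. epowr (g x) p \<partial>\<mu>) < \<infinity>"
    using Gfin by (rule le_less_trans)
  then have "u' \<in> newtonian p \<mu> (- E)"
    unfolding newtonian_def using u'm u'fin by (simp add: u'_def)
  moreover have "u' y = u y" if y: "y \<in> - E \<inter> ball x0 R" for y
  proof -
    have yB: "y \<in> - E \<inter> ?B" using y R by auto
    have "2 * dist x0 y / R \<le> 2" using y R by (simp add: field_simps)
    then have "\<eta> y = 1" by (simp add: \<eta>_def)
    then show ?thesis using yB uU(1)[OF yB] by (simp add: u'E w_def)
  qed
  ultimately show ?thesis by (rule that)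
qed

end

lemma le_epowr_if_le_perturbed:
  assumes p: "0 < p" and c: "0 < c" and m: "0 < m" "m < \<infinity>" and J: "J < \<infinity>"
    and le: "\<And>\<delta>. 0 < \<delta> \<Longrightarrow> A \<le> ennreal c * epowr ((I + ennreal \<delta> * J) / m) (1 / p)"
  shows "A \<le> ennreal c * epowr (I / m) (1 / p)"
proof -
  define T where "T = A / ennreal c"
  have cT: "A = ennreal c * T"
    using c by (simp add: T_def ennreal_times_divide) (simp add: mult.commute ennreal_mult_divide_eq)
  have le': "epowr T p * m \<le> I + ennreal \<delta> * J" if "0 < \<delta>" for \<delta>
  proof -
    have "T \<le> epowr ((I + ennreal \<delta> * J) / m) (1 / p)"
      using le[OF that] c unfolding cT by (subst (asm) ennreal_mult_le_mult_iff) auto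
    then have "epowr T p \<le> (I + ennreal \<delta> * J) / m"
      using epowr_mono[OF p, of T "epowr ((I + ennreal \<delta> * J) / m) (1 / p)"] epowr_inverse(2)[OF p] by simp
    then have "epowr T p * m \<le> (I + ennreal \<delta> * J) / m * m" by (rule mult_right_mono) simp
    also have "\<dots> = I + ennreal \<delta> * J"
      using m by (simp add: ennreal_divide_times)
    finally show ?thesis .
  qed
  have "epowr T p * m \<le> I"
  proof (rule ennreal_le_epsilon)
    fix e :: real assume e: "0 < e"
    obtain j where j: "J = ennreal j" "0 \<le> j" using J by (cases J) auto
    have "epowr T p * m \<le> I + ennreal (e / (1 + j)) * J" using e j by (intro le') auto
    also have "ennreal (e / (1 + j)) * J \<le> ennreal e"
    proof -
      have "e / (1 + j) * j \<le> e" using e j by (simp add: field_simps)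
      then show ?thesis using e j by (simp add: ennreal_mult[symmetric] ennreal_leI)
    qed
    finally show "epowr T p * m \<le> I + ennreal e" by (simp add: add_left_mono)
  qed
  then have "epowr T p * m / m \<le> I / m" by (rule divide_right_mono_ennreal)
  then have "epowr T p \<le> I / m" using m by (simp add: ennreal_mult_divide_eq)
  then have "T \<le> epowr (I / m) (1 / p)" by (simp add: epowr_le_iff[OF p])
  then show ?thesis unfolding cT by (rule mult_left_mono) simp
qed

section \<open>The function spaces and their restrictions\<close>

lemma newtonian_iff_dirichlet:
  assumes Z: "Z \<in> sets \<mu>" and p: "0 < p"
  shows "u \<in> newtonian p \<mu> Z \<longleftrightarrow> u \<in> dirichlet p \<mu> Z \<and> (\<integral>\<^sup>+x\<in>Z. epowr (e2ennreal \<bar>u x\<bar>) p \<partial>\<mu>) < \<infinity>"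
proof
  assume u: "u \<in> newtonian p \<mu> Z"
  then have um: "u \<in> borel_measurable (restrict_space \<mu> Z)" and ext: "u \<in> extensional Z"
    and fin: "(\<integral>\<^sup>+x\<in>Z. epowr (e2ennreal \<bar>u x\<bar>) p \<partial>\<mu>) < \<infinity>"
    and inf: "(INF g \<in> {g. upper_gradient Z u g}. \<integral>\<^sup>+x\<in>Z. epowr (g x) p \<partial>\<mu>) < \<infinity>"
    by (auto simp: newtonian_def)
  have "(\<lambda>x. epowr (e2ennreal \<bar>u x\<bar>) p) \<in> borel_measurable (restrict_space \<mu> Z)" using um by measurable
  then have "(\<lambda>x. epowr (e2ennreal \<bar>u x\<bar>) p * indicator Z x) \<in> borel_measurable \<mu>"
    using Z by (subst (asm) borel_measurable_restrict_space_iff_ennreal) auto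
  then have "AE x in \<mu>. epowr (e2ennreal \<bar>u x\<bar>) p * indicator Z x \<noteq> \<infinity>"
    using fin by (intro nn_integral_PInf_AE) auto
  then have "AE x in \<mu>. x \<in> Z \<longrightarrow> \<bar>u x\<bar> \<noteq> \<infinity>" by eventually_elim auto
  moreover have "\<exists>g. upper_gradient Z u g \<and> (\<integral>\<^sup>+x\<in>Z. epowr (g x) p \<partial>\<mu>) < \<infinity>"
    using inf by (auto simp: INF_less_iff)
  ultimately show "u \<in> dirichlet p \<mu> Z \<and> (\<integral>\<^sup>+x\<in>Z. epowr (e2ennreal \<bar>u x\<bar>) p \<partial>\<mu>) < \<infinity>"
    using um ext fin by (auto simp: dirichlet_def)
next
  assume u: "u \<in> dirichlet p \<mu> Z \<and> (\<integral>\<^sup>+x\<in>Z. epowr (e2ennreal \<bar>u x\<bar>) p \<partial>\<mu>) < \<infinity>"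
  then obtain g where g: "upper_gradient Z u g" "(\<integral>\<^sup>+x\<in>Z. epowr (g x) p \<partial>\<mu>) < \<infinity>" by (auto simp: dirichlet_def)
  have "(INF g \<in> {g. upper_gradient Z u g}. \<integral>\<^sup>+x\<in>Z. epowr (g x) p \<partial>\<mu>) \<le> (\<integral>\<^sup>+x\<in>Z. epowr (g x) p \<partial>\<mu>)"
    using g by (intro INF_lower) simp
  then have "(INF g \<in> {g. upper_gradient Z u g}. \<integral>\<^sup>+x\<in>Z. epowr (g x) p \<partial>\<mu>) < \<infinity>"
    using g(2) by (rule le_less_trans)
  then show "u \<in> newtonian p \<mu> Z" using u by (simp add: newtonian_def dirichlet_def)
qed

lemma upper_gradient_restrict: "upper_gradient Z u g \<Longrightarrow> upper_gradient Z (restrict u Z) g"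
proof -
  have "\<gamma> 0 \<in> Z \<and> \<gamma> l \<in> Z" if "(\<gamma>, l) \<in> curves Z" for \<gamma> l
    using that by (auto simp: curves_def image_subset_iff)
  then show "upper_gradient Z u g \<Longrightarrow> upper_gradient Z (restrict u Z) g"
    unfolding upper_gradient_osc by fastforce
qed

lemma restrict_dirichlet:
  assumes v: "v \<in> dirichlet p \<mu> UNIV"
  shows "restrict v Z \<in> dirichlet p \<mu> Z"
proof -
  obtain g where g: "upper_gradient UNIV v g" "(\<integral>\<^sup>+x\<in>UNIV. epowr (g x) p \<partial>\<mu>) < \<infinity>"
    and vm: "v \<in> borel_measurable (restrict_space \<mu> UNIV)" and fin: "AE x in \<mu>. x \<in> UNIV \<longrightarrow> \<bar>v x\<bar> \<noteq> \<infinity>"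
    using v by (auto simp: dirichlet_def)
  have "v \<in> borel_measurable (restrict_space \<mu> Z)" by (rule measurable_restrict_mono[OF vm]) simp
  moreover have "restrict v Z \<in> borel_measurable (restrict_space \<mu> Z) \<longleftrightarrow> v \<in> borel_measurable (restrict_space \<mu> Z)"
    by (rule measurable_cong) (simp add: space_restrict_space)
  moreover have "upper_gradient Z (restrict v Z) g"
    by (rule upper_gradient_restrict[OF upper_gradient_subset[OF g(1)]]) simp
  moreover have "(\<integral>\<^sup>+x\<in>Z. epowr (g x) p \<partial>\<mu>) < \<infinity>"
  proof -
    have "(\<integral>\<^sup>+x\<in>Z. epowr (g x) p \<partial>\<mu>) \<le> (\<integral>\<^sup>+x\<in>UNIV. epowr (g x) p \<partial>\<mu>)"
      by (intro nn_integral_mono) (auto simp: indicator_def)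
    then show ?thesis using g(2) by (rule le_less_trans)
  qed
  moreover have "AE x in \<mu>. x \<in> Z \<longrightarrow> \<bar>restrict v Z x\<bar> \<noteq> \<infinity>" using fin by eventually_elim auto
  ultimately show ?thesis by (auto simp: dirichlet_def)
qed

text \<open>Both removability properties compare a space with the restrictions of another one. As values off \<open>Z\<close>
  can be prescribed freely, this only asks for an extension up to a set of measure zero.\<close>

lemma ae_class_eq_restrictions_iff:
  assumes ext: "F \<subseteq> extensional Z" and res: "\<And>v. v \<in> G \<Longrightarrow> restrict v Z \<in> F"
  shows "ae_class \<mu> Z F = (\<lambda>u. restrict u Z) ` ae_class \<mu> UNIV G
    \<longleftrightarrow> (\<forall>u\<in>F. \<exists>v\<in>G. AE x in \<mu>. x \<in> Z \<longrightarrow> u x = v x)"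
proof
  assume eq: "ae_class \<mu> Z F = (\<lambda>u. restrict u Z) ` ae_class \<mu> UNIV G"
  show "\<forall>u\<in>F. \<exists>v\<in>G. AE x in \<mu>. x \<in> Z \<longrightarrow> u x = v x"
  proof
    fix u assume "u \<in> F"
    then have "u \<in> ae_class \<mu> Z F" using ext by (auto simp: ae_class_def)
    then have "u \<in> (\<lambda>u. restrict u Z) ` ae_class \<mu> UNIV G" unfolding eq .
    then obtain w where w: "u = restrict w Z" "w \<in> ae_class \<mu> UNIV G" by auto
    then obtain v where v: "v \<in> G" "AE x in \<mu>. x \<in> UNIV \<longrightarrow> w x = v x" by (auto simp: ae_class_def)
    have "AE x in \<mu>. x \<in> Z \<longrightarrow> u x = v x" using v(2) w(1) by (auto elim: eventually_mono)
    then show "\<exists>v\<in>G. AE x in \<mu>. x \<in> Z \<longrightarrow> u x = v x" using v(1) by (rule bexI)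
  qed
next
  assume ex: "\<forall>u\<in>F. \<exists>v\<in>G. AE x in \<mu>. x \<in> Z \<longrightarrow> u x = v x"
  show "ae_class \<mu> Z F = (\<lambda>u. restrict u Z) ` ae_class \<mu> UNIV G"
  proof (intro antisym subsetI)
    fix u assume "u \<in> ae_class \<mu> Z F"
    then obtain f where f: "u \<in> extensional Z" "f \<in> F" "AE x in \<mu>. x \<in> Z \<longrightarrow> u x = f x" by (auto simp: ae_class_def)
    obtain v where v: "v \<in> G" "AE x in \<mu>. x \<in> Z \<longrightarrow> f x = v x" using ex f(2) by blast
    define w where "w x = (if x \<in> Z then u x else v x)" for x
    have "AE x in \<mu>. x \<in> UNIV \<longrightarrow> w x = v x" using f(3) v(2) by eventually_elim (auto simp: w_def)
    then have "w \<in> ae_class \<mu> UNIV G" using v(1) by (auto simp: ae_class_def)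
    moreover have "u = restrict w Z" using f(1) by (auto simp: w_def restrict_def extensional_def)
    ultimately show "u \<in> (\<lambda>u. restrict u Z) ` ae_class \<mu> UNIV G" by blast
  next
    fix u assume "u \<in> (\<lambda>u. restrict u Z) ` ae_class \<mu> UNIV G"
    then obtain w v where w: "u = restrict w Z" "v \<in> G" "AE x in \<mu>. x \<in> UNIV \<longrightarrow> w x = v x"
      by (auto simp: ae_class_def)
    have "AE x in \<mu>. x \<in> Z \<longrightarrow> u x = restrict v Z x" using w(3) unfolding w(1) by (auto elim: eventually_mono)
    then have "\<exists>f\<in>F. AE x in \<mu>. x \<in> Z \<longrightarrow> u x = f x" using res[OF w(2)] by (rule bexI)
    then show "u \<in> ae_class \<mu> Z F" unfolding ae_class_def w(1) by simp
  qed
qed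

lemma path_almost_open_if_open:
  assumes p: "0 < p" and \<Omega>: "open \<Omega>"
  shows "path_almost_open p \<mu> \<Omega>"
proof -
  have "\<exists>U N. openin (top_of_set {0..l}) U \<and> N \<in> null_sets lebesgue \<and> {t\<in>{0..l}. \<gamma> t \<in> \<Omega>} = U \<union> N"
    if "(\<gamma>, l) \<in> curves UNIV" for \<gamma> l
  proof -
    have "openin (top_of_set {0..l}) ({0..l} \<inter> \<gamma> -` \<Omega>)"
      using that \<Omega> by (intro continuous_openin_preimage_gen) (auto simp: curves_def)
    then show ?thesis by (intro exI[of _ "{0..l} \<inter> \<gamma> -` \<Omega>"] exI[of _ "{}"]) auto
  qed
  then have "{(\<gamma>, l) \<in> curves UNIV. \<not> (\<exists>U N. openin (top_of_set {0..l}) U \<and> N \<in> null_sets lebesgue \<and>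
               {t\<in>{0..l}. \<gamma> t \<in> \<Omega>} = U \<union> N)} = {}" by blast
  then have "path_almost_open p \<mu> \<Omega> \<longleftrightarrow> modulus p \<mu> UNIV {} = 0"
    unfolding path_almost_open_def by (simp only:)
  also have "modulus p \<mu> UNIV {} \<le> (\<integral>\<^sup>+x\<in>UNIV. epowr 0 p \<partial>\<mu>)"
    unfolding modulus_def by (rule INF_lower) simp
  then have "modulus p \<mu> UNIV {} = 0" by simp
  finally show ?thesis by simp
qed

context null_complement
begin

lemma average_complement_ball:
  fixes W :: "'a \<Rightarrow> real"
  assumes w: "w \<in> borel_measurable (restrict_space \<mu> A)"
    and A: "A \<in> sets \<mu>" "A \<subseteq> ball x r" "ball x r - A \<subseteq> E" 
    and W [measurable]: "W \<in> borel_measurable \<nu>" and eq: "AE y in \<nu>. y \<in> A \<longrightarrow> w y = ereal (W y)"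
  shows "average \<mu> A w = mean r W x"
proof -
  have ae: "AE y in \<nu>. indicator A y *\<^sub>R real_of_ereal (w y) = indicator (ball x r) y *\<^sub>R W y"
    using eq AE_complement by eventually_elim (use A in \<open>auto simp: indicator_def\<close>)
  have "(\<lambda>y. real_of_ereal (w y)) \<in> borel_measurable (restrict_space \<mu> A)" using w by measurable
  then have m: "(\<lambda>y. indicator A y *\<^sub>R real_of_ereal (w y)) \<in> borel_measurable \<mu>"
    using A by (subst (asm) borel_measurable_restrict_space_iff) auto
  have mW: "(\<lambda>y. indicator (ball x r) y *\<^sub>R W y) \<in> borel_measurable \<nu>" by measurable
  have "(\<integral>y\<in>A. real_of_ereal (w y) \<partial>\<mu>) = (\<integral>y. indicator (ball x r) y *\<^sub>R W y \<partial>\<mu>)"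
    unfolding set_lebesgue_integral_def
    by (rule integral_cong_AE[OF m measurable_completion[OF mW] AE_completion[OF ae]])
  also have "\<dots> = (\<integral>y\<in>ball x r. W y \<partial>\<nu>)"
    unfolding set_lebesgue_integral_def by (rule integral_completion[OF mW])
  finally have 1: "(\<integral>y\<in>A. real_of_ereal (w y) \<partial>\<mu>) = (\<integral>y\<in>ball x r. W y \<partial>\<nu>)" .
  have "emeasure \<mu> A = (\<integral>\<^sup>+y. indicator A y \<partial>\<mu>)" using A by simp
  also have "\<dots> = (\<integral>\<^sup>+y. indicator (ball x r) y \<partial>\<nu>)"
    using AE_complement
    by (subst nn_integral_completion, intro nn_integral_cong_AE, eventually_elim) (use A in \<open>auto simp: indicator_def\<close>)
  also have "\<dots> = emeasure \<nu> (ball x r)" by simp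
  finally show ?thesis using 1 unfolding average_def mean_def measure_def by simp
qed

end

section \<open>The equivalence\<close>

context null_complement
begin

text \<open>The function is cut off, extended, and the Poincare inequality of the whole space is applied to the
  extension \<open>v\<close> on the smaller ball. There \<open>max g' (d * \<rho>)\<close> is an upper gradient of \<open>v\<close> for every
  \<open>d > 0\<close>, and its energy tends to that of \<open>g\<close> as \<open>d\<close> tends to zero.\<close>

lemma poincare_if_bounded:
  fixes u :: "'a \<Rightarrow> ereal"
  assumes pao: "path_almost_open p \<mu> (- E)"
    and ext: "\<And>u. u \<in> newtonian p \<mu> (- E) \<Longrightarrow>
        \<exists>v\<in>newtonian p \<mu> UNIV. AE x in \<mu>. x \<in> - E \<longrightarrow> u x = v x"
    and C: "0 < C" and L: "1 \<le> L"
    and PI: "\<And>r u g. 0 < r \<Longrightarrow> integrable_ereal_on \<mu> (ball x (L * r)) u \<Longrightarrow>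
       upper_gradient (ball x (L * r)) u g \<Longrightarrow>
       (\<integral>\<^sup>+y\<in>ball x r. osc (u y) (ereal (average \<mu> (ball x r) u)) \<partial>\<nu>) / emeasure \<nu> (ball x r)
         \<le> ennreal (C * r) * epowr (avg (L * r) (\<lambda>y. epowr (g y) p) x) (1 / p)"
    and r: "0 < r"
    and g: "upper_gradient (- E \<inter> ball x (2 * (L * r))) u g"
    and gfin: "(\<integral>\<^sup>+y\<in>- E \<inter> ball x (2 * (L * r)). epowr (g y) p \<partial>\<mu>) < \<infinity>"
    and um: "u \<in> borel_measurable (restrict_space \<mu> (- E \<inter> ball x (2 * (L * r))))"
    and k: "0 \<le> k" "\<And>y. y \<in> - E \<inter> ball x (2 * (L * r)) \<Longrightarrow> \<bar>u y\<bar> \<le> ereal k"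
    and U [measurable]: "U \<in> borel_measurable \<nu>" and uU: "AE y in \<nu>. y \<in> - E \<inter> ball x (2 * (L * r)) \<longrightarrow> u y = ereal (U y)"
  shows "(\<integral>\<^sup>+y\<in>ball x r. ennreal \<bar>U y - mean r U x\<bar> \<partial>\<nu>)
    \<le> ennreal (C * r) * epowr (avg (L * r) (\<lambda>y. epowr (g y) p) x) (1 / p) * emeasure \<nu> (ball x r)"
proof -
  define R where "R = L * r"
  have R: "0 < R" "r \<le> R" using L r by (simp_all add: R_def)
  obtain u' where u': "u' \<in> newtonian p \<mu> (- E)" "\<And>y. y \<in> - E \<inter> ball x R \<Longrightarrow> u' y = u y"
    using cutoff_newtonian[OF R(1) g[folded R_def] gfin[folded R_def] um[folded R_def] k(1) k(2)[folded R_def]] by blast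
  obtain v where v: "v \<in> newtonian p \<mu> UNIV" "AE x in \<mu>. x \<in> - E \<longrightarrow> u' x = v x"
    using ext[OF u'(1)] by blast
  have "v \<in> dirichlet p \<mu> UNIV"
    using v(1) newtonian_iff_dirichlet[OF _ p0, of UNIV "\<mu>" v] by auto
  then obtain h where h: "upper_gradient UNIV v h" "(\<integral>\<^sup>+x. epowr (h x) p \<partial>\<nu>) < \<infinity>"
    and vm: "v \<in> borel_measurable \<mu>"
    by (auto simp: dirichlet_def nn_integral_completion)
  have uv: "AE y in \<nu>. y \<in> - E \<inter> ball x R \<longrightarrow> u y = v y"
    using v(2)[unfolded AE_completion_iff] by eventually_elim (use u'(2) in auto)
  have sub: "ball x r \<subseteq> ball x R" "- E \<inter> ball x R \<subseteq> - E \<inter> ball x (2 * R)" using R by auto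
  have gR: "upper_gradient (- E \<inter> ball x R) u g"
    by (rule upper_gradient_subset[OF g[folded R_def] sub(2)])
  obtain g' \<rho> where g' [measurable]: "g' \<in> borel_measurable borel" and \<rho> [measurable]: "\<rho> \<in> borel_measurable borel"
    and gg': "AE y in \<nu>. y \<in> - E \<inter> ball x R \<longrightarrow> g y = g' y" and \<rho>fin: "(\<integral>\<^sup>+y. epowr (\<rho> y) p \<partial>\<nu>) < \<infinity>"
    and weak: "\<And>\<gamma> l. (\<gamma>, l) \<in> curves (ball x R) \<Longrightarrow> line_integral \<rho> \<gamma> l < \<infinity> \<Longrightarrow> osc (v (\<gamma> 0)) (v (\<gamma> l)) \<le> line_integral g' \<gamma> l"
    using restriction_gradient_is_weak_gradient[OF pao h gR uv] by blast
  have vU: "AE y in \<nu>. y \<in> ball x R \<longrightarrow> v y = ereal (U y)"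
    using uv uU[folded R_def] AE_complement by eventually_elim (use R in auto)
  have v_int: "integrable_ereal_on \<mu> (ball x R) v"
    unfolding integrable_ereal_on_def
  proof
    show "v \<in> borel_measurable (restrict_space \<mu> (ball x R))"
      by (rule measurable_restrict_space1[OF vm])
    have "(\<integral>\<^sup>+y\<in>ball x R. e2ennreal \<bar>v y\<bar> \<partial>\<nu>) \<le> (\<integral>\<^sup>+y\<in>ball x R. ennreal k \<partial>\<nu>)"
    proof (rule nn_integral_mono_AE)
      show "AE y in \<nu>. e2ennreal \<bar>v y\<bar> * indicator (ball x R) y \<le> ennreal k * indicator (ball x R) y"
        using uv AE_complement
      proof eventually_elim
        case (elim y)
        show ?case
        proof (cases "y \<in> ball x R")
          case True
          then have yA: "y \<in> - E \<inter> ball x (2 * (L * r))" using elim sub(2) R_def by auto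
          then have "\<bar>v y\<bar> \<le> ereal k" using k(2)[OF yA] elim True by simp
          then show ?thesis using e2ennreal_mono[of "\<bar>v y\<bar>" "ereal k"] True by (simp add: e2ennreal_ereal)
        qed simp
      qed
    qed
    also have "\<dots> < \<infinity>" by (simp add: nn_integral_cmult_indicator ennreal_mult_less_top)
    finally show "(\<integral>\<^sup>+y\<in>ball x R. e2ennreal \<bar>v y\<bar> \<partial>\<mu>) < \<infinity>" by (simp add: nn_integral_completion)
  qed
  have avg_v: "average \<mu> (ball x r) v = mean r U x"
  proof (rule average_complement_ball)
    show "v \<in> borel_measurable (restrict_space \<mu> (ball x r))"
      by (rule measurable_restrict_space1[OF vm])
    show "AE y in \<nu>. y \<in> ball x r \<longrightarrow> v y = ereal (U y)" using vU by eventually_elim (use sub(1) in blast)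
  qed (auto simp: sets_completionI_sets)
  have lhs: "(\<integral>\<^sup>+y\<in>ball x r. osc (v y) (ereal (mean r U x)) \<partial>\<nu>) = (\<integral>\<^sup>+y\<in>ball x r. ennreal \<bar>U y - mean r U x\<bar> \<partial>\<nu>)"
    using vU by (intro nn_integral_cong_AE, eventually_elim) (use sub(1) in \<open>auto simp: indicator_def\<close>)
  have "(\<integral>\<^sup>+y\<in>ball x r. ennreal \<bar>U y - mean r U x\<bar> \<partial>\<nu>) / emeasure \<nu> (ball x r)
      \<le> ennreal (C * r) * epowr ((\<integral>\<^sup>+y\<in>ball x R. epowr (g y) p \<partial>\<nu>) / emeasure \<nu> (ball x R)) (1 / p)"
  proof (rule le_epowr_if_le_perturbed[OF p0 _ _ _ \<rho>fin])
    show "0 < C * r" using C r by simp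
    show "0 < emeasure \<nu> (ball x R)" "emeasure \<nu> (ball x R) < \<infinity>" using ball_pos[OF R(1)] ball_fin[OF R(1)] by auto
    fix \<delta> :: real assume \<delta>: "0 < \<delta>"
    define d where "d = ennreal (\<delta> powr (1 / p))"
    have d: "epowr d p = ennreal \<delta>" "0 < d" using \<delta> p0 by (auto simp: d_def epowr_ennreal powr_powr)
    define G where "G y = max (g' y) (d * \<rho> y)" for y
    have [measurable]: "G \<in> borel_measurable borel" unfolding G_def by measurable
    have "upper_gradient (ball x R) v G"
      unfolding upper_gradient_osc
    proof (intro conjI ballI, rule measurable_restrict_space1, simp, clarify)
      fix \<gamma> l assume c: "(\<gamma>, l) \<in> curves (ball x R)"
      show "osc (v (\<gamma> 0)) (v (\<gamma> l)) \<le> line_integral G \<gamma> l"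
      proof (cases "line_integral \<rho> \<gamma> l < \<infinity>")
        case True
        from weak[OF c True] have "osc (v (\<gamma> 0)) (v (\<gamma> l)) \<le> line_integral g' \<gamma> l" .
        also have "\<dots> \<le> line_integral G \<gamma> l"
          unfolding G_def by (intro line_integral_mono) simp
        finally show ?thesis .
      next
        case False
        have "line_integral \<rho> \<gamma> l = top" using False by (simp add: not_less top_unique)
        then have "\<infinity> = d * line_integral \<rho> \<gamma> l" using d(2) by (simp add: ennreal_mult_top)
        also have "\<dots> = line_integral (\<lambda>x. d * \<rho> x) \<gamma> l"
          by (rule line_integral_cmult[symmetric, OF c]) simp
        also have "\<dots> \<le> line_integral G \<gamma> l" unfolding G_def by (intro line_integral_mono) simp
        finally show ?thesis by (simp add: top_unique)
      qed
    qed
    from PI[OF r v_int[unfolded R_def] this[unfolded R_def]]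
    have "(\<integral>\<^sup>+y\<in>ball x r. ennreal \<bar>U y - mean r U x\<bar> \<partial>\<nu>) / emeasure \<nu> (ball x r)
        \<le> ennreal (C * r) * epowr (avg R (\<lambda>y. epowr (G y) p) x) (1 / p)"
      unfolding avg_v lhs R_def .
    also have "\<dots> \<le> ennreal (C * r) * epowr (((\<integral>\<^sup>+y\<in>ball x R. epowr (g y) p \<partial>\<nu>) + ennreal \<delta> * (\<integral>\<^sup>+y. epowr (\<rho> y) p \<partial>\<nu>)) / emeasure \<nu> (ball x R)) (1 / p)"
      unfolding avg_def
    proof (intro mult_left_mono epowr_mono divide_right_mono_ennreal)
      have "(\<integral>\<^sup>+y\<in>ball x R. epowr (G y) p \<partial>\<nu>)
          \<le> (\<integral>\<^sup>+y. epowr (g' y) p * indicator (ball x R) y + ennreal \<delta> * epowr (\<rho> y) p \<partial>\<nu>)"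
      proof (intro nn_integral_mono)
        fix y
        have "epowr (G y) p \<le> epowr (g' y) p + epowr (d * \<rho> y) p" unfolding G_def by (rule epowr_max_le[OF p0])
        also have "epowr (d * \<rho> y) p = ennreal \<delta> * epowr (\<rho> y) p" by (simp add: epowr_mult[OF p0] d(1))
        finally show "epowr (G y) p * indicator (ball x R) y \<le> epowr (g' y) p * indicator (ball x R) y + ennreal \<delta> * epowr (\<rho> y) p"
          by (auto simp: indicator_def)
      qed
      also have "\<dots> = (\<integral>\<^sup>+y\<in>ball x R. epowr (g' y) p \<partial>\<nu>) + ennreal \<delta> * (\<integral>\<^sup>+y. epowr (\<rho> y) p \<partial>\<nu>)"
        by (subst nn_integral_add) (auto simp: nn_integral_cmult)
      also have "(\<integral>\<^sup>+y\<in>ball x R. epowr (g' y) p \<partial>\<nu>) = (\<integral>\<^sup>+y\<in>ball x R. epowr (g y) p \<partial>\<nu>)"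
        using gg' AE_complement by (intro nn_integral_cong_AE, eventually_elim) (auto simp: indicator_def)
      finally show "(\<integral>\<^sup>+y\<in>ball x R. epowr (G y) p \<partial>\<nu>)
          \<le> (\<integral>\<^sup>+y\<in>ball x R. epowr (g y) p \<partial>\<nu>) + ennreal \<delta> * (\<integral>\<^sup>+y. epowr (\<rho> y) p \<partial>\<nu>)" .
    qed (use p0 in auto)
    finally show "(\<integral>\<^sup>+y\<in>ball x r. ennreal \<bar>U y - mean r U x\<bar> \<partial>\<nu>) / emeasure \<nu> (ball x r)
      \<le> ennreal (C * r) * epowr (((\<integral>\<^sup>+y\<in>ball x R. epowr (g y) p \<partial>\<nu>) + ennreal \<delta> * (\<integral>\<^sup>+y. epowr (\<rho> y) p \<partial>\<nu>)) / emeasure \<nu> (ball x R)) (1 / p)" .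
  qed
  then have "(\<integral>\<^sup>+y\<in>ball x r. ennreal \<bar>U y - mean r U x\<bar> \<partial>\<nu>) / emeasure \<nu> (ball x r) * emeasure \<nu> (ball x r)
      \<le> ennreal (C * r) * epowr (avg (L * r) (\<lambda>y. epowr (g y) p) x) (1 / p) * emeasure \<nu> (ball x r)"
    unfolding avg_def R_def by (rule mult_right_mono) simp
  then show ?thesis using r by simp
qed

text \<open>Boundedness is removed by truncation. The ball on the right-hand side is doubled to make room for
  the cutoff.\<close>

theorem poincare_if_newtonian_extension:
  assumes pao: "path_almost_open p \<mu> (- E)"
    and ext: "\<And>u. u \<in> newtonian p \<mu> (- E) \<Longrightarrow>
        \<exists>v\<in>newtonian p \<mu> UNIV. AE x in \<mu>. x \<in> - E \<longrightarrow> u x = v x"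
    and sp: "supports_poincare p \<mu> UNIV"
  shows "supports_poincare p \<mu> (- E)"
proof -
  obtain C L where C: "0 < C" and L: "1 \<le> L" and PI0:
    "\<forall>x r u g. x \<in> UNIV \<longrightarrow> 0 < r \<longrightarrow> integrable_ereal_on \<mu> (UNIV \<inter> ball x (L * r)) u \<longrightarrow>
       upper_gradient (UNIV \<inter> ball x (L * r)) u g \<longrightarrow>
       (\<integral>\<^sup>+y\<in>UNIV \<inter> ball x r. osc (u y) (ereal (average \<mu> (UNIV \<inter> ball x r) u)) \<partial>\<mu>)
           / emeasure \<mu> (UNIV \<inter> ball x r)
         \<le> ennreal (C * r) * epowr ((\<integral>\<^sup>+y\<in>UNIV \<inter> ball x (L * r). epowr (g y) p \<partial>\<mu>)
           / emeasure \<mu> (UNIV \<inter> ball x (L * r))) (1 / p)"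
    by (rule supports_poincareD[OF sp]) (rule that)
  have PI: "(\<integral>\<^sup>+y\<in>ball x r. osc (u y) (ereal (average \<mu> (ball x r) u)) \<partial>\<nu>) / emeasure \<nu> (ball x r)
         \<le> ennreal (C * r) * epowr (avg (L * r) (\<lambda>y. epowr (g y) p) x) (1 / p)"
    if "0 < r" "integrable_ereal_on \<mu> (ball x (L * r)) u" "upper_gradient (ball x (L * r)) u g" for x r u g
  proof -
    have b: "emeasure \<mu> (ball x s) = emeasure \<nu> (ball x s)" for s by simp
    show ?thesis
      using PI0[rule_format, of x r u g] that unfolding Int_UNIV_left nn_integral_completion b avg_def by simp
  qed
  define C' where "C' = C * D powr (1 / p)"
  have C': "0 < C'" using C D_pos by (simp add: C'_def)
  have main: "(\<integral>\<^sup>+y\<in>- E \<inter> ball x r. osc (u y) (ereal (average \<mu> (- E \<inter> ball x r) u)) \<partial>\<mu>) / emeasure \<mu> (- E \<inter> ball x r)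
      \<le> ennreal (C' * r) * epowr ((\<integral>\<^sup>+y\<in>- E \<inter> ball x (2 * L * r). epowr (g y) p \<partial>\<mu>)
           / emeasure \<mu> (- E \<inter> ball x (2 * L * r))) (1 / p)"
    if r: "0 < r" and ui: "integrable_ereal_on \<mu> (- E \<inter> ball x (2 * L * r)) u"
      and g: "upper_gradient (- E \<inter> ball x (2 * L * r)) u g" for x r u g
  proof (cases "(\<integral>\<^sup>+y\<in>- E \<inter> ball x (2 * L * r). epowr (g y) p \<partial>\<mu>) < \<infinity>")
    case False
    then have "(\<integral>\<^sup>+y\<in>- E \<inter> ball x (2 * L * r). epowr (g y) p \<partial>\<mu>) = top"
      by (simp add: not_less top_unique)
    then show ?thesis
      using C' r by (simp only: emeasure_complement_ball ennreal_top_divide) (simp add: ennreal_mult_top)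
  next
    case gfin: True
    let ?B = "- E \<inter> ball x (2 * (L * r))"
    have R2: "2 * L * r = 2 * (L * r)" by simp
    have r': "r \<le> 2 * (L * r)" "r \<le> L * r" "0 < L * r" using L r by simp_all
    have um: "u \<in> borel_measurable (restrict_space \<mu> ?B)"
      and ufin: "(\<integral>\<^sup>+y\<in>?B. e2ennreal \<bar>u y\<bar> \<partial>\<mu>) < \<infinity>"
      using ui unfolding R2 integrable_ereal_on_def by auto
    have "(\<lambda>y. e2ennreal \<bar>u y\<bar>) \<in> borel_measurable (restrict_space \<mu> ?B)" using um by measurable
    then have "(\<lambda>y. e2ennreal \<bar>u y\<bar> * indicator ?B y) \<in> borel_measurable \<mu>"
      by (subst (asm) borel_measurable_restrict_space_iff_ennreal) auto
    then have "AE y in \<mu>. e2ennreal \<bar>u y\<bar> * indicator ?B y \<noteq> \<infinity>"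
      using ufin by (intro nn_integral_PInf_AE) auto
    then have "AE y in \<nu>. y \<in> ?B \<longrightarrow> \<bar>u y\<bar> \<noteq> \<infinity>"
      unfolding AE_completion_iff by eventually_elim auto
    then obtain U where U [measurable]: "U \<in> borel_measurable \<nu>" and uU: "AE y in \<nu>. y \<in> ?B \<longrightarrow> u y = ereal (U y)"
      using borel_version_real[OF um complement_ball_sets] by blast
    have sub: "- E \<inter> ball x r \<subseteq> ?B" "ball x r \<subseteq> ball x (2 * (L * r))" using r' by auto
    have umr: "u \<in> borel_measurable (restrict_space \<mu> (- E \<inter> ball x r))"
      by (rule measurable_restrict_mono[OF um sub(1)])
    have uUr: "AE y in \<nu>. y \<in> - E \<inter> ball x r \<longrightarrow> u y = ereal (U y)"
      using uU by eventually_elim (use sub in blast)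
    have av: "average \<mu> (- E \<inter> ball x r) u = mean r U x"
      by (rule average_complement_ball[OF umr complement_ball_sets _ _ U uUr]) auto
    define T where "T k y = max (- real k) (min (real k) (U y))" for k y
    have [measurable]: "T k \<in> borel_measurable \<nu>" for k unfolding T_def by measurable
    define Y where "Y = ennreal (C * r) * epowr (avg (L * r) (\<lambda>y. epowr (g y) p) x) (1 / p)"
    have bound: "(\<integral>\<^sup>+y\<in>ball x r. ennreal \<bar>T k y - mean r (T k) x\<bar> \<partial>\<nu>) \<le> Y * emeasure \<nu> (ball x r)" for k
      unfolding Y_def
    proof (rule poincare_if_bounded[OF pao ext C L PI r])
      show "upper_gradient ?B (\<lambda>y. trunc k (u y)) g"
        using g unfolding R2 by (rule upper_gradient_trunc)
      show "(\<integral>\<^sup>+y\<in>?B. epowr (g y) p \<partial>\<mu>) < \<infinity>" using gfin unfolding R2 .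
      show "(\<lambda>y. trunc k (u y)) \<in> borel_measurable (restrict_space \<mu> ?B)"
        by (rule measurable_compose[OF um measurable_trunc])
      show "AE y in \<nu>. y \<in> ?B \<longrightarrow> trunc k (u y) = ereal (T k y)"
        using uU by eventually_elim (use trunc_ereal T_def in metis)
      show "\<bar>trunc k (u y)\<bar> \<le> ereal (real k)" for y by (rule abs_trunc_le)
    qed simp_all
    have Uint: "set_integrable \<nu> (ball x r) U"
    proof (rule set_integrable_if_oscillation_finite[OF U, where c = 0])
      have "(\<integral>\<^sup>+y\<in>ball x r. ennreal \<bar>U y - 0\<bar> \<partial>\<nu>) \<le> (\<integral>\<^sup>+y\<in>?B. e2ennreal \<bar>u y\<bar> \<partial>\<nu>)"
      proof (rule nn_integral_mono_AE)
        show "AE y in \<nu>. ennreal \<bar>U y - 0\<bar> * indicator (ball x r) y \<le> e2ennreal \<bar>u y\<bar> * indicator ?B y"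
          using uU AE_complement
        proof eventually_elim
          case (elim y)
          then show ?case using sub(2) by (cases "y \<in> ball x r") (auto simp: e2ennreal_ereal indicator_def)
        qed
      qed
      then show "(\<integral>\<^sup>+y\<in>ball x r. ennreal \<bar>U y - 0\<bar> \<partial>\<nu>) < \<infinity>" using ufin by (simp add: nn_integral_completion)
    qed
    have Tlim: "(\<lambda>k. T k y) \<longlonglongrightarrow> U y" for y
    proof -
      obtain n :: nat where n: "\<bar>U y\<bar> \<le> real n" using real_arch_simple by blast
      have "eventually (\<lambda>k. T k y = U y) sequentially"
        unfolding eventually_sequentially using n by (intro exI[of _ n]) (auto simp: T_def)
      then show ?thesis by (rule tendsto_eventually)
    qed
    have mlim: "(\<lambda>k. mean r (T k) x) \<longlonglongrightarrow> mean r U x"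
      unfolding mean_def set_lebesgue_integral_def divide_inverse
    proof (intro tendsto_mult tendsto_const integral_dominated_convergence[where w = "\<lambda>y. \<bar>indicator (ball x r) y *\<^sub>R U y\<bar>"])
      show "integrable \<nu> (\<lambda>y. \<bar>indicator (ball x r) y *\<^sub>R U y\<bar>)"
        using Uint unfolding set_integrable_def by (rule integrable_abs)
      show "AE y in \<nu>. (\<lambda>k. indicator (ball x r) y *\<^sub>R T k y) \<longlonglongrightarrow> indicator (ball x r) y *\<^sub>R U y"
        by (intro AE_I2 tendsto_scaleR tendsto_const Tlim)
      show "AE y in \<nu>. norm (indicator (ball x r) y *\<^sub>R T k y) \<le> \<bar>indicator (ball x r) y *\<^sub>R U y\<bar>" for k
        by (rule AE_I2) (auto simp: T_def indicator_def)
    qed measurable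
    have "(\<integral>\<^sup>+y\<in>ball x r. ennreal \<bar>U y - mean r U x\<bar> \<partial>\<nu>)
        = (\<integral>\<^sup>+y. liminf (\<lambda>k. ennreal \<bar>T k y - mean r (T k) x\<bar> * indicator (ball x r) y) \<partial>\<nu>)"
    proof (intro nn_integral_cong)
      fix y
      have "(\<lambda>k. ennreal \<bar>T k y - mean r (T k) x\<bar> * indicator (ball x r) y)
          \<longlonglongrightarrow> ennreal \<bar>U y - mean r U x\<bar> * indicator (ball x r) y"
      proof (cases "y \<in> ball x r")
        case True
        then show ?thesis
          using tendsto_ennrealI[OF tendsto_rabs[OF tendsto_diff[OF Tlim[of y] mlim]]] by simp
      qed simp
      then show "ennreal \<bar>U y - mean r U x\<bar> * indicator (ball x r) y
          = liminf (\<lambda>k. ennreal \<bar>T k y - mean r (T k) x\<bar> * indicator (ball x r) y)"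
        by (intro lim_imp_Liminf[symmetric]) auto
    qed
    also have "\<dots> \<le> liminf (\<lambda>k. \<integral>\<^sup>+y\<in>ball x r. ennreal \<bar>T k y - mean r (T k) x\<bar> \<partial>\<nu>)"
      by (intro nn_integral_liminf) measurable
    also have "\<dots> \<le> Y * emeasure \<nu> (ball x r)"
      using bound by (intro Liminf_le) auto
    finally have "(\<integral>\<^sup>+y\<in>ball x r. ennreal \<bar>U y - mean r U x\<bar> \<partial>\<nu>) / emeasure \<nu> (ball x r) \<le> Y"
      using ball_pos[OF r, of x] by (intro divide_le_posI_ennreal) (simp_all add: mult.commute)
    also have "Y \<le> ennreal (C' * r) * epowr (avg (2 * (L * r)) (\<lambda>y. epowr (g y) p) x) (1 / p)"
    proof -
      have "avg (L * r) (\<lambda>y. epowr (g y) p) x \<le> ennreal D * avg (2 * (L * r)) (\<lambda>y. epowr (g y) p) x"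
        by (rule avg_le_avg[OF _ r'(3) doubling[OF r'(3)]]) (use r' in auto)
      then have "epowr (avg (L * r) (\<lambda>y. epowr (g y) p) x) (1 / p)
          \<le> epowr (ennreal D * avg (2 * (L * r)) (\<lambda>y. epowr (g y) p) x) (1 / p)"
        using p0 by (intro epowr_mono) auto
      also have "\<dots> = ennreal (D powr (1 / p)) * epowr (avg (2 * (L * r)) (\<lambda>y. epowr (g y) p) x) (1 / p)"
        using p0 D_pos by (simp add: epowr_mult epowr_ennreal)
      finally have "Y \<le> ennreal (C * r) * (ennreal (D powr (1 / p)) * epowr (avg (2 * (L * r)) (\<lambda>y. epowr (g y) p) x) (1 / p))"
        unfolding Y_def by (rule mult_left_mono) simp
      also have "\<dots> = ennreal (C' * r) * epowr (avg (2 * (L * r)) (\<lambda>y. epowr (g y) p) x) (1 / p)"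
        using C r by (simp add: C'_def ennreal_mult mult_ac)
      finally show ?thesis .
    qed
    also have "(\<integral>\<^sup>+y\<in>ball x r. ennreal \<bar>U y - mean r U x\<bar> \<partial>\<nu>) = (\<integral>\<^sup>+y\<in>ball x r. osc (u y) (ereal (mean r U x)) \<partial>\<nu>)"
      using uUr AE_complement by (intro nn_integral_cong_AE, eventually_elim) (auto simp: indicator_def)
    finally show ?thesis
      unfolding av emeasure_complement_ball nn_integral_complement_Int R2 avg_def .
  qed
  show ?thesis
    unfolding supports_poincare_def Let_def abs_diff_osc
  proof (intro exI conjI ballI allI impI)
    show "0 < C'" by (rule C')
    show "1 \<le> 2 * L" using L by simp
  qed (rule main)
qed

end

theorem theorem1p1:
  fixes p :: real
    and w :: "real ^ 'n \<Rightarrow> real"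
    and \<mu> :: "(real ^ 'n) measure"
    and E \<Omega> :: "(real ^ 'n) set"
  assumes "1 \<le> p"
    and "p_admissible p w"
    and "\<mu> = weighted_measure w"
    and "E \<in> null_sets \<mu>"
    and "\<Omega> = UNIV - E"
  shows "(open \<Omega> \<longrightarrow> path_almost_open p \<mu> \<Omega>) \<and>
         (path_almost_open p \<mu> \<Omega> \<longrightarrow>
            (removable_sobolev p \<mu> E \<longleftrightarrow> removable_dirichlet p \<mu> E) \<and>
            (removable_dirichlet p \<mu> E \<longleftrightarrow> supports_poincare p \<mu> \<Omega>))"
proof -
  have p0: "0 < p" using assms(1) by simp
  have \<Omega>: "\<Omega> = - E" using assms(5) by auto
  obtain \<nu> :: "(real ^ 'n) measure" where \<nu>: "sets \<nu> = sets borel" "weighted_measure w = completion \<nu>"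
    using weighted_measure_eq_completion assms(2) unfolding p_admissible_def by blast
  have \<mu>: "\<mu> = completion \<nu>" using assms(3) \<nu>(2) by simp
  have ball: "emeasure \<mu> (ball x r) = emeasure \<nu> (ball x r)" for x r
    unfolding \<mu> using \<nu>(1) by simp
  have dbl: "globally_doubling \<mu>" and spU: "supports_poincare p \<mu> UNIV"
    using assms(2,3) by (auto simp: p_admissible_def)
  obtain D where D: "0 < D" "\<forall>x r. 0 < r \<longrightarrow> emeasure \<mu> (ball x (2 * r)) \<le> ennreal D * emeasure \<mu> (ball x r)"
    using dbl unfolding globally_doubling_def by blast
  have pf: "\<forall>x r. 0 < r \<longrightarrow> 0 < emeasure \<mu> (ball x r) \<and> emeasure \<mu> (ball x r) < \<infinity>"
    using dbl unfolding globally_doubling_def by blast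
  interpret null_complement \<nu> D p E
    by unfold_locales (use \<nu> D pf ball assms(1,4) \<mu> in auto)
  let ?Z = "- E"
  have Z: "?Z \<in> sets \<mu>" unfolding \<mu> by simp
  have nd: "u \<in> newtonian p \<mu> Z \<longleftrightarrow> u \<in> dirichlet p \<mu> Z \<and> (\<integral>\<^sup>+x\<in>Z. epowr (e2ennreal \<bar>u x\<bar>) p \<partial>\<mu>) < \<infinity>"
    if "Z \<in> sets \<mu>" for u Z by (rule newtonian_iff_dirichlet[OF that p0])
  have U: "UNIV \<in> sets \<mu>" unfolding \<mu> using sets.top[of "completion \<nu>"] by simp
  have rd: "removable_dirichlet p \<mu> E \<longleftrightarrow>
      (\<forall>u\<in>dirichlet p \<mu> ?Z. \<exists>v\<in>dirichlet p \<mu> UNIV. AE x in \<mu>. x \<in> ?Z \<longrightarrow> u x = v x)"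
    unfolding removable_dirichlet_def dirichlet_space_def
  proof (rule ae_class_eq_restrictions_iff)
    show "dirichlet p \<mu> ?Z \<subseteq> extensional ?Z" by (auto simp: dirichlet_def)
  qed (rule restrict_dirichlet)
  have rs: "removable_sobolev p \<mu> E \<longleftrightarrow>
      (\<forall>u\<in>newtonian p \<mu> ?Z. \<exists>v\<in>newtonian p \<mu> UNIV. AE x in \<mu>. x \<in> ?Z \<longrightarrow> u x = v x)"
    unfolding removable_sobolev_def sobolev_space_def
  proof (rule ae_class_eq_restrictions_iff)
    show "newtonian p \<mu> ?Z \<subseteq> extensional ?Z" by (auto simp: newtonian_def)
    fix v assume v: "v \<in> newtonian p \<mu> UNIV"
    have "(\<integral>\<^sup>+x\<in>?Z. epowr (e2ennreal \<bar>restrict v ?Z x\<bar>) p \<partial>\<mu>) \<le> (\<integral>\<^sup>+x\<in>UNIV. epowr (e2ennreal \<bar>v x\<bar>) p \<partial>\<mu>)"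
      by (intro nn_integral_mono) (auto simp: indicator_def)
    then show "restrict v ?Z \<in> newtonian p \<mu> ?Z"
      using v restrict_dirichlet[of v p \<mu> ?Z] unfolding nd[OF Z] nd[OF U] by (auto intro: le_less_trans)
  qed
  have ds: "removable_sobolev p \<mu> E" if rdE: "removable_dirichlet p \<mu> E"
    unfolding rs
  proof
    fix u assume u: "u \<in> newtonian p \<mu> ?Z"
    then obtain v where v: "v \<in> dirichlet p \<mu> UNIV" "AE x in \<mu>. x \<in> ?Z \<longrightarrow> u x = v x"
      using rdE unfolding rd nd[OF Z] by blast
    have "(\<integral>\<^sup>+x\<in>UNIV. epowr (e2ennreal \<bar>v x\<bar>) p \<partial>\<mu>) = (\<integral>\<^sup>+x\<in>?Z. epowr (e2ennreal \<bar>u x\<bar>) p \<partial>\<mu>)"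
      using v(2) AE_completion[OF AE_complement] unfolding \<mu>
      by (intro nn_integral_cong_AE, eventually_elim) simp
    then have "v \<in> newtonian p \<mu> UNIV" using u v(1) unfolding nd[OF Z] nd[OF U] by simp
    then show "\<exists>v\<in>newtonian p \<mu> UNIV. AE x in \<mu>. x \<in> ?Z \<longrightarrow> u x = v x" using v(2) by blast
  qed
  have pd: "removable_dirichlet p \<mu> E" if "supports_poincare p \<mu> ?Z"
    unfolding rd
  proof
    fix u assume "u \<in> dirichlet p \<mu> ?Z"
    then show "\<exists>v\<in>dirichlet p \<mu> UNIV. AE x in \<mu>. x \<in> ?Z \<longrightarrow> u x = v x"
      using dirichlet_extension that unfolding \<mu> by blast
  qed
  have sp: "supports_poincare p \<mu> ?Z" if "path_almost_open p \<mu> ?Z" "removable_sobolev p \<mu> E"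
    using poincare_if_newtonian_extension that(1) that(2)[unfolded rs] spU unfolding \<mu> by blast
  show ?thesis
    unfolding \<Omega> using path_almost_open_if_open[OF p0] ds pd sp by blast
qed

end
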